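(* Let $0<q<1$, $q':=\frac{q}{q-1}$ (so $q'<0$) and $0<\vartheta<\infty$. Let $v,w$ be weights and let $U$ be a $\vartheta$-regular kernel. Then the following assertions are equivalent: (i) There exists a constant $C\in(0,\infty)$ such that the inequality $$\left(\int_0^\infty\left(\int_t^\infty f(x)U(t,x)\,dx\right)^q w(t)\,dt\right)^{\frac1q}\le C\int_0^\infty f(t)v(t)\,dt\qquad( * )$$ holds for all $f\in\mathscr M_+$. (ii) Both conditions $$D_3:=\sup_{\{t_k\}_{k\in\mathbb I}}\ \sum_{k\in\mathbb I_0}\left(\int_{t_{k-1}}^{t_k}w(t)\,dt\right)^{1-q'}\operatorname*{ess\,sup}_{x\in(t_k,t_{k+1})}U^{-q'}(t_k,x)\,v^{q'}(x)<\infty$$ and $$D_4:=\sup_{\{t_k\}_{k\in\mathbb I}}\ \sum_{k\in\mathbb I_0}\left(\int_{t_{k-1}}^{t_k}w(t)U^q(t,t_k)\,dt\right)^{1-q'}\operatorname*{ess\,sup}_{x\in(t_k,t_{k+1})}v^{q'}(x)<\infty$$ are satisfied, where both suprema are taken over all covering sequences $\{t_k\}_{k\in\mathbb I}$. (iii) Both conditions $$A_3:=\int_0^\infty\left(\int_0^t w(x)\,dx\right)^{-q'}w(t)\ \operatorname*{ess\,sup}_{z\in(t,\infty)}U^{-q'}(t,z)\,v^{q'}(z)\,dt<\infty$$ and $$A_4:=\int_0^\infty\left(\int_0^t w(x)U^q(x,t)\,dx\right)^{-q'}w(t)\ \operatorname*{ess\,sup}_{z\in(t,\infty)}U^q(t,z)\,v^{q'}(z)\,dt<\infty$$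 are satisfied. Moreover, if $C$ is the least constant such that $( * )$ holds for all $f\in\mathscr M_+$, then $$C^{-q'}\approx D_3+D_4\approx A_3+A_4.$$
   Context: $\mathscr M_+$ denotes the set of all nonnegative Lebesgue measurable functions on $(0,\infty)$. A weight is a function $w\in\mathscr M_+$ such that $0<\int_0^t w(s)\,ds<\infty$ for all $t>0$. For $\vartheta>0$, a $\vartheta$-regular kernel is a measurable function $U:[0,\infty)^2\to[0,\infty)$ such that: (a) $U(x,y)$ is nonincreasing in $x$ and nondecreasing in $y$; (b) $U(x,z)\le\vartheta\,(U(x,y)+U(y,z))$ for all $0\le x<y<z<\infty$; (c) $U(0,y)>0$ for all $y>0$. For an exponent $\alpha$, $U^\alpha(x,y)$ means $(U(x,y))^\alpha$. An index set is a set $\mathbb I=\{k\in\mathbb Z:\ k_{\min}\le k\le k_{\max}\}$ with $k_{\min}\le k_{\max}$ integers; $\mathbb I_0:=\mathbb I\setminus\{k_{\min},k_{\max}\}$. If $\mathbb I$ is an index set with at least three elements, a sequence $\{t_k\}_{k\in\mathbb I}$ is a covering sequence if $t_{k_{\min}}=0$, $t_{k_{\max}}=\infty$ and $t_k<t_{k+1}$ for all $k\in\mathbb I\setminus\{k_{\max}\}$. $A\lesssim B$ means $A\le cB$ with a constant $c$ depending only on $q,\vartheta$ (in particular not on $v,w$); $A\approx B$ means $A\lesssim B$ and $B\lesssim A$. Values in $[0,\infty]$ are allowed, with the usual convention $0\cdot\infty=0$; $v^{q'}=\infty$ where $v=0$. *)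

theory Defs
  imports "HOL-Analysis.Analysis" "HOL-Probability.Essential_Supremum"
begin

(* Real powers on [0,\<infinity>]: 0 to a negative power is \<infinity> and \<infinity> to a negative power is 0. *)
definition epowr :: "ennreal \<Rightarrow> real \<Rightarrow> ennreal" where
  "epowr x a =
     (if a = 0 then 1
      else if x = 0 then (if a > 0 then 0 else \<infinity>)
      else if x = \<infinity> then (if a > 0 then \<infinity> else 0)
      else ennreal (enn2real x powr a))"

(* Functions on (0,\<infinity>) are total on the reals; their values outside (0,\<infinity>) are never used. *)
definition Mplus :: "(real \<Rightarrow> ennreal) set" where
  "Mplus = borel_measurable (lebesgue_on {0<..})"

definition weight :: "(real \<Rightarrow> ennreal) \<Rightarrow> bool" where
  "weight w \<longleftrightarrow> w \<in> Mplus \<and>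
     (\<forall>t>0. 0 < (\<integral>\<^sup>+s\<in>{0<..<t}. w s \<partial>lebesgue) \<and> (\<integral>\<^sup>+s\<in>{0<..<t}. w s \<partial>lebesgue) < \<infinity>)"

(* The values of U outside [0,\<infinity>) x [0,\<infinity>) are unconstrained and never used. *)
definition regular_kernel :: "real \<Rightarrow> (real \<Rightarrow> real \<Rightarrow> real) \<Rightarrow> bool" where
  "regular_kernel \<theta> U \<longleftrightarrow>
     case_prod U \<in> borel_measurable (lebesgue_on ({0..} \<times> {0..})) \<and>
     (\<forall>x\<ge>0. \<forall>y\<ge>0. 0 \<le> U x y) \<and>
     (\<forall>x x' y. 0 \<le> x \<and> x \<le> x' \<and> 0 \<le> y \<longrightarrow> U x' y \<le> U x y) \<and>
     (\<forall>x y y'. 0 \<le> x \<and> 0 \<le> y \<and> y \<le> y' \<longrightarrow> U x y \<le> U x y') \<and>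
     (\<forall>x y z. 0 \<le> x \<and> x < y \<and> y < z \<longrightarrow> U x z \<le> \<theta> * (U x y + U y z)) \<and>
     (\<forall>y>0. 0 < U 0 y)"

(* The index set is {m..n}; the entries take values in [0,\<infinity>], and only the last one is infinite. *)
definition covering_sequence :: "int \<Rightarrow> int \<Rightarrow> (int \<Rightarrow> ereal) \<Rightarrow> bool" where
  "covering_sequence m n t \<longleftrightarrow>
     m \<le> n \<and> 3 \<le> card {m..n} \<and> t m = 0 \<and> t n = \<infinity> \<and>
     (\<forall>k\<in>{m..n} - {n}. t k < t (k + 1))"

definition conj_exp :: "real \<Rightarrow> real" where
  "conj_exp q = q / (q - 1)"

definition hardy_inequality ::
  "real \<Rightarrow> (real \<Rightarrow> real \<Rightarrow> real) \<Rightarrow> (real \<Rightarrow> ennreal) \<Rightarrow> (real \<Rightarrow> ennreal) \<Rightarrow> ennreal \<Rightarrow> bool" where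
  "hardy_inequality q U v w C \<longleftrightarrow>
     (\<forall>f\<in>Mplus.
        epowr (\<integral>\<^sup>+t\<in>{0<..}.
                 (epowr (\<integral>\<^sup>+x\<in>{t<..}. f x * ennreal (U t x) \<partial>lebesgue) q * w t) \<partial>lebesgue)
              (1 / q)
          \<le> C * (\<integral>\<^sup>+t\<in>{0<..}. (f t * v t) \<partial>lebesgue))"

(* Equal to \<infinity> if the inequality holds with no finite constant. *)
definition least_constant ::
  "real \<Rightarrow> (real \<Rightarrow> real \<Rightarrow> real) \<Rightarrow> (real \<Rightarrow> ennreal) \<Rightarrow> (real \<Rightarrow> ennreal) \<Rightarrow> ennreal" where
  "least_constant q U v w = Inf {C. hardy_inequality q U v w C}"

definition D3 ::
  "real \<Rightarrow> (real \<Rightarrow> real \<Rightarrow> real) \<Rightarrow> (real \<Rightarrow> ennreal) \<Rightarrow> (real \<Rightarrow> ennreal) \<Rightarrow> ennreal" where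
  "D3 q U v w =
     (let q' = conj_exp q in
      SUP (m, n, t) \<in> {(m, n, t). covering_sequence m n t}.
        \<Sum>k\<in>{m..n} - {m, n}.
          epowr (\<integral>\<^sup>+s\<in>einterval (t (k - 1)) (t k). w s \<partial>lebesgue) (1 - q') *
          esssup (lebesgue_on (einterval (t k) (t (k + 1))))
            (\<lambda>x. epowr (ennreal (U (real_of_ereal (t k)) x)) (- q') * epowr (v x) q'))"

definition D4 ::
  "real \<Rightarrow> (real \<Rightarrow> real \<Rightarrow> real) \<Rightarrow> (real \<Rightarrow> ennreal) \<Rightarrow> (real \<Rightarrow> ennreal) \<Rightarrow> ennreal" where
  "D4 q U v w =
     (let q' = conj_exp q in
      SUP (m, n, t) \<in> {(m, n, t). covering_sequence m n t}.
        \<Sum>k\<in>{m..n} - {m, n}.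
          epowr (\<integral>\<^sup>+s\<in>einterval (t (k - 1)) (t k).
                   (w s * epowr (ennreal (U s (real_of_ereal (t k)))) q) \<partial>lebesgue) (1 - q') *
          esssup (lebesgue_on (einterval (t k) (t (k + 1)))) (\<lambda>x. epowr (v x) q'))"

definition A3 ::
  "real \<Rightarrow> (real \<Rightarrow> real \<Rightarrow> real) \<Rightarrow> (real \<Rightarrow> ennreal) \<Rightarrow> (real \<Rightarrow> ennreal) \<Rightarrow> ennreal" where
  "A3 q U v w =
     (let q' = conj_exp q in
      \<integral>\<^sup>+t\<in>{0<..}.
        (epowr (\<integral>\<^sup>+x\<in>{0<..<t}. w x \<partial>lebesgue) (- q') * w t *
         esssup (lebesgue_on {t<..})
           (\<lambda>z. epowr (ennreal (U t z)) (- q') * epowr (v z) q')) \<partial>lebesgue)"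

definition A4 ::
  "real \<Rightarrow> (real \<Rightarrow> real \<Rightarrow> real) \<Rightarrow> (real \<Rightarrow> ennreal) \<Rightarrow> (real \<Rightarrow> ennreal) \<Rightarrow> ennreal" where
  "A4 q U v w =
     (let q' = conj_exp q in
      \<integral>\<^sup>+t\<in>{0<..}.
        (epowr (\<integral>\<^sup>+x\<in>{0<..<t}. (w x * epowr (ennreal (U x t)) q) \<partial>lebesgue) (- q') * w t *
         esssup (lebesgue_on {t<..})
           (\<lambda>z. epowr (ennreal (U t z)) q * epowr (v z) q')) \<partial>lebesgue)"

(* X and Y are functionals of (U, v, w); the constant is uniform in all three. *)
definition equiv_up_to_constant ::
  "real \<Rightarrow> ((real \<Rightarrow> real \<Rightarrow> real) \<Rightarrow> (real \<Rightarrow> ennreal) \<Rightarrow> (real \<Rightarrow> ennreal) \<Rightarrow> ennreal) \<Rightarrow>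
   ((real \<Rightarrow> real \<Rightarrow> real) \<Rightarrow> (real \<Rightarrow> ennreal) \<Rightarrow> (real \<Rightarrow> ennreal) \<Rightarrow> ennreal) \<Rightarrow> bool" where
  "equiv_up_to_constant \<theta> X Y \<longleftrightarrow>
     (\<exists>c::real. 0 < c \<and>
        (\<forall>U v w. regular_kernel \<theta> U \<longrightarrow> weight v \<longrightarrow> weight w \<longrightarrow>
           X U v w \<le> ennreal c * Y U v w \<and> Y U v w \<le> ennreal c * X U v w))"

end

theory Submission
  imports Defs
begin

text \<open>Put \<open>r = - q' = q / (1 - q)\<close>, \<open>u = U\<^sup>q\<close>, \<open>g = v\<^bsup>q'\<^esup>\<close>, \<open>W t = \<integral>\<^sub>0\<^sup>t w\<close> and
  \<open>M t z = \<integral>\<^sub>0\<^sup>t w(s) u(s, z) ds\<close>. The equivalences follow from the cycle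
  \<open>D\<^sub>3 + D\<^sub>4 \<lesssim> C\<^sup>r \<lesssim> A\<^sub>3 + A\<^sub>4 \<lesssim> D\<^sub>3 + D\<^sub>4\<close>.

  The first estimate tests the inequality with a linear combination of functions concentrated on the intervals
  of a covering sequence where the essential suprema are nearly attained.

  For the second, let \<open>S t\<close> be the essential supremum over \<open>z > t\<close> of \<open>g(z) u(t, z) M(z, z)\<^sup>r\<close> and
  \<open>h = S\<^bsup>-1/r\<^esup>\<close>. Then \<open>\<integral>\<^sub>0\<^sup>x U(t, x) h(t) w(t) dt \<le> v(x)\<close> for almost every \<open>x\<close>, so Young's inequality
  and Tonelli's theorem give \<open>C\<^sup>r \<lesssim> \<integral> w S\<close>. Comparing \<open>M(z, z)\<close> with \<open>M(t, z)\<close> and using Tonelli's theorem once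
  more bounds \<open>\<integral> w S\<close> by \<open>A\<^sub>3 + A\<^sub>4\<close>.

  For the third, discretise at points \<open>t\<^sub>k\<close> where \<open>W\<close> grows by a factor \<open>a\<close> so large that the constant of the
  kernel inequality is absorbed. The terms containing the kernel on a single grid interval are bounded by
  \<open>D\<^sub>3\<close>; the remaining ones are summed over greedy blocks of indices along which \<open>M(t\<^sub>k, t\<^sub>k)\<close> stays
  comparable, and the starting points of the blocks yield a covering sequence for \<open>D\<^sub>4\<close>.\<close>

text \<open>The diagonal mass in \<open>S\<close> is forced by the test of \<open>h\<close>: since
  \<open>U = u^(1 + 1/r)\<close>, a bound \<open>h(t) \<le> v(x) u(t,x)^(-1/r) / M(x,x)\<close>
  leaves the integral of \<open>w u\<close>, which is exactly \<open>M(x,x)\<close>, and the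
  quotient becomes \<open>v(x)\<close>. Two obstacles shape the rest. Sums and suprema may be
  infinite and cannot be subtracted, so geometric absorption is phrased as
  \<open>R k + R k \<le> 2 * P k + R (k + 1)\<close>. Moreover, an essential supremum leaves for
  each \<open>t\<close> a null set of exceptional \<open>z\<close> depending on \<open>t\<close>,
  whereas the test of \<open>h\<close> and the bound for \<open>S\<close> fix \<open>z\<close> and
  integrate in \<open>t\<close>. Exchanging the two needs a jointly measurable kernel, which is why
  \<open>u\<close> is first replaced by a right-continuous version.\<close>

lemma epowr_ennreal: "0 \<le> x \<Longrightarrow> 0 < p \<Longrightarrow> epowr (ennreal x) p = ennreal (x powr p)"
  by (auto simp: epowr_def ennreal_eq_0_iff)

lemma epowr_top [simp]: "0 < p \<Longrightarrow> epowr top p = top"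
  by (auto simp: epowr_def)

lemma epowr_zero [simp]: "0 < p \<Longrightarrow> epowr 0 p = 0"
  by (auto simp: epowr_def)

lemma epowr_one [simp]: "epowr x 1 = x"
  by (cases x) (auto simp: epowr_ennreal)

lemma epowr_mono: "0 < p \<Longrightarrow> x \<le> y \<Longrightarrow> epowr x p \<le> epowr y p"
  by (cases x; cases y) (auto simp: epowr_ennreal powr_mono2 top_unique)

lemma epowr_less_top: "0 < p \<Longrightarrow> x < top \<Longrightarrow> epowr x p < top"
  by (cases x) (auto simp: epowr_ennreal)

lemma epowr_pos: "0 < p \<Longrightarrow> 0 < x \<Longrightarrow> 0 < epowr x p"
  by (cases x) (auto simp: epowr_ennreal)

lemma epowr_mult: "0 < p \<Longrightarrow> epowr (x * y) p = epowr x p * epowr y p"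
proof (cases "x = 0 \<or> y = 0")
  case False
  assume "0 < p"
  with False show ?thesis
    by (cases x; cases y)
      (auto simp: epowr_ennreal powr_mult ennreal_mult_top ennreal_top_mult simp flip: ennreal_mult)
qed auto

lemma epowr_epowr: "0 < p \<Longrightarrow> 0 < s \<Longrightarrow> epowr (epowr x p) s = epowr x (p * s)"
  by (cases x) (auto simp: epowr_ennreal powr_powr)

lemma epowr_add: "0 < p \<Longrightarrow> 0 < s \<Longrightarrow> epowr x (p + s) = epowr x p * epowr x s"
  by (cases x) (auto simp: epowr_ennreal powr_add simp flip: ennreal_mult)

lemma epowr_Suc: "0 < p \<Longrightarrow> epowr x (1 + p) = x * epowr x p"
  using epowr_add[of 1 p x] by simp

lemma epowr_max_le: "0 < p \<Longrightarrow> epowr (x + y) p \<le> epowr 2 p * max (epowr x p) (epowr y p)"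
proof -
  assume p: "0 < p"
  have "x + y \<le> 2 * max x y"
    by (metis add_mono max.cobounded1 max.cobounded2 mult_2)
  then have "epowr (x + y) p \<le> epowr 2 p * epowr (max x y) p"
    using epowr_mono[OF p] epowr_mult[OF p] by metis
  also have "epowr (max x y) p = max (epowr x p) (epowr y p)"
    using epowr_mono[OF p] by (metis max.absorb1 max.absorb2 linear)
  finally show ?thesis .
qed

lemma epowr_add_le: "0 < p \<Longrightarrow> epowr (x + y) p \<le> epowr 2 p * (epowr x p + epowr y p)"
  by (rule order_trans[OF epowr_max_le]) (auto intro!: mult_left_mono simp: max_def)

text \<open>After division by \<open>x + y\<close> both quotients lie in [0,1], where
  \<open>z \<le> z powr q\<close>. This carries the kernel inequality from \<open>U\<close> to its
  power \<open>q\<close>.\<close>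

lemma powr_subadd:
  fixes x y :: real
  assumes "0 < q" "q \<le> 1" "0 \<le> x" "0 \<le> y"
  shows "(x + y) powr q \<le> x powr q + y powr q"
proof (cases "x + y = 0")
  case False
  define s where "s = x + y"
  have s: "s > 0" using False assms by (auto simp: s_def)
  have *: "z / s \<le> (z / s) powr q" if "0 \<le> z" "z \<le> s" for z
    using powr_mono'[of q 1 "z / s"] that s assms by auto
  have "1 = x / s + y / s" using s by (simp add: s_def flip: add_divide_distrib)
  also have "\<dots> \<le> (x / s) powr q + (y / s) powr q"
    using assms by (intro add_mono *) (auto simp: s_def)
  also have "\<dots> = (x powr q + y powr q) / s powr q"
    using assms s by (simp add: powr_divide add_divide_distrib)
  finally show ?thesis using s by (simp add: s_def field_simps)
qed (use assms in auto)

lemma measurable_epowr [measurable (raw)]: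
  assumes "f \<in> borel_measurable M"
  shows "(\<lambda>x. epowr (f x) p) \<in> borel_measurable M"
  using assms unfolding epowr_def by measurable

section \<open>Essential suprema, cancellation and measurability in [0,\<infinity>]\<close>

lemma AE_le_esssup:
  fixes f :: "real \<Rightarrow> ennreal"
  assumes "S \<in> sets lebesgue"
  shows "AE x in lebesgue. x \<in> S \<longrightarrow> f x \<le> esssup (lebesgue_on S) f"
proof -
  have "AE x in lebesgue_on S. f x \<le> esssup (lebesgue_on S) f"
    by (rule esssup_AE)
  then show ?thesis using assms by (simp add: AE_restrict_space_iff)
qed

lemma esssup_le:
  fixes f :: "real \<Rightarrow> ennreal"
  assumes "S \<in> sets lebesgue" "f \<in> borel_measurable (lebesgue_on S)"
    and "AE x in lebesgue. x \<in> S \<longrightarrow> f x \<le> B"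
  shows "esssup (lebesgue_on S) f \<le> B"
  using assms by (intro esssup_I) (auto simp: AE_restrict_space_iff)

lemma ennreal_mult_le_iff_le_divide:
  fixes b x y :: ennreal
  shows "b \<noteq> 0 \<Longrightarrow> b < top \<Longrightarrow> b * x \<le> y \<longleftrightarrow> x \<le> y / b"
  using divide_less_ennreal[of b y x] by (simp add: mult.commute flip: not_less)

lemma mult_esssup_le:
  fixes f :: "real \<Rightarrow> ennreal"
  assumes "S \<in> sets lebesgue" "f \<in> borel_measurable (lebesgue_on S)" "b < top"
    and "AE x in lebesgue. x \<in> S \<longrightarrow> b * f x \<le> B"
  shows "b * esssup (lebesgue_on S) f \<le> B"
proof (cases "b = 0")
  case False
  have "esssup (lebesgue_on S) f \<le> B / b"
    using assms(3,4) False
    by (intro esssup_le assms(1,2)) (auto elim!: eventually_mono simp: ennreal_mult_le_iff_le_divide)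
  then show ?thesis using False assms(3) by (simp add: ennreal_mult_le_iff_le_divide)
qed simp

text \<open>Stands in for subtracting \<open>x\<close>, which [0,\<infinity>] permits only for
  finite values; it is applied to values of \<open>W\<close> and \<open>M\<close>.\<close>

lemma ennreal_absorb_half:
  fixes x y :: ennreal
  assumes "x < top" "x + x \<le> x + y"
  shows "x \<le> y"
  using assms by (auto simp: ennreal_add_left_cancel_le)

text \<open>Reduces a bound by \<open>y\<close> to bounds by finite \<open>z > y\<close>. Such
  \<open>z\<close> are also positive, so they may enter quotients and negative powers even when
  \<open>y = 0\<close>.\<close>

lemma ennreal_le_if_less_imp_le:
  fixes x y :: ennreal
  assumes "\<And>z. y < z \<Longrightarrow> z < top \<Longrightarrow> x \<le> z"
  shows "x \<le> y"
proof (rule dense_ge)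
  fix z assume "y < z"
  then show "x \<le> z"
    using assms[of z] by (cases "z = top") (auto simp: less_top)
qed


lemma borel_measurable_superlevel_intervals:
  fixes f :: "real \<Rightarrow> ennreal"
  assumes "\<And>c. is_interval {x \<in> I. c < f x}"
  shows "(\<lambda>x. f x * indicator I x) \<in> borel_measurable borel"
proof (rule borel_measurableI_greater)
  fix c :: ennreal
  have "{x \<in> space borel. c < f x * indicator I x} = {x \<in> I. c < f x}"
    by (auto simp: indicator_def)
  then show "{x \<in> space borel. c < f x * indicator I x} \<in> sets borel"
    by (simp only: real_interval_borel_measurable[OF assms])
qed

lemma borel_measurable_antimono_ennreal:
  fixes f :: "real \<Rightarrow> ennreal"
  assumes "\<And>x y. x \<in> I \<Longrightarrow> y \<in> I \<Longrightarrow> x \<le> y \<Longrightarrow> f y \<le> f x" and "is_interval I"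
  shows "(\<lambda>x. f x * indicator I x) \<in> borel_measurable borel"
proof (rule borel_measurable_superlevel_intervals, unfold is_interval_1, intro ballI allI impI)
  fix c a b x assume x: "a \<in> {x \<in> I. c < f x}" "b \<in> {x \<in> I. c < f x}" "a \<le> x \<and> x \<le> b"
  then have "x \<in> I" using assms(2) unfolding is_interval_1 by blast
  then show "x \<in> {x \<in> I. c < f x}" using assms(1)[of x b] x by (auto intro: less_le_trans)
qed

lemma borel_measurable_mono_ennreal:
  fixes f :: "real \<Rightarrow> ennreal"
  assumes "\<And>x y. x \<in> I \<Longrightarrow> y \<in> I \<Longrightarrow> x \<le> y \<Longrightarrow> f x \<le> f y" and "is_interval I"
  shows "(\<lambda>x. f x * indicator I x) \<in> borel_measurable borel"
proof (rule borel_measurable_superlevel_intervals, unfold is_interval_1, intro ballI allI impI)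
  fix c a b x assume x: "a \<in> {x \<in> I. c < f x}" "b \<in> {x \<in> I. c < f x}" "a \<le> x \<and> x \<le> b"
  then have "x \<in> I" using assms(2) unfolding is_interval_1 by blast
  then show "x \<in> {x \<in> I. c < f x}" using assms(1)[of a x] x by (auto intro: less_le_trans)
qed

text \<open>In effect \<open>R k \<le> P k + R (Suc k) / 2\<close>, and the geometric series sums to
  2. The additive form is the one that the estimates of essential suprema produce.\<close>

lemma sum_le_of_halving_recursion:
  fixes R P :: "nat \<Rightarrow> ennreal"
  assumes "\<And>k. k < n \<Longrightarrow> R k + R k \<le> 2 * P k + R (Suc k)" "R n \<le> P n"
  shows "(\<Sum>k\<le>n. R k) \<le> 2 * (\<Sum>k\<le>n. P k)"
proof -
  \<comment> \<open>The extra \<open>R 0\<close> lets the induction close: it supplies the second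
    copy of \<open>R 0\<close> to the recursion, and the \<open>R 1\<close> released there is
    absorbed by the induction hypothesis.\<close>
  have "R 0 + (\<Sum>k\<le>n. R k) \<le> 2 * (\<Sum>k\<le>n. P k)"
    using assms
  proof (induction n arbitrary: R P)
    case 0
    then show ?case by (simp add: add_mono mult_2)
  next
    case (Suc n)
    have IH: "R 1 + (\<Sum>k\<le>n. R (Suc k)) \<le> 2 * (\<Sum>k\<le>n. P (Suc k))"
      using Suc.IH[of "\<lambda>k. R (Suc k)" "\<lambda>k. P (Suc k)"] Suc.prems by auto
    have "R 0 + (\<Sum>k\<le>Suc n. R k) = R 0 + R 0 + (\<Sum>k\<le>n. R (Suc k))"
      by (simp add: sum.atMost_Suc_shift add.assoc del: sum.atMost_Suc)
    also have "\<dots> \<le> 2 * P 0 + R 1 + (\<Sum>k\<le>n. R (Suc k))"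
      using Suc.prems(1)[of 0] by (intro add_right_mono) auto
    also have "\<dots> \<le> 2 * P 0 + 2 * (\<Sum>k\<le>n. P (Suc k))"
      using IH by (simp add: add.assoc add_left_mono)
    also have "\<dots> = 2 * (\<Sum>k\<le>Suc n. P k)"
      by (simp add: sum.atMost_Suc_shift distrib_left del: sum.atMost_Suc)
    finally show ?case .
  qed
  then show ?thesis
    by (rule order_trans[rotated]) simp
qed

section \<open>Interval integrals and sums over covering sequences\<close>

lemma sets_lebesgue_interval [measurable]:
  fixes a b :: real
  shows "{a<..<b} \<in> sets lebesgue" "{a<..} \<in> sets lebesgue"
  by simp_all

lemma AE_lebesgue_neq: "AE s in lebesgue. s \<noteq> (x::real)"
  by (rule AE_completion) (rule AE_lborel_singleton)

lemma set_nn_integral_split: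
  fixes f :: "real \<Rightarrow> ennreal"
  assumes [measurable]: "f \<in> borel_measurable lebesgue" and "a \<le> x" "x \<le> b"
  shows "(\<integral>\<^sup>+s\<in>{a<..<b}. f s \<partial>lebesgue) =
    (\<integral>\<^sup>+s\<in>{a<..<x}. f s \<partial>lebesgue) + (\<integral>\<^sup>+s\<in>{x<..<b}. f s \<partial>lebesgue)"
proof -
  have "(\<integral>\<^sup>+s\<in>{a<..<b}. f s \<partial>lebesgue) =
    (\<integral>\<^sup>+s. f s * indicator {a<..<x} s + f s * indicator {x<..<b} s \<partial>lebesgue)"
    using assms(2,3) AE_lebesgue_neq[of x]
    by (intro nn_integral_cong_AE) (auto elim!: eventually_mono simp: indicator_def)
  also have "\<dots> = (\<integral>\<^sup>+s\<in>{a<..<x}. f s \<partial>lebesgue) + (\<integral>\<^sup>+s\<in>{x<..<b}. f s \<partial>lebesgue)"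
    by (intro nn_integral_add) auto
  finally show ?thesis .
qed

lemma set_nn_integral_mono_set:
  assumes "A \<subseteq> B"
  shows "(\<integral>\<^sup>+s\<in>A. f s \<partial>M) \<le> (\<integral>\<^sup>+s\<in>B. f s \<partial>M)"
  using assms by (intro nn_integral_mono) (auto simp: indicator_def)

text \<open>The common shape of \<open>D3\<close> and \<open>D4\<close>: each summand sees only
  three consecutive points of the covering sequence.\<close>

definition cover_sup :: "(ereal \<Rightarrow> ereal \<Rightarrow> ereal \<Rightarrow> ennreal) \<Rightarrow> ennreal" where
  "cover_sup F = (SUP (m, n, t) \<in> {(m, n, t). covering_sequence m n t}.
     \<Sum>k\<in>{m..n} - {m, n}. F (t (k - 1)) (t k) (t (k + 1)))"

lemma covering_sequence_sum_le:
  fixes F :: "ereal \<Rightarrow> ereal \<Rightarrow> ereal \<Rightarrow> ennreal"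
  assumes "X 0 = 0" "X (Suc n) = \<infinity>" "\<And>k. k \<le> n \<Longrightarrow> X k < X (Suc k)"
  shows "(\<Sum>k=1..n. F (X (k-1)) (X k) (X (k+1))) \<le> cover_sup F"
\<comment> \<open>A covering sequence has at least three points, so \<open>n = 0\<close> yields
  none; the sum is then empty.\<close>
proof (cases "n = 0")
  case False
  define t where "t = (\<lambda>k. X (nat k))"
  have cov: "covering_sequence 0 (int (Suc n)) t"
    unfolding covering_sequence_def
  proof (intro conjI ballI)
    show "0 \<le> int (Suc n)" "3 \<le> card {0..int (Suc n)}" using False by auto
    show "t 0 = 0" "t (int (Suc n)) = \<infinity>" using assms by (simp_all add: t_def nat_add_distrib)
    show "t k < t (k + 1)" if "k \<in> {0..int (Suc n)} - {int (Suc n)}" for k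
    proof -
      have "nat (k + 1) = Suc (nat k)" "nat k \<le> n" using that by auto
      then show ?thesis using assms(3) by (simp add: t_def)
    qed
  qed
  have *: "{0..int (Suc n)} - {0, int (Suc n)} = int ` {1..n}"
  proof (intro equalityI subsetI)
    fix k assume "k \<in> {0..int (Suc n)} - {0, int (Suc n)}"
    then have "k = int (nat k)" "nat k \<in> {1..n}" by auto
    then show "k \<in> int ` {1..n}" by blast
  qed auto
  have "(\<Sum>k=1..n. F (X (k-1)) (X k) (X (k+1))) =
      (\<Sum>k\<in>{0..int (Suc n)} - {0, int (Suc n)}. F (t (k - 1)) (t k) (t (k + 1)))"
    unfolding * by (subst sum.reindex) (auto simp: t_def nat_add_distrib nat_diff_distrib intro!: sum.cong)
  also have "\<dots> \<le> cover_sup F"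
    unfolding cover_sup_def using cov by (intro SUP_upper2[of "(0, int (Suc n), t)"]) auto
  finally show ?thesis .
qed simp

lemma sum_even_odd:
  fixes f :: "nat \<Rightarrow> ennreal"
  shows "(\<Sum>k=1..n. f k) = (\<Sum>j=1..n div 2. f (2 * j)) + (\<Sum>j=1..(n + 1) div 2. f (2 * j - 1))"
proof (induction n)
  case (Suc n)
  show ?case
  proof (cases "even n")
    case True
    then have "Suc n div 2 = n div 2" "(Suc n + 1) div 2 = Suc (n div 2)" "(n + 1) div 2 = n div 2"
      "2 * (n div 2) = n"
      by auto
    then show ?thesis using Suc by (simp add: add.assoc)
  next
    case False
    then have "Suc n div 2 = Suc (n div 2)" "(Suc n + 1) div 2 = Suc (n div 2)" "(n + 1) div 2 = Suc (n div 2)"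
      "2 * (n div 2) = n - 1" "n > 0"
      by (auto elim!: oddE)
    then show ?thesis using Suc by (simp add: ac_simps)
  qed
qed simp

text \<open>The left endpoint lies two steps back, so the points of even index and those of odd
  index each form a covering sequence. The price is a right endpoint two steps ahead, which
  \<open>mono\<close> allows. Truncated subtraction puts \<open>X 0 = 0\<close> in front of the odd
  points, and \<open>X\<close> is infinite at every index beyond \<open>n\<close> because a step of
  two may jump over \<open>n + 1\<close>.\<close>

lemma covering_sequence_step2_sum_le:
  fixes F :: "ereal \<Rightarrow> ereal \<Rightarrow> ereal \<Rightarrow> ennreal"
  assumes "X 0 = 0" "\<And>k. k > n \<Longrightarrow> X k = \<infinity>" "\<And>k. k \<le> n \<Longrightarrow> X k < X (Suc k)"
    and mono: "\<And>a b e e'. e \<le> e' \<Longrightarrow> F a b e \<le> F a b e'"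
  shows "(\<Sum>k=1..n. F (X (k-2)) (X k) (X (k+1))) \<le> 2 * cover_sup F" (is "_ \<le> 2 * ?S")
proof -
  have le: "X k \<le> X (Suc k)" for k
    using assms(2,3)[of k] assms(2)[of "Suc k"] by (cases "k \<le> n") auto
  have less: "X k < X (k + 2)" if "k \<le> n" for k
    using assms(3)[OF that] le[of "Suc k"] by simp
  have even: "(\<Sum>j=1..n div 2. F (X (2*j - 2)) (X (2*j)) (X (2*j + 2))) \<le> ?S"
  proof -
    have "(\<Sum>j=1..n div 2. F (X (2*(j-1))) (X (2*j)) (X (2*(j+1)))) \<le> ?S"
    proof (rule covering_sequence_sum_le[where X = "\<lambda>j. X (2 * j)"])
      show "X (2 * Suc (n div 2)) = \<infinity>" by (intro assms(2)) presburger
      show "X (2 * k) < X (2 * Suc k)" if "k \<le> n div 2" for k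
        using less[of "2 * k"] that by auto
    qed (use assms in simp)
    then show ?thesis by (simp add: diff_mult_distrib2)
  qed
  have odd: "(\<Sum>j=1..(n+1) div 2. F (X (2*j - 1 - 2)) (X (2*j - 1)) (X (2*j - 1 + 2))) \<le> ?S"
  proof -
    have "(\<Sum>j=1..(n+1) div 2. F (X (2*(j-1) - 1)) (X (2*j - 1)) (X (2*(j+1) - 1))) \<le> ?S"
    proof (rule covering_sequence_sum_le[where X = "\<lambda>j. X (2 * j - 1)"])
      show "X (2 * Suc ((n+1) div 2) - 1) = \<infinity>" by (intro assms(2)) presburger
      show "X (2 * k - 1) < X (2 * Suc k - 1)" if "k \<le> (n+1) div 2" for k
      proof (cases "k = 0")
        case True
        then show ?thesis using assms(3)[of 0] by simp
      next
        case False
        then have "2 * Suc k - 1 = (2 * k - 1) + 2" "2 * k - 1 \<le> n" using that by auto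
        then show ?thesis using less[of "2 * k - 1"] by simp
      qed
    qed (use assms in simp)
    also have "(\<Sum>j=1..(n+1) div 2. F (X (2*(j-1) - 1)) (X (2*j - 1)) (X (2*(j+1) - 1))) =
       (\<Sum>j=1..(n+1) div 2. F (X (2*j - 1 - 2)) (X (2*j - 1)) (X (2*j - 1 + 2)))"
    proof (intro sum.cong refl)
      fix j assume "j \<in> {1..(n+1) div 2}"
      then have "2*(j-1) - 1 = 2*j - 1 - 2" "2*(j+1) - 1 = 2*j - 1 + 2" by auto
      then show "F (X (2*(j-1) - 1)) (X (2*j - 1)) (X (2*(j+1) - 1)) =
        F (X (2*j - 1 - 2)) (X (2*j - 1)) (X (2*j - 1 + 2))" by metis
    qed
    finally show ?thesis .
  qed
  have "(\<Sum>k=1..n. F (X (k-2)) (X k) (X (k+1))) \<le> (\<Sum>k=1..n. F (X (k-2)) (X k) (X (k+2)))"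
    using le by (intro sum_mono mono) simp
  also have "\<dots> = (\<Sum>j=1..n div 2. F (X (2*j - 2)) (X (2*j)) (X (2*j + 2))) +
      (\<Sum>j=1..(n+1) div 2. F (X (2*j - 1 - 2)) (X (2*j - 1)) (X (2*j - 1 + 2)))"
    by (rule sum_even_odd)
  also have "\<dots> \<le> ?S + ?S" using even odd by (rule add_mono)
  finally show ?thesis by (simp add: mult_2)
qed

section \<open>The rescaled data and the functions \<open>W\<close> and \<open>M\<close>\<close>

lemma einterval_sets_lebesgue [measurable, simp]: "einterval a b \<in> sets lebesgue"
  using borel_einterval by (metis sets_completionI_sets sets_lborel)

text \<open>With \<open>u = U^q\<close> and \<open>g = v^q'\<close> the exponents become
  \<open>1 - q' = 1 + r\<close>, \<open>U^(-q') = u^(1 + r)\<close> and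
  \<open>U = u^(1 + 1/r)\<close>. The bound in \<open>u_bounded\<close> is uniform in the first
  argument because \<open>U 0 y\<close> dominates \<open>U x y\<close>; it makes \<open>M\<close>
  finite.\<close>

locale hardy_data =
  fixes r c :: real and u :: "real \<Rightarrow> real \<Rightarrow> ennreal" and w g :: "real \<Rightarrow> ennreal"
  assumes r_pos: "0 < r" and c_ge_1: "1 \<le> c"
    and w_meas [measurable]: "w \<in> borel_measurable lebesgue"
    and g_meas [measurable]: "g \<in> borel_measurable lebesgue"
    and W_pos: "\<And>t. 0 < t \<Longrightarrow> 0 < (\<integral>\<^sup>+s\<in>{0<..<t}. w s \<partial>lebesgue)"
    and W_finite: "\<And>t. (\<integral>\<^sup>+s\<in>{0<..<t}. w s \<partial>lebesgue) < top"
    and u_zero: "\<And>x y. x \<le> 0 \<or> y \<le> 0 \<Longrightarrow> u x y = 0"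
    and u_anti: "\<And>x x' y. 0 < x \<Longrightarrow> x \<le> x' \<Longrightarrow> u x' y \<le> u x y"
    and u_mono: "\<And>x y y'. y \<le> y' \<Longrightarrow> u x y \<le> u x y'"
    and u_triangle: "\<And>x y z. 0 < x \<Longrightarrow> x < y \<Longrightarrow> y < z \<Longrightarrow> u x z \<le> ennreal c * (u x y + u y z)"
    and u_bounded: "\<And>y. \<exists>B<top. \<forall>x. u x y \<le> B"
begin

definition W :: "real \<Rightarrow> ennreal" where
  "W t = (\<integral>\<^sup>+s\<in>{0<..<t}. w s \<partial>lebesgue)"

definition M :: "real \<Rightarrow> real \<Rightarrow> ennreal" where
  "M t z = (\<integral>\<^sup>+s\<in>{0<..<t}. (w s * u s z) \<partial>lebesgue)"

definition tail_ess :: "real \<Rightarrow> ennreal" where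
  "tail_ess t = esssup (lebesgue_on {t<..}) g"

definition d3 :: "ereal \<Rightarrow> ereal \<Rightarrow> ereal \<Rightarrow> ennreal" where
  "d3 a b e = epowr (\<integral>\<^sup>+s\<in>einterval a b. w s \<partial>lebesgue) (1 + r) *
     esssup (lebesgue_on (einterval b e)) (\<lambda>x. epowr (u (real_of_ereal b) x) (1 + r) * g x)"

definition d4 :: "ereal \<Rightarrow> ereal \<Rightarrow> ereal \<Rightarrow> ennreal" where
  "d4 a b e = epowr (\<integral>\<^sup>+s\<in>einterval a b. (w s * u s (real_of_ereal b)) \<partial>lebesgue) (1 + r) *
     esssup (lebesgue_on (einterval b e)) g"

definition DD3 :: ennreal where "DD3 = cover_sup d3"

definition DD4 :: ennreal where "DD4 = cover_sup d4"

lemma r1_pos: "0 < 1 + r"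
  using r_pos by simp

lemma u_measurable1 [measurable]: "(\<lambda>x. u x y) \<in> borel_measurable borel"
proof -
  have "(\<lambda>x. u x y * indicator {0<..} x) \<in> borel_measurable borel"
    by (intro borel_measurable_antimono_ennreal) (auto intro: u_anti is_interval_io)
  also have "(\<lambda>x. u x y * indicator {0<..} x) = (\<lambda>x. u x y)"
    by (auto simp: fun_eq_iff indicator_def u_zero)
  finally show ?thesis .
qed

lemma u_measurable2 [measurable]: "(\<lambda>y. u x y) \<in> borel_measurable borel"
  using borel_measurable_mono_ennreal[of UNIV "u x"] by (simp add: u_mono)

lemma u_measurable_lebesgue [measurable]:
  "(\<lambda>x. u x y) \<in> borel_measurable lebesgue" "(\<lambda>y. u x y) \<in> borel_measurable lebesgue"
  by (simp_all add: measurable_completion)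

lemma u_finite: "u x y < top"
  using u_bounded[of y] by (auto intro: le_less_trans)

lemma u_triangle': "0 < x \<Longrightarrow> x \<le> y \<Longrightarrow> y \<le> z \<Longrightarrow> u x z \<le> ennreal c * (u x y + u y z)"
proof -
  assume xyz: "0 < x" "x \<le> y" "y \<le> z"
  have 1: "(1::ennreal) \<le> ennreal c" using c_ge_1 by simp
  have "u x z \<le> u x y + u y z" if "x = y \<or> y = z" using that by auto
  also have "u x y + u y z \<le> ennreal c * (u x y + u y z)"
    using mult_right_mono[OF 1, of "u x y + u y z"] by simp
  finally show ?thesis using xyz u_triangle[of x y z] by fastforce
qed

lemma W_mono: "s \<le> t \<Longrightarrow> W s \<le> W t"
  unfolding W_def by (intro set_nn_integral_mono_set) auto

lemma W_less_top: "W t < top"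
  unfolding W_def by (rule W_finite)

lemma M_mono1: "s \<le> t \<Longrightarrow> M s z \<le> M t z"
  unfolding M_def by (intro set_nn_integral_mono_set) auto

lemma M_mono2: "y \<le> z \<Longrightarrow> M t y \<le> M t z"
  unfolding M_def by (intro nn_integral_mono mult_right_mono mult_left_mono u_mono) auto

lemma M_less_top: "M t z < top"
proof -
  obtain B where B: "B < top" "\<And>x. u x z \<le> B" using u_bounded[of z] by auto
  have "M t z \<le> (\<integral>\<^sup>+s. B * (w s * indicator {0<..<t} s) \<partial>lebesgue)"
    unfolding M_def using mult_left_mono[OF B(2), of "w _"]
    by (intro nn_integral_mono) (auto simp: indicator_def mult.commute[of B])
  also have "\<dots> = B * W t" unfolding W_def by (intro nn_integral_cmult) auto
  also have "\<dots> < top" using B W_less_top by (simp add: ennreal_mult_less_top)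
  finally show ?thesis .
qed

lemma W_u_le_M: "0 < x \<Longrightarrow> W x * u x z \<le> M x z"
proof -
  assume x: "0 < x"
  have "W x * u x z = (\<integral>\<^sup>+s. (w s * indicator {0<..<x} s) * u x z \<partial>lebesgue)"
    unfolding W_def by (intro nn_integral_multc[symmetric]) auto
  also have "\<dots> \<le> M x z" unfolding M_def
    by (intro nn_integral_mono) (auto simp: indicator_def intro!: mult_left_mono u_anti)
  finally show ?thesis .
qed

lemma M_triangle: "t \<le> y \<Longrightarrow> y \<le> z \<Longrightarrow> M t z \<le> ennreal c * (M t y + W t * u y z)"
proof -
  assume yz: "t \<le> y" "y \<le> z"
  have "M t z \<le> (\<integral>\<^sup>+s. ennreal c * ((w s * u s y) * indicator {0<..<t} s + (w s * indicator {0<..<t} s) * u y z) \<partial>lebesgue)"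
    unfolding M_def
  proof (intro nn_integral_mono)
    fix s
    show "w s * u s z * indicator {0<..<t} s \<le> ennreal c * ((w s * u s y) * indicator {0<..<t} s + (w s * indicator {0<..<t} s) * u y z)"
      using mult_left_mono[OF u_triangle'[of s y z], of "w s"] yz
      by (auto simp: indicator_def distrib_left ac_simps)
  qed
  also have "\<dots> = ennreal c * (M t y + W t * u y z)"
    unfolding M_def W_def
    by (simp add: nn_integral_cmult nn_integral_add nn_integral_multc)
  finally show ?thesis .
qed

lemma M_diag_mono: "s \<le> t \<Longrightarrow> M s s \<le> M t t"
  using M_mono1 M_mono2 by (meson order_trans)

lemma W_measurable_borel [measurable]: "W \<in> borel_measurable borel"
  using borel_measurable_mono_ennreal[of UNIV W] by (simp add: W_mono)

lemma M_diag_measurable_borel [measurable]: "(\<lambda>t. M t t) \<in> borel_measurable borel"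
  using borel_measurable_mono_ennreal[of UNIV "\<lambda>t. M t t"] by (simp add: M_diag_mono)

lemma W_measurable [measurable]: "W \<in> borel_measurable lebesgue"
  by (simp add: measurable_completion)

lemma M_diag_measurable [measurable]: "(\<lambda>t. M t t) \<in> borel_measurable lebesgue"
  by (simp add: measurable_completion)

lemma tail_ess_antimono: "s \<le> t \<Longrightarrow> tail_ess t \<le> tail_ess s"
proof -
  assume "s \<le> t"
  have "AE x in lebesgue. x \<in> {s<..} \<longrightarrow> g x \<le> tail_ess s"
    unfolding tail_ess_def by (intro AE_le_esssup) auto
  then show ?thesis using \<open>s \<le> t\<close>
    unfolding tail_ess_def[of t] by (intro esssup_le) (auto elim!: eventually_mono simp: measurable_restrict_space1)
qed

end

lemma esssup_mono_set:
  fixes f :: "real \<Rightarrow> ennreal"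
  assumes "S \<in> sets lebesgue" "T \<in> sets lebesgue" "f \<in> borel_measurable lebesgue" "S \<subseteq> T"
  shows "esssup (lebesgue_on S) f \<le> esssup (lebesgue_on T) f"
proof (rule esssup_le)
  show "AE x in lebesgue. x \<in> S \<longrightarrow> f x \<le> esssup (lebesgue_on T) f"
    using AE_le_esssup[OF assms(2), of f] assms(4) by (auto elim!: eventually_mono)
qed (use assms in \<open>auto simp: measurable_restrict_space1\<close>)

lemma einterval_ereal_simps [simp]:
  "einterval 0 (ereal b) = {0<..<b}"
  "einterval (ereal a) (ereal b) = {a<..<b}"
  "einterval (ereal a) \<infinity> = {a<..}"
  by (auto simp: einterval_def zero_ereal_def)

context hardy_data
begin

lemma d4_mono: "e \<le> e' \<Longrightarrow> d4 a b e \<le> d4 a b e'"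
  unfolding d4_def
  by (intro mult_left_mono esssup_mono_set) (auto simp: einterval_def)

text \<open>Split \<open>M z z\<close> at \<open>x\<close> and apply the kernel inequality through
  \<open>y\<close> to the part below \<open>x\<close>. The term with \<open>M y y\<close> is
  absorbed, being at most \<open>M z z / (2 * c)\<close>. The term \<open>W x * u y z\<close> is
  local: by doubling, (x,y) carries at least the mass \<open>W x\<close>, and
  \<open>u s z \<ge> u y z\<close> there. The intermediate point \<open>y\<close> is the reason why
  sums with a step of two appear.\<close>

lemma M_le_local:
  assumes "0 < x" "x < y" "y < z" "2 * W x \<le> W y" "ennreal (2 * c) * M y y \<le> M z z"
  shows "M z z \<le> ennreal (2 * (1 + c)) * (\<integral>\<^sup>+s\<in>{x<..<z}. (w s * u s z) \<partial>lebesgue)"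
proof -
  define L where "L = (\<integral>\<^sup>+s\<in>{x<..<z}. (w s * u s z) \<partial>lebesgue)"
  have "W y = W x + (\<integral>\<^sup>+s\<in>{x<..<y}. w s \<partial>lebesgue)"
    unfolding W_def using assms by (intro set_nn_integral_split) auto
  then have "W x + W x \<le> W x + (\<integral>\<^sup>+s\<in>{x<..<y}. w s \<partial>lebesgue)"
    using assms(4) unfolding mult_2 by simp
  then have "W x \<le> (\<integral>\<^sup>+s\<in>{x<..<y}. w s \<partial>lebesgue)"
    by (rule ennreal_absorb_half[OF W_less_top])
  then have "W x * u y z \<le> (\<integral>\<^sup>+s\<in>{x<..<y}. w s \<partial>lebesgue) * u y z"
    by (intro mult_right_mono) auto
  also have "\<dots> = (\<integral>\<^sup>+s. (w s * indicator {x<..<y} s) * u y z \<partial>lebesgue)"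
    by (intro nn_integral_multc[symmetric]) auto
  also have "\<dots> \<le> L" unfolding L_def
    using assms by (intro nn_integral_mono) (auto simp: indicator_def intro!: mult_left_mono u_anti)
  finally have 1: "W x * u y z \<le> L" .
  have "M z z = M x z + L"
    unfolding M_def L_def using assms by (intro set_nn_integral_split) auto
  also have "M x z \<le> ennreal c * (M x y + W x * u y z)"
    using assms by (intro M_triangle) auto
  also have "M x y \<le> M y y" using assms by (intro M_mono1) auto
  also note 1
  finally have "M z z \<le> ennreal c * (M y y + L) + L"
    by (simp add: add_mono mult_mono)
  then have "2 * M z z \<le> 2 * (ennreal c * (M y y + L) + L)"
    by (intro mult_left_mono) auto
  also have "\<dots> = 2 * ennreal c * M y y + (2 * ennreal c + 2) * L"
    by (simp only: distrib_left distrib_right mult.assoc add.assoc)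
  also have "2 * ennreal c = ennreal (2 * c)" using c_ge_1 by (simp add: ennreal_mult)
  also have "ennreal (2 * c) + 2 = ennreal (2 * (1 + c))" using c_ge_1 by (simp add: distrib_left)
  also have "ennreal (2 * c) * M y y + ennreal (2 * (1 + c)) * L \<le> M z z + ennreal (2 * (1 + c)) * L"
    using assms(5) by (rule add_right_mono)
  finally have "M z z + M z z \<le> M z z + ennreal (2 * (1 + c)) * L" unfolding mult_2 .
  then show ?thesis unfolding L_def[symmetric] by (rule ennreal_absorb_half[OF M_less_top])
qed

lemma tail_ess_split:
  assumes "x < y"
  shows "tail_ess x \<le> esssup (lebesgue_on {x<..<y}) g + tail_ess y"
  unfolding tail_ess_def[of x]
proof (rule esssup_le)
  have "AE s in lebesgue. s \<in> {x<..<y} \<longrightarrow> g s \<le> esssup (lebesgue_on {x<..<y}) g"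
    by (intro AE_le_esssup) auto
  moreover have "AE s in lebesgue. s \<in> {y<..} \<longrightarrow> g s \<le> tail_ess y"
    unfolding tail_ess_def by (intro AE_le_esssup) auto
  ultimately show "AE s in lebesgue. s \<in> {x<..} \<longrightarrow> g s \<le> esssup (lebesgue_on {x<..<y}) g + tail_ess y"
    using AE_lebesgue_neq[of y]
    by eventually_elim (auto intro: add_increasing add_increasing2)
qed (auto simp: measurable_restrict_space1)

text \<open>Since \<open>M (x k) (x k)\<close> at least doubles, so does its power
  \<open>1 + r\<close>, and the halving recursion trades the tail suprema for suprema over single
  intervals. \<open>M_le_local\<close> then makes the first factor local. The 4 is 2 from the
  recursion times 2 from the even and odd indices.\<close>

lemma separated_sum_le:
  fixes x :: "nat \<Rightarrow> real"
  assumes pos: "\<And>k. 1 \<le> k \<Longrightarrow> k \<le> n \<Longrightarrow> 0 < x k"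
    and inc: "\<And>k. 1 \<le> k \<Longrightarrow> k < n \<Longrightarrow> x k < x (Suc k)"
    and W2: "\<And>k. 1 \<le> k \<Longrightarrow> k < n \<Longrightarrow> 2 * W (x k) \<le> W (x (Suc k))"
    and Mc: "\<And>k. 1 \<le> k \<Longrightarrow> k < n \<Longrightarrow> ennreal (2 * c) * M (x k) (x k) \<le> M (x (Suc k)) (x (Suc k))"
  shows "(\<Sum>k=1..n. epowr (M (x k) (x k)) (1 + r) * tail_ess (x k))
    \<le> 4 * epowr (ennreal (2 * (1 + c))) (1 + r) * DD4"
proof (cases n)
  case (Suc n')
  define X where "X k = (if k = 0 then 0 else if k \<le> n then ereal (x k) else \<infinity>)" for k
  define R where "R k = epowr (M (x k) (x k)) (1 + r) * tail_ess (x k)" for k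
  define V where "V k = esssup (lebesgue_on (einterval (X k) (X (k + 1)))) g" for k
  define P where "P k = epowr (M (x k) (x k)) (1 + r) * V k" for k
  define C where "C = ennreal (2 * (1 + c))"
  have halve: "R k + R k \<le> 2 * P k + R (Suc k)" if k: "1 \<le> k" "k < n" for k
  proof -
    have "R k \<le> P k + epowr (M (x k) (x k)) (1 + r) * tail_ess (x (Suc k))"
      using tail_ess_split[OF inc[OF k]] k mult_left_mono[of "tail_ess (x k)" "V k + tail_ess (x (Suc k))"]
      by (simp add: R_def P_def V_def X_def flip: distrib_left)
    note add_mono[OF this this]
    also have "P k + epowr (M (x k) (x k)) (1 + r) * tail_ess (x (Suc k)) +
      (P k + epowr (M (x k) (x k)) (1 + r) * tail_ess (x (Suc k))) =
      2 * P k + (2 * epowr (M (x k) (x k)) (1 + r)) * tail_ess (x (Suc k))"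
      unfolding mult_2 distrib_right by (simp only: ac_simps)
    finally have "R k + R k \<le> 2 * P k + (2 * epowr (M (x k) (x k)) (1 + r)) * tail_ess (x (Suc k))"
      .
    also have "2 * epowr (M (x k) (x k)) (1 + r) \<le> epowr (M (x (Suc k)) (x (Suc k))) (1 + r)"
    proof -
      have "(2::ennreal) = ennreal (2 powr 1)" by simp
      also have "\<dots> \<le> ennreal (2 powr (1 + r))" using r_pos by (intro ennreal_leI powr_mono) auto
      also have "\<dots> = epowr 2 (1 + r)" using r1_pos epowr_ennreal[of 2 "1 + r"] by simp
      finally have "2 * epowr (M (x k) (x k)) (1 + r) \<le> epowr 2 (1 + r) * epowr (M (x k) (x k)) (1 + r)"
        by (rule mult_right_mono) simp
      also have "\<dots> = epowr (2 * M (x k) (x k)) (1 + r)" using r1_pos by (simp add: epowr_mult)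
      also have "2 * M (x k) (x k) \<le> ennreal (2 * c) * M (x k) (x k)"
        using c_ge_1 ennreal_leI[of 2 "2 * c"] by (intro mult_right_mono) auto
      also note Mc[OF k]
      finally show ?thesis using r1_pos by (simp add: epowr_mono)
    qed
    finally show ?thesis by (simp add: R_def mult_right_mono)
  qed
  have "(\<Sum>k=1..n. R k) = (\<Sum>k\<le>n'. R (Suc k))"
    by (simp only: Suc One_nat_def sum.atLeast1_atMost_eq lessThan_Suc_atMost)
  also have "\<dots> \<le> 2 * (\<Sum>k\<le>n'. P (Suc k))"
  proof (rule sum_le_of_halving_recursion)
    have "V n = tail_ess (x n)" using Suc by (simp add: V_def X_def tail_ess_def)
    then show "R (Suc n') \<le> P (Suc n')" using Suc by (simp add: R_def P_def)
  qed (use halve Suc in auto)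
  also have "(\<Sum>k\<le>n'. P (Suc k)) = (\<Sum>k=1..n. P k)"
    by (simp only: Suc One_nat_def sum.atLeast1_atMost_eq lessThan_Suc_atMost)
  also have "\<dots> \<le> (\<Sum>k=1..n. epowr C (1 + r) * d4 (X (k-2)) (X k) (X (k+1)))"
  proof (rule sum_mono)
    fix k assume k: "k \<in> {1..n}"
    have "M (x k) (x k) \<le> C * (\<integral>\<^sup>+s\<in>einterval (X (k-2)) (X k). (w s * u s (x k)) \<partial>lebesgue)"
    proof (cases "k \<le> 2")
      case True
      have 1: "1 \<le> C" using c_ge_1 ennreal_leI[of 1 "2 * (1 + c)"] unfolding C_def ennreal_1 by argo
      show ?thesis using True k mult_right_mono[OF 1, of "M (x k) (x k)"]
        by (simp add: X_def M_def)
    next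
      case False
      then have k': "Suc (k - 2) = k - 1" "Suc (k - 1) = k" "1 \<le> k - 2" "k - 2 < n" "1 \<le> k - 1" "k - 1 < n"
        using k by auto
      then have X: "X (k - 2) = ereal (x (k - 2))" "X k = ereal (x k)" using k by (auto simp: X_def)
      show ?thesis unfolding X einterval_ereal_simps C_def
        using inc[OF k'(3,4)] inc[OF k'(5,6)] W2[OF k'(3,4)] Mc[OF k'(5,6)] pos[of "k - 2"] k'
        by (intro M_le_local[of "x (k-2)" "x (k-1)"]) auto
    qed
    then have "epowr (M (x k) (x k)) (1 + r) \<le>
      epowr (C * (\<integral>\<^sup>+s\<in>einterval (X (k-2)) (X k). (w s * u s (x k)) \<partial>lebesgue)) (1 + r)"
      by (rule epowr_mono[OF r1_pos])
    then have "P k \<le> epowr C (1 + r) *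
        epowr (\<integral>\<^sup>+s\<in>einterval (X (k-2)) (X k). (w s * u s (x k)) \<partial>lebesgue) (1 + r) * V k"
      unfolding P_def epowr_mult[OF r1_pos] by (rule mult_right_mono) simp
    moreover have "real_of_ereal (X k) = x k" using k by (simp add: X_def)
    ultimately show "P k \<le> epowr C (1 + r) * d4 (X (k-2)) (X k) (X (k+1))"
      by (simp add: d4_def V_def mult.assoc)
  qed
  also have "\<dots> = epowr C (1 + r) * (\<Sum>k=1..n. d4 (X (k-2)) (X k) (X (k+1)))"
    by (simp add: sum_distrib_left)
  also have "(\<Sum>k=1..n. d4 (X (k-2)) (X k) (X (k+1))) \<le> 2 * DD4"
    unfolding DD4_def
  proof (rule covering_sequence_step2_sum_le)
    show "X k < X (Suc k)" if "k \<le> n" for k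
      using that pos[of 1] inc[of k] Suc by (auto simp: X_def)
  qed (auto simp: X_def d4_mono)
  finally have "(\<Sum>k=1..n. R k) \<le> 2 * (epowr C (1 + r) * (2 * DD4))"
    by (simp add: mult_left_mono)
  also have "\<dots> = 4 * epowr C (1 + r) * DD4"
  proof -
    have "(4::ennreal) = 2 * 2" by simp
    then show ?thesis by (metis mult.left_commute mult.assoc)
  qed
  finally show ?thesis by (simp add: R_def C_def)
qed simp

end

section \<open>Discretisation of the integral conditions\<close>

text \<open>The ratio \<open>a\<close> collects 2 from the halving recursion, \<open>c\<close> from
  the kernel inequality and \<open>2^(1 + r)\<close> from splitting \<open>H\<close> over a sum, so
  that one grid step absorbs all three.\<close>

locale hardy_grid = hardy_data +
  fixes N :: nat and t :: "nat \<Rightarrow> real" and a :: real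
  assumes t_0: "t 0 = 0" and t_Suc: "\<And>k. k < N \<Longrightarrow> t k < t (Suc k)"
    and a_eq: "a = 2 * c * 2 powr (1 + r)"
    and W_grid: "\<And>k. 1 \<le> k \<Longrightarrow> k < N \<Longrightarrow> ennreal a * W (t k) \<le> W (t (Suc k))"
begin

text \<open>With \<open>j = W (t k) * u (t k) z\<close> and \<open>y = om k\<close>, the product
  \<open>g z * H j y\<close> dominates up to constants the integrands of both integral conditions on
  the cell after \<open>t k\<close>: \<open>j^(1 + r)\<close> serves the first and
  \<open>j * (y + j)^r\<close> the second.\<close>

definition H :: "ennreal \<Rightarrow> ennreal \<Rightarrow> ennreal" where
  "H j y = j * epowr (y + j) r"

definition om :: "nat \<Rightarrow> ennreal" where "om k = M (t k) (t k)"

definition m :: "nat \<Rightarrow> ennreal" where "m k = W (t k) * u (t k) (t (Suc k))"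

definition X :: "nat \<Rightarrow> ereal" where "X k = (if k \<le> N then ereal (t k) else \<infinity>)"

definition Phi :: "nat \<Rightarrow> ennreal" where
  "Phi k = esssup (lebesgue_on (einterval (X k) (X (Suc k)))) (\<lambda>z. epowr (u (t k) z) (1 + r) * g z)"

definition C1 :: ennreal where "C1 = epowr 2 (1 + r)"

text \<open>The growth factor that \<open>M_le_local\<close> demands of the diagonal values.\<close>

definition K :: ennreal where "K = ennreal (2 * c)"

lemma C1_eq: "C1 = ennreal (2 powr (1 + r))"
  unfolding C1_def using epowr_ennreal[of 2 "1 + r"] r1_pos by simp

lemma a_eq_C1: "ennreal a = 2 * (C1 * ennreal c)"
  using c_ge_1 by (simp add: a_eq C1_eq ennreal_mult ac_simps)

lemma C1_ge_2: "2 \<le> C1"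
proof -
  have "(2::real) powr 1 \<le> 2 powr (1 + r)" using r_pos by (intro powr_mono) auto
  then show ?thesis unfolding C1_eq using ennreal_leI[of 2 "2 powr (1 + r)"] by simp
qed

lemma one_le_c: "1 \<le> ennreal c" using c_ge_1 by simp

lemma W_double: "1 \<le> k \<Longrightarrow> k < N \<Longrightarrow> 2 * W (t k) \<le> W (t (Suc k))"
proof -
  assume k: "1 \<le> k" "k < N"
  have "2 * (1 * 1) \<le> 2 * (C1 * ennreal c)"
    using C1_ge_2 one_le_c by (intro mult_left_mono mult_mono) (auto intro: order_trans[of 1 2])
  then have "2 \<le> ennreal a" by (simp add: a_eq_C1)
  then have "2 * W (t k) \<le> ennreal a * W (t k)" by (rule mult_right_mono) simp
  with W_grid[OF k] show ?thesis by simp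
qed

lemma t_less: "i < j \<Longrightarrow> j \<le> N \<Longrightarrow> t i < t j"
proof (induction j)
  case (Suc j)
  then show ?case using t_Suc[of j] by (cases "i = j") auto
qed simp

lemma t_le: "i \<le> j \<Longrightarrow> j \<le> N \<Longrightarrow> t i \<le> t j"
  using t_less[of i j] by (cases "i = j") auto

lemma t_pos: "1 \<le> k \<Longrightarrow> k \<le> N \<Longrightarrow> 0 < t k"
  using t_less[of 0 k] t_0 by simp

lemma om_mono: "i \<le> j \<Longrightarrow> j \<le> N \<Longrightarrow> om i \<le> om j"
  unfolding om_def by (intro M_diag_mono t_le)

lemma m_le_om: "1 \<le> k \<Longrightarrow> k < N \<Longrightarrow> m k \<le> om (Suc k)"
  unfolding m_def om_def
  using W_u_le_M[of "t k" "t (Suc k)"] t_pos[of k] M_mono1[of "t k" "t (Suc k)" "t (Suc k)"] t_Suc[of k]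
  by simp

lemma W_le_increment:
  assumes "k < N"
  shows "W (t (Suc k)) \<le> 2 * (\<integral>\<^sup>+s\<in>{t k<..<t (Suc k)}. w s \<partial>lebesgue)" (is "_ \<le> 2 * ?I")
proof -
  have eq: "W (t (Suc k)) = W (t k) + ?I"
    unfolding W_def using assms t_less[of k "Suc k"] t_le[of 0 k] t_0 by (intro set_nn_integral_split) auto
  have "W (t k) \<le> ?I"
  proof (cases "k = 0")
    case True
    then show ?thesis by (simp add: t_0 W_def)
  next
    case False
    then have "W (t k) + W (t k) \<le> W (t k) + ?I"
      using W_double[of k] assms unfolding eq mult_2 by simp
    then show ?thesis by (rule ennreal_absorb_half[OF W_less_top])
  qed
  then show ?thesis unfolding eq mult_2 by (rule add_right_mono)
qed

text \<open>Up to a factor 2 the mass \<open>W (t k)\<close> sits on the cell that ends at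
  \<open>t k\<close>, and there \<open>u s (t e)\<close> is at least
  \<open>u (t k) (t (Suc k))\<close>. Hence \<open>m k\<close> is at most twice the integral of
  \<open>w s * u s (t e)\<close> over that cell, and the cells add up to \<open>M\<close>. The
  number of summands does not enter.\<close>

lemma sum_m_le:
  assumes "e \<le> N" "1 \<le> e"
  shows "(\<Sum>k=1..<e. m k) \<le> 2 * om e"
proof -
  have "(\<Sum>k=1..<Suc j. m k) \<le> 2 * M (t j) (t e)" if "j < e" for j
    using that
  proof (induction j)
    case (Suc j)
    let ?I = "\<integral>\<^sup>+s\<in>{t j<..<t (Suc j)}. w s \<partial>lebesgue"
    let ?J = "\<integral>\<^sup>+s\<in>{t j<..<t (Suc j)}. (w s * u s (t e)) \<partial>lebesgue"
    have j: "Suc j < e" "Suc j < N" "Suc (Suc j) \<le> e" using Suc.prems assms by auto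
    have "m (Suc j) \<le> 2 * (?I * u (t (Suc j)) (t (Suc (Suc j))))"
      unfolding m_def mult.assoc[symmetric] using j by (intro mult_right_mono W_le_increment) auto
    also have "?I * u (t (Suc j)) (t (Suc (Suc j))) =
       (\<integral>\<^sup>+s. (w s * indicator {t j<..<t (Suc j)} s) * u (t (Suc j)) (t (Suc (Suc j))) \<partial>lebesgue)"
      by (intro nn_integral_multc[symmetric]) auto
    also have "\<dots> \<le> ?J"
    proof (intro nn_integral_mono)
      fix s
      have "u (t (Suc j)) (t (Suc (Suc j))) \<le> u s (t e)" if "s \<in> {t j<..<t (Suc j)}"
        using that t_le[of 0 j] j assms t_0
        by (intro order_trans[OF u_mono[OF t_le[OF j(3) assms(1)]] u_anti]) auto
      then show "(w s * indicator {t j<..<t (Suc j)} s) * u (t (Suc j)) (t (Suc (Suc j))) \<le>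
          w s * u s (t e) * indicator {t j<..<t (Suc j)} s"
        by (auto simp: indicator_def intro!: mult_left_mono)
    qed
    finally have "m (Suc j) \<le> 2 * ?J" by (simp add: mult_left_mono)
    moreover have "(\<Sum>k=1..<Suc j. m k) \<le> 2 * M (t j) (t e)" using Suc by simp
    moreover have "M (t (Suc j)) (t e) = M (t j) (t e) + ?J"
      unfolding M_def using j t_le[of 0 j] t_0 t_less[of j "Suc j"] by (intro set_nn_integral_split) auto
    ultimately show ?case by (simp add: distrib_left add_mono)
  qed simp
  from this[of "e - 1"] assms have "(\<Sum>k=1..<e. m k) \<le> 2 * M (t (e - 1)) (t e)" by simp
  also have "\<dots> \<le> 2 * om e" unfolding om_def using assms t_le[of "e - 1" e]
    by (intro mult_left_mono M_mono1) auto
  finally show ?thesis .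
qed

lemma H_mono: "j \<le> j' \<Longrightarrow> y \<le> y' \<Longrightarrow> H j y \<le> H j' y'"
  unfolding H_def using r_pos by (intro mult_mono epowr_mono add_mono) auto

lemma H_double: "H (j + j) y \<le> C1 * H j y"
proof -
  have "epowr (y + (j + j)) r \<le> epowr (2 * (y + j)) r"
    using r_pos by (intro epowr_mono) (auto simp: distrib_left mult_2 intro!: add_right_mono add_increasing2)
  also have "\<dots> = epowr 2 r * epowr (y + j) r" by (rule epowr_mult[OF r_pos])
  finally have "H (j + j) y \<le> (2 * j) * (epowr 2 r * epowr (y + j) r)"
    unfolding H_def mult_2 by (intro mult_left_mono) auto
  also have "\<dots> = C1 * H j y" using r_pos by (simp add: C1_def H_def epowr_Suc ac_simps)
  finally show ?thesis .
qed

lemma H_add: "H (i + j) y \<le> C1 * (H i y + H j y)"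
proof -
  have "H (i + j) y \<le> H (max i j + max i j) y" by (intro H_mono add_mono) auto
  also have "\<dots> \<le> C1 * H (max i j) y" by (rule H_double)
  also have "\<dots> \<le> C1 * (H i y + H j y)" by (intro mult_left_mono) (auto simp: max_def)
  finally show ?thesis .
qed

lemma H_le: "H j y \<le> C1 * (epowr j (1 + r) + epowr y (1 + r))"
proof -
  have "H j y \<le> (j + y) * epowr (j + y) r"
    unfolding H_def by (intro mult_mono) (auto simp: add.commute)
  also have "\<dots> = epowr (j + y) (1 + r)" using r_pos by (simp add: epowr_Suc)
  also have "\<dots> \<le> C1 * (epowr j (1 + r) + epowr y (1 + r))"
    unfolding C1_def by (rule epowr_add_le[OF r1_pos])
  finally show ?thesis .
qed

text \<open>The discrete majorant: \<open>W_dens_le_G\<close> bounds \<open>W (t k) * dens s\<close>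
  by a multiple of \<open>G k\<close> for \<open>s\<close> in the cell after
  \<open>t k\<close>.\<close>

definition G :: "nat \<Rightarrow> ennreal" where
  "G k = esssup (lebesgue_on {t k<..}) (\<lambda>z. g z * H (W (t k) * u (t k) z) (om k))"

lemma G_measurable [measurable]: "(\<lambda>z. g z * H (W (t k) * u (t k) z) (om k)) \<in> borel_measurable lebesgue"
  unfolding H_def by measurable

lemma AE_G: "AE z in lebesgue. t k < z \<longrightarrow> g z * H (W (t k) * u (t k) z) (om k) \<le> G k"
  using AE_le_esssup[of "{t k<..}" "\<lambda>z. g z * H (W (t k) * u (t k) z) (om k)"] by (simp add: G_def)

lemma AE_tail: "AE z in lebesgue. x < z \<longrightarrow> g z \<le> tail_ess x"
  using AE_le_esssup[of "{x<..}" g] by (simp add: tail_ess_def)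

text \<open>Greedy blocks of grid indices: a new block starts at the first index at which \<^term>\<open>om\<close> exceeds
  \<^term>\<open>K\<close> times its value at the start of the current block.\<close>

primrec st :: "nat \<Rightarrow> nat" where
  "st 0 = 0"
| "st (Suc k) = (if k = 0 \<or> K * om (st k) < om (Suc k) then Suc k else st k)"

lemma st_le: "st k \<le> k"
  by (induction k) auto

lemma st_ge_1: "1 \<le> k \<Longrightarrow> 1 \<le> st k"
  by (induction k) auto

lemma st_idem: "st (st k) = st k"
  by (induction k) auto

lemma st_mono: "i \<le> j \<Longrightarrow> st i \<le> st j"
proof (induction j)
  case (Suc j)
  then show ?case using st_le[of i] by (cases "i = Suc j") auto
qed simp

lemma one_le_K: "1 \<le> K"
  unfolding K_def using c_ge_1 by simp

lemma om_le_st: "om k \<le> K * om (st k)"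
proof (induction k)
  case 0
  then show ?case using mult_right_mono[OF one_le_K, of "om 0"] by simp
next
  case (Suc k)
  then show ?case using mult_right_mono[OF one_le_K, of "om (Suc k)"] by auto
qed

definition starts :: "nat set" where "starts = {k \<in> {1..N}. st k = k}"

text \<open>The predecessor of \<open>p'\<close> belongs to a block that starts at or after
  \<open>p\<close>, and the greedy rule compares \<open>om p'\<close> with the value at that
  start.\<close>

lemma starts_separated:
  assumes "p \<in> starts" "p' \<in> starts" "p < p'"
  shows "K * om p \<le> om p'"
proof -
  obtain j where j: "p' = Suc j" "p \<le> j" "j \<noteq> 0" using assms by (cases p') (auto simp: starts_def)
  have "st p' = p'" "st p = p" "p' \<le> N" using assms by (auto simp: starts_def)
  then have "K * om (st j) < om p'" "p \<le> st j"
    using j st_le[of j] st_mono[OF j(2)] by (auto split: if_splits)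
  moreover have "om p \<le> om (st j)"
    using \<open>p \<le> st j\<close> st_le[of j] j \<open>p' \<le> N\<close> by (intro om_mono) auto
  ultimately show ?thesis using mult_left_mono[of "om p" "om (st j)" K] by simp
qed

definition last_ix :: "nat \<Rightarrow> bool" where "last_ix k \<longleftrightarrow> k = N \<or> st (Suc k) = Suc k"

text \<open>The share of the cell after \<open>t k\<close> in \<open>G k\<close>. Inside a block the
  kernel on the cell is bounded by \<open>m k \<le> om (Suc k)\<close>, which the block controls. At
  the last index of a block \<open>om (Suc k)\<close> may be far larger, or the cell unbounded; the
  kernel then stays inside the essential supremum \<open>Phi k\<close>, to be paid for by
  \<open>DD3\<close>.\<close>

definition Lam :: "nat \<Rightarrow> ennreal" where
  "Lam k = (if last_ix k then C1 * (epowr (W (t k)) (1 + r) * Phi k + epowr (om k) (1 + r) * tail_ess (t k))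
     else H (m k) (om k) * tail_ess (t k))"

lemma AE_local:
  assumes k: "1 \<le> k" "k \<le> N"
  shows "AE z in lebesgue. z \<in> einterval (X k) (X (Suc k)) \<longrightarrow>
    g z * H (W (t k) * u (t k) z) (om k) \<le> Lam k"
proof (cases "last_ix k")
  case True
  have "AE z in lebesgue. z \<in> einterval (X k) (X (Suc k)) \<longrightarrow> epowr (u (t k) z) (1 + r) * g z \<le> Phi k"
    unfolding Phi_def by (intro AE_le_esssup) auto
  then show ?thesis
    using AE_tail[of "t k"]
  proof eventually_elim
    case (elim z)
    show ?case
    proof
      assume z: "z \<in> einterval (X k) (X (Suc k))"
      then have "t k < z" using k by (auto simp: einterval_def X_def)
      have "g z * H (W (t k) * u (t k) z) (om k)
         \<le> g z * (C1 * (epowr (W (t k) * u (t k) z) (1 + r) + epowr (om k) (1 + r)))"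
        by (intro mult_left_mono H_le) auto
      also have "\<dots> = C1 * (epowr (W (t k)) (1 + r) * (epowr (u (t k) z) (1 + r) * g z) + epowr (om k) (1 + r) * g z)"
        using r1_pos by (simp add: epowr_mult distrib_left ac_simps)
      also have "\<dots> \<le> C1 * (epowr (W (t k)) (1 + r) * Phi k + epowr (om k) (1 + r) * tail_ess (t k))"
        using elim z \<open>t k < z\<close> by (intro mult_left_mono add_mono) auto
      finally show "g z * H (W (t k) * u (t k) z) (om k) \<le> Lam k" using True by (simp add: Lam_def)
    qed
  qed
next
  case False
  then have "k < N" using k by (auto simp: last_ix_def)
  show ?thesis using AE_tail[of "t k"]
  proof eventually_elim
    case (elim z)
    show ?case
    proof
      assume z: "z \<in> einterval (X k) (X (Suc k))"
      then have "t k < z" "z < t (Suc k)" using \<open>k < N\<close> by (auto simp: einterval_def X_def)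
      then have "g z * H (W (t k) * u (t k) z) (om k) \<le> tail_ess (t k) * H (m k) (om k)"
        using elim unfolding m_def by (intro mult_mono H_mono mult_left_mono u_mono) auto
      then show "g z * H (W (t k) * u (t k) z) (om k) \<le> Lam k"
        using False by (simp add: Lam_def mult.commute)
    qed
  qed
qed

definition Q :: "nat \<Rightarrow> ennreal" where
  "Q k = Lam k + (if k < N then C1 * H (ennreal c * m k) (om k) * tail_ess (t (Suc k)) else 0)"

text \<open>For \<open>z\<close> before \<open>t (Suc k)\<close> the local bound suffices. Beyond it
  the kernel inequality through \<open>t (Suc k)\<close> splits the argument of \<open>H\<close>
  into the cell part \<open>c * m k\<close> and the far part \<open>I\<close>. The growth of
  \<open>W\<close> by \<open>a\<close> gives
  \<open>2 * C1 * I \<le> W (t (Suc k)) * u (t (Suc k)) z\<close>, so the far part costs at most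
  half of \<open>G (Suc k)\<close>.\<close>

lemma G_recursion:
  assumes k: "1 \<le> k" "k < N"
  shows "G k + G k \<le> 2 * Q k + G (Suc k)"
proof -
  let ?J = "\<lambda>z. W (t k) * u (t k) z" and ?J' = "\<lambda>z. W (t (Suc k)) * u (t (Suc k)) z"
  have "2 * G k \<le> 2 * Q k + G (Suc k)"
    unfolding G_def[of k]
  proof (rule mult_esssup_le)
    show "AE z in lebesgue. z \<in> {t k<..} \<longrightarrow> 2 * (g z * H (?J z) (om k)) \<le> 2 * Q k + G (Suc k)"
      using AE_local[OF k(1) less_imp_le[OF k(2)]] AE_tail[of "t (Suc k)"] AE_G[of "Suc k"] AE_lebesgue_neq[of "t (Suc k)"]
    proof eventually_elim
      case (elim z)
      show ?case
      proof
        assume "z \<in> {t k<..}"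
        then consider "z \<in> einterval (X k) (X (Suc k))" | "t (Suc k) < z"
          using elim k by (fastforce simp: X_def)
        then show "2 * (g z * H (?J z) (om k)) \<le> 2 * Q k + G (Suc k)"
        proof cases
          case 1
          then have "g z * H (?J z) (om k) \<le> Q k"
            using elim k unfolding Q_def by (intro add_increasing2) auto
          then show ?thesis by (intro add_increasing2 mult_left_mono) auto
        next
          case 2
          define I where "I = ennreal c * (W (t k) * u (t (Suc k)) z)"
          have "u (t k) z \<le> ennreal c * (u (t k) (t (Suc k)) + u (t (Suc k)) z)"
            using 2 k t_pos[of k] t_Suc[of k] by (intro u_triangle) auto
          then have "?J z \<le> W (t k) * (ennreal c * (u (t k) (t (Suc k)) + u (t (Suc k)) z))"
            by (rule mult_left_mono) simp
          also have "\<dots> = ennreal c * m k + I"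
            unfolding m_def I_def by (simp only: distrib_left ac_simps)
          finally have "H (?J z) (om k) \<le> C1 * (H (ennreal c * m k) (om k) + H I (om k))"
            by (intro order_trans[OF H_mono H_add]) auto
          then have "2 * (g z * H (?J z) (om k)) \<le> 2 * (g z * (C1 * (H (ennreal c * m k) (om k) + H I (om k))))"
            by (intro mult_left_mono) auto
          also have "\<dots> = 2 * (C1 * H (ennreal c * m k) (om k) * g z) + g z * (2 * (C1 * H I (om k)))"
            by (simp only: distrib_left ac_simps)
          also have "2 * (C1 * H I (om k)) \<le> H (?J' z) (om (Suc k))"
          proof -
            have le: "2 * (C1 * I) \<le> ?J' z"
              using mult_right_mono[OF W_grid[OF k], of "u (t (Suc k)) z"]
              by (simp add: I_def a_eq_C1 ac_simps)
            have "1 * (1 * I) \<le> 2 * (C1 * I)"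
              using C1_ge_2 by (intro mult_mono) (auto intro: order_trans[of 1 2])
            then have "I \<le> ?J' z" using le by simp
            then have "epowr (om k + I) r \<le> epowr (om (Suc k) + ?J' z) r"
              using r_pos k om_mono[of k "Suc k"] by (intro epowr_mono add_mono) auto
            from mult_mono[OF le this] show ?thesis
              unfolding H_def by (simp add: mult.assoc)
          qed
          also have "g z * H (?J' z) (om (Suc k)) \<le> G (Suc k)" using elim 2 by simp
          also have "C1 * H (ennreal c * m k) (om k) * g z \<le> Q k"
            using elim 2 k unfolding Q_def by (intro add_increasing mult_left_mono) (auto intro: mult_left_mono)
          finally show ?thesis by (simp add: mult_left_mono add_mono)
        qed
      qed
    qed
  qed (use k in \<open>auto simp: measurable_restrict_space1\<close>)
  then show ?thesis unfolding mult_2 .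
qed

lemma G_last_le: "1 \<le> N \<Longrightarrow> G N \<le> Q N"
  unfolding G_def Q_def using AE_local[of N]
  by (intro esssup_le) (auto simp: X_def measurable_restrict_space1)

lemma sum_G_le: "(\<Sum>k=1..N. G k) \<le> 2 * (\<Sum>k=1..N. Q k)"
proof (cases N)
  case (Suc n)
  have "(\<Sum>k=1..N. G k) = (\<Sum>k\<le>n. G (Suc k))"
    by (simp only: Suc One_nat_def sum.atLeast1_atMost_eq lessThan_Suc_atMost)
  also have "\<dots> \<le> 2 * (\<Sum>k\<le>n. Q (Suc k))"
  proof (rule sum_le_of_halving_recursion)
    have "1 \<le> N" using Suc by simp
    from G_last_le[OF this] show "G (Suc n) \<le> Q (Suc n)" by (simp only: Suc[symmetric])
  qed (use G_recursion Suc in auto)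
  also have "(\<Sum>k\<le>n. Q (Suc k)) = (\<Sum>k=1..N. Q k)"
    by (simp only: Suc One_nat_def sum.atLeast1_atMost_eq lessThan_Suc_atMost)
  finally show ?thesis .
qed simp

end

section \<open>Summation over the blocks\<close>

context hardy_grid
begin

lemma sum_Phi_le: "(\<Sum>k=1..N. epowr (W (t k)) (1 + r) * Phi k) \<le> C1 * DD3"
proof -
  have "(\<Sum>k=1..N. epowr (W (t k)) (1 + r) * Phi k) \<le> (\<Sum>k=1..N. C1 * d3 (X (k-1)) (X k) (X (k+1)))"
  proof (rule sum_mono)
    fix k assume k: "k \<in> {1..N}"
    then have X: "X (k - 1) = ereal (t (k - 1))" "X k = ereal (t k)" "Suc (k - 1) = k" by (auto simp: X_def)
    have "W (t k) \<le> 2 * (\<integral>\<^sup>+s\<in>{t (k-1)<..<t k}. w s \<partial>lebesgue)"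
      using W_le_increment[of "k - 1"] k X(3) by simp
    from epowr_mono[OF r1_pos this]
    have "epowr (W (t k)) (1 + r) * Phi k \<le>
        C1 * epowr (\<integral>\<^sup>+s\<in>{t (k-1)<..<t k}. w s \<partial>lebesgue) (1 + r) * Phi k"
      unfolding epowr_mult[OF r1_pos] C1_def by (rule mult_right_mono) simp
    then show "epowr (W (t k)) (1 + r) * Phi k \<le> C1 * d3 (X (k-1)) (X k) (X (k+1))"
      unfolding d3_def Phi_def using X by (simp add: mult.assoc)
  qed
  also have "\<dots> = C1 * (\<Sum>k=1..N. d3 (X (k-1)) (X k) (X (k+1)))" by (simp add: sum_distrib_left)
  also have "\<dots> \<le> C1 * DD3"
    unfolding DD3_def
  proof (intro mult_left_mono covering_sequence_sum_le)
    show "X k < X (Suc k)" if "k \<le> N" for k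
      using that t_Suc[of k] by (auto simp: X_def)
  qed (auto simp: X_def t_0)
  finally show ?thesis .
qed

text \<open>The second summand of \<open>Q (k - 1)\<close>, moved to the index \<open>k\<close>:
  since \<open>m (k - 1) \<le> om k\<close>, it is the block of \<open>k\<close>, not that of
  \<open>k - 1\<close>, which controls it.\<close>

definition Tm :: "nat \<Rightarrow> ennreal" where
  "Tm k = (if 2 \<le> k then C1 * H (ennreal c * m (k - 1)) (om (k - 1)) * tail_ess (t k) else 0)"

definition Tl :: "nat \<Rightarrow> ennreal" where
  "Tl k = (if last_ix k then C1 * (epowr (om k) (1 + r) * tail_ess (t k)) else 0)"

definition Tn :: "nat \<Rightarrow> ennreal" where
  "Tn k = (if last_ix k then 0 else H (m k) (om k) * tail_ess (t k))"

lemma sum_Q_le_sum_T: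
  "(\<Sum>k=1..N. Q k) \<le> C1 * (C1 * DD3) + (\<Sum>k=1..N. Tm k + Tl k + Tn k)"
proof -
  have shift: "(\<Sum>k=1..N. if k < N then C1 * H (ennreal c * m k) (om k) * tail_ess (t (Suc k)) else 0)
      = (\<Sum>k=1..N. Tm k)"
  proof -
    have "(\<Sum>k=1..N. Tm k) = (\<Sum>k\<in>Suc ` {1..<N}. Tm k)"
    proof (rule sum.mono_neutral_right)
      show "\<forall>k\<in>{1..N} - Suc ` {1..<N}. Tm k = 0"
      proof
        fix k assume k: "k \<in> {1..N} - Suc ` {1..<N}"
        have "\<not> 2 \<le> k"
        proof
          assume "2 \<le> k"
          then have "k = Suc (k - 1)" "k - 1 \<in> {1..<N}" using k by auto
          then show False using k by blast
        qed
        then show "Tm k = 0" by (simp add: Tm_def)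
      qed
    qed auto
    also have "\<dots> = (\<Sum>k\<in>{1..<N}. Tm (Suc k))" by (subst sum.reindex) (simp_all add: comp_def)
    also have "\<dots> = (\<Sum>k=1..N. if k < N then C1 * H (ennreal c * m k) (om k) * tail_ess (t (Suc k)) else 0)"
      by (rule sum.mono_neutral_cong_left) (auto simp: Tm_def)
    finally show ?thesis by simp
  qed
  have "(\<Sum>k=1..N. Q k) \<le> (\<Sum>k=1..N. C1 * (epowr (W (t k)) (1 + r) * Phi k) + (Tl k + Tn k) +
      (if k < N then C1 * H (ennreal c * m k) (om k) * tail_ess (t (Suc k)) else 0))"
    unfolding Q_def Lam_def Tl_def Tn_def
    by (intro sum_mono add_mono order_refl) (auto simp: distrib_left)
  also have "\<dots> = C1 * (\<Sum>k=1..N. epowr (W (t k)) (1 + r) * Phi k) + (\<Sum>k=1..N. Tm k + Tl k + Tn k)"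
    by (simp only: sum.distrib shift sum_distrib_left add.assoc add.commute add.left_commute)
  also have "\<dots> \<le> C1 * (C1 * DD3) + (\<Sum>k=1..N. Tm k + Tl k + Tn k)"
    by (intro add_right_mono mult_left_mono sum_Phi_le) simp
  finally show ?thesis .
qed

text \<open>In a block with start \<open>p\<close> one has \<open>om k \<le> K * om p\<close>; the
  factor \<open>1 + c\<close> accounts for arguments of the form
  \<open>om k + c * om k\<close>.\<close>

definition beta0 :: ennreal where "beta0 = ennreal (1 + c) * K"

text \<open>Within the block every factor with exponent \<open>r\<close> is at most
  \<open>b^r\<close> and every tail supremum at most \<open>tail_ess (t p)\<close>. What remains is
  linear in \<open>m\<close>, and the sum of \<open>m\<close> up to the last index \<open>e\<close>
  is at most \<open>2 * om e \<le> 2 * K * om p\<close>, whatever the length of the block. Only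
  \<open>e\<close> can contribute to \<open>Tl\<close>.\<close>

lemma block_sum_le:
  assumes p: "p \<in> starts"
  shows "(\<Sum>k\<in>{k\<in>{1..N}. st k = p}. Tm k + Tl k + Tn k)
    \<le> (3 * C1 + 2) * (epowr beta0 (1 + r) * (epowr (om p) (1 + r) * tail_ess (t p)))"
proof -
  define B where "B = {k\<in>{1..N}. st k = p}"
  define e where "e = Max B"
  define b where "b = beta0 * om p"
  define Y where "Y = epowr b r * tail_ess (t p)"
  define Z where "Z = epowr b (1 + r) * tail_ess (t p)"
  have bY: "b * Y = Z" unfolding Y_def Z_def using r_pos by (simp add: epowr_Suc mult.assoc)
  have [simp]: "finite B" by (simp add: B_def)
  have "p \<in> B" using p by (auto simp: B_def starts_def)
  then have e: "e \<in> B" unfolding e_def by (intro Max_in) auto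
  have le_e: "k \<le> e" if "k \<in> B" for k using that by (simp add: e_def)
  have eN: "e \<le> N" "1 \<le> e" using e by (auto simp: B_def)
  have p_le: "p \<le> k" "k \<le> N" "1 \<le> k" if "k \<in> B" for k
    using that st_le[of k] by (auto simp: B_def)
  have tail: "tail_ess (t k) \<le> tail_ess (t p)" if "k \<in> B" for k
    using p_le[OF that] by (intro tail_ess_antimono t_le)
  have om: "om k \<le> K * om p" if "k \<in> B" for k
    using om_le_st[of k] that by (simp add: B_def)
  have cK: "ennreal c * (K * om p) \<le> b" "2 * (K * om p) \<le> b"
      "om k + ennreal c * om k \<le> b" if "k \<in> B" for k
  proof -
    show "ennreal c * (K * om p) \<le> b" "2 * (K * om p) \<le> b" unfolding b_def beta0_def mult.assoc
      using c_ge_1 ennreal_leI[of c "1 + c"] ennreal_leI[of 2 "1 + c"] by (auto intro!: mult_right_mono)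
    have "om k + ennreal c * om k = ennreal (1 + c) * om k"
      using c_ge_1 by (simp add: distrib_right)
    also have "\<dots> \<le> b" unfolding b_def beta0_def mult.assoc using om[OF that] by (intro mult_left_mono) auto
    finally show "om k + ennreal c * om k \<le> b" .
  qed
  have last: "k = e" if "k \<in> B" "last_ix k" for k
  proof (rule ccontr)
    assume "k \<noteq> e"
    then have "k < e" using le_e[OF that(1)] by simp
    then have "st (Suc k) = Suc k" "st (Suc k) \<le> st e" using that(2) eN st_mono[of "Suc k" e]
      by (auto simp: last_ix_def simp del: st.simps)
    moreover have "st e = p" using e by (simp add: B_def)
    ultimately show False using p_le(1)[OF that(1)] by linarith
  qed
  have not_last: "Suc k \<in> B" if "k \<in> B" "\<not> last_ix k" for k
    using that p_le[OF that(1)] by (auto simp: last_ix_def B_def)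
  have sum_m: "(\<Sum>k=1..<e. m k) \<le> 2 * (K * om p)"
    using sum_m_le[OF eN] mult_left_mono[OF om[OF e], of 2] by simp
  have "(\<Sum>k\<in>B. Tm k) \<le> (\<Sum>k\<in>{k\<in>B. 2 \<le> k}. m (k - 1) * (C1 * ennreal c * Y))"
    unfolding Tm_def
  proof (subst sum.inter_filter[symmetric], simp, rule sum_mono)
    fix k assume k: "k \<in> {k\<in>B. 2 \<le> k}"
    then have "om (k - 1) \<le> om k" "m (k - 1) \<le> om k"
      using om_mono[of "k - 1" k] m_le_om[of "k - 1"] p_le[of k] by auto
    then have "om (k - 1) + ennreal c * m (k - 1) \<le> b"
      using cK(3)[of k] k by (auto intro: order_trans[OF add_mono[OF _ mult_left_mono]])
    then have "C1 * H (ennreal c * m (k - 1)) (om (k - 1)) * tail_ess (t k) \<le>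
        C1 * (ennreal c * m (k - 1) * epowr b r) * tail_ess (t p)"
      unfolding H_def using tail[of k] k r_pos by (intro mult_mono epowr_mono) auto
    then show "C1 * H (ennreal c * m (k - 1)) (om (k - 1)) * tail_ess (t k) \<le>
        m (k - 1) * (C1 * ennreal c * Y)"
      unfolding Y_def by (simp only: ac_simps)
  qed
  also have "\<dots> = (\<Sum>k\<in>{k\<in>B. 2 \<le> k}. m (k - 1)) * (C1 * ennreal c * Y)"
    by (simp add: sum_distrib_right)
  also have "(\<Sum>k\<in>{k\<in>B. 2 \<le> k}. m (k - 1)) = (\<Sum>k\<in>(\<lambda>k. k - 1) ` {k\<in>B. 2 \<le> k}. m k)"
    by (subst sum.reindex) (auto simp: inj_on_def)
  also have "\<dots> \<le> (\<Sum>k=1..<e. m k)"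
    using le_e by (intro sum_mono2) (fastforce simp: less_eq_Suc_le)+
  also note sum_m
  also have "2 * (K * om p) * (C1 * ennreal c * Y) =
      2 * C1 * ((ennreal c * (K * om p)) * Y)" by (simp only: ac_simps)
  also have "\<dots> \<le> 2 * C1 * (b * Y)"
    using cK(1)[OF e] by (intro mult_left_mono mult_right_mono) auto
  also note bY
  finally have Tm: "(\<Sum>k\<in>B. Tm k) \<le> 2 * C1 * Z"
    by (simp add: mult_right_mono)
  have "(\<Sum>k\<in>B. Tn k) \<le> (\<Sum>k\<in>{k\<in>B. \<not> last_ix k}. m k * Y)"
  proof -
    have "(\<Sum>k\<in>B. Tn k) = (\<Sum>k\<in>{k\<in>B. \<not> last_ix k}. Tn k)"
      by (rule sum.mono_neutral_right) (auto simp: Tn_def)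
    also have "\<dots> \<le> (\<Sum>k\<in>{k\<in>B. \<not> last_ix k}. m k * Y)"
    proof (rule sum_mono)
      fix k assume k: "k \<in> {k\<in>B. \<not> last_ix k}"
      then have S: "Suc k \<in> B" using not_last by auto
      have "om k \<le> om (Suc k)" "m k \<le> om (Suc k)"
        using om_mono[of k "Suc k"] m_le_om[of k] p_le[of k] p_le[OF S] k by auto
      then have "om k + m k \<le> om (Suc k) + om (Suc k)" by (rule add_mono)
      also have "\<dots> \<le> 2 * (K * om p)" unfolding mult_2 using om[OF S] by (intro add_mono)
      also have "\<dots> \<le> b" by (rule cK(2)[OF e])
      finally show "Tn k \<le> m k * Y"
        using k tail[of k] r_pos unfolding Tn_def H_def mult.assoc Y_def
        by (auto intro!: mult_left_mono mult_mono epowr_mono)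
    qed
    finally show ?thesis .
  qed
  also have "\<dots> = (\<Sum>k\<in>{k\<in>B. \<not> last_ix k}. m k) * Y"
    by (simp add: sum_distrib_right)
  also have "(\<Sum>k\<in>{k\<in>B. \<not> last_ix k}. m k) \<le> (\<Sum>k=1..<e. m k)"
    using le_e[OF not_last] p_le by (intro sum_mono2) fastforce+
  also note sum_m
  also note cK(2)[OF e]
  also note bY
  finally have Tn: "(\<Sum>k\<in>B. Tn k) \<le> Z"
    by (simp add: mult_right_mono)
  have "(\<Sum>k\<in>B. Tl k) = Tl e"
    using last by (subst sum.remove[OF _ e]) (auto simp: Tl_def intro!: sum.neutral)
  also have "\<dots> \<le> C1 * Z"
  proof -
    have "om e \<le> b"
      using cK(3)[OF e] by (rule order_trans[rotated]) simp
    then show ?thesis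
      unfolding Tl_def Z_def using tail[OF e] r1_pos by (auto intro!: mult_left_mono mult_mono epowr_mono)
  qed
  finally have Tl: "(\<Sum>k\<in>B. Tl k) \<le> C1 * Z" .
  have "(\<Sum>k\<in>B. Tm k + Tl k + Tn k) \<le> 2 * C1 * Z + C1 * Z + Z"
    unfolding sum.distrib using Tm Tl Tn by (intro add_mono)
  \<comment> \<open>The second copy of \<open>Z\<close> only rounds the coefficient up to
    \<open>3 * C1 + 2\<close>.\<close>
  also have "\<dots> \<le> 2 * C1 * Z + C1 * Z + (Z + Z)"
    by (intro add_left_mono) simp
  also have "\<dots> = (2 * C1 + C1 + 2) * Z" by (simp only: distrib_right mult_2)
  also have "2 * C1 + C1 = 3 * C1"
    using distrib_right[of 2 1 C1] by simp
  also have "Z = epowr beta0 (1 + r) * (epowr (om p) (1 + r) * tail_ess (t p))"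
    unfolding Z_def b_def by (simp add: epowr_mult[OF r1_pos] mult.assoc)
  finally show ?thesis unfolding B_def .
qed

text \<open>In increasing order the block starts have both growth properties of
  \<open>separated_sum_le\<close>: that of \<open>om\<close> by the greedy rule and that of
  \<open>W\<close> by the grid.\<close>

lemma sum_starts_le:
  "(\<Sum>p\<in>starts. epowr (om p) (1 + r) * tail_ess (t p)) \<le> 4 * epowr (ennreal (2 * (1 + c))) (1 + r) * DD4"
proof -
  define ps where "ps = sorted_list_of_set starts"
  define n where "n = length ps"
  define x where "x k = t (ps ! (k - 1))" for k
  have fin: "finite starts" by (simp add: starts_def)
  have set: "set ps = starts" and dist: "distinct ps" and sorted: "sorted_wrt (<) ps"
    using fin by (auto simp: ps_def strict_sorted_list_of_set)
  have in_st: "ps ! i \<in> starts" if "i < n" for i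
    using that nth_mem set by (force simp: n_def)
  have less: "ps ! i < ps ! j" if "i < j" "j < n" for i j
    using sorted_wrt_nth_less[OF sorted] that by (simp add: n_def)
  have "(\<Sum>p\<in>starts. epowr (om p) (1 + r) * tail_ess (t p)) =
      (\<Sum>i<n. epowr (om (ps ! i)) (1 + r) * tail_ess (t (ps ! i)))"
    unfolding n_def by (rule sum.reindex_bij_betw[OF bij_betw_nth[OF dist refl set[symmetric]], symmetric])
  also have "\<dots> = (\<Sum>k=1..n. epowr (M (x k) (x k)) (1 + r) * tail_ess (x k))"
    by (simp add: sum.atLeast1_atMost_eq x_def om_def)
  also have "\<dots> \<le> 4 * epowr (ennreal (2 * (1 + c))) (1 + r) * DD4"
  proof (rule separated_sum_le)
    show "0 < x k" if "1 \<le> k" "k \<le> n" for k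
      using in_st[of "k - 1"] that unfolding x_def by (intro t_pos) (auto simp: starts_def)
    fix k assume k: "1 \<le> k" "k < n"
    then have p: "ps ! (k - 1) \<in> starts" "ps ! k \<in> starts" "ps ! (k - 1) < ps ! k"
      using in_st[of "k - 1"] in_st[of k] less[of "k - 1" k] by auto
    then show "x k < x (Suc k)" unfolding x_def by (auto simp: starts_def intro: t_less)
    show "2 * W (x k) \<le> W (x (Suc k))"
      using p W_double[of "ps ! (k - 1)"] W_mono[OF t_le[of "Suc (ps ! (k - 1))" "ps ! k"]]
      unfolding x_def by (auto simp: starts_def intro: order_trans)
    show "ennreal (2 * c) * M (x k) (x k) \<le> M (x (Suc k)) (x (Suc k))"
      using starts_separated[OF p] by (simp add: x_def om_def K_def)
  qed
  finally show ?thesis .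
qed

definition CG :: ennreal where
  "CG = 2 * (C1 * C1 + (3 * C1 + 2) * epowr beta0 (1 + r) * (4 * epowr (ennreal (2 * (1 + c))) (1 + r)))"

lemma sum_G_le_D: "(\<Sum>k=1..N. G k) \<le> CG * (DD3 + DD4)"
proof -
  define E where "E = 4 * epowr (ennreal (2 * (1 + c))) (1 + r)"
  define Y where "Y = (3 * C1 + 2) * epowr beta0 (1 + r)"
  have "(\<Sum>k=1..N. Tm k + Tl k + Tn k) =
      (\<Sum>p\<in>starts. \<Sum>k\<in>{k\<in>{1..N}. st k = p}. Tm k + Tl k + Tn k)"
  proof (rule sum.group[symmetric])
    show "st ` {1..N} \<subseteq> starts"
    proof safe
      fix k assume "k \<in> {1..N}"
      then show "st k \<in> starts"
        using st_le[of k] st_ge_1[of k] st_idem[of k] by (auto simp: starts_def)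
    qed
  qed (auto simp: starts_def)
  also have "\<dots> \<le> (\<Sum>p\<in>starts. Y * (epowr (om p) (1 + r) * tail_ess (t p)))"
    using block_sum_le by (intro sum_mono) (simp add: Y_def mult.assoc)
  also have "\<dots> = Y * (\<Sum>p\<in>starts. epowr (om p) (1 + r) * tail_ess (t p))"
    by (simp add: sum_distrib_left)
  also have "\<dots> \<le> Y * (E * DD4)" unfolding E_def by (intro mult_left_mono sum_starts_le) auto
  finally have "(\<Sum>k=1..N. Q k) \<le> C1 * (C1 * DD3) + Y * (E * DD4)"
    using sum_Q_le_sum_T by (meson add_left_mono order_trans)
  also have "\<dots> \<le> C1 * C1 * (DD3 + DD4) + Y * E * (DD3 + DD4)"
    unfolding mult.assoc[symmetric] by (intro add_mono mult_left_mono) auto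
  finally have "(\<Sum>k=1..N. G k) \<le> 2 * (C1 * C1 * (DD3 + DD4) + Y * E * (DD3 + DD4))"
    using sum_G_le by (meson mult_left_mono order_trans zero_le)
  also have "\<dots> = CG * (DD3 + DD4)"
    unfolding CG_def Y_def E_def by (simp only: distrib_right mult.assoc)
  finally show ?thesis .
qed

end

section \<open>From grid sums to the integral of \<open>w * dens\<close>\<close>

lemma nn_integral_intermediate_value:
  fixes f :: "real \<Rightarrow> ennreal"
  assumes [measurable]: "f \<in> borel_measurable lebesgue"
    and ab: "0 \<le> a" "a \<le> b" and fin: "(\<integral>\<^sup>+s\<in>{0<..<b}. f s \<partial>lebesgue) < top"
    and y: "(\<integral>\<^sup>+s\<in>{0<..<a}. f s \<partial>lebesgue) \<le> y" "y \<le> (\<integral>\<^sup>+s\<in>{0<..<b}. f s \<partial>lebesgue)"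
  shows "\<exists>x\<in>{a..b}. (\<integral>\<^sup>+s\<in>{0<..<x}. f s \<partial>lebesgue) = y"
proof -
  \<comment> \<open>As the integral over (0,b) is finite, \<open>f\<close> is finite almost
    everywhere there. The real version \<open>h\<close> is integrable, so its indefinite integral is
    continuous and the intermediate value theorem applies.\<close>
  define h where "h s = enn2real (f s * indicator {0<..<b} s)" for s
  have [measurable]: "h \<in> borel_measurable lebesgue" unfolding h_def by measurable
  have "AE s in lebesgue. f s * indicator {0<..<b} s \<noteq> top"
    using nn_integral_PInf_AE[of "\<lambda>s. f s * indicator {0<..<b} s" lebesgue] fin by simp
  then have hf: "AE s in lebesgue. ennreal (h s) = f s * indicator {0<..<b} s"
    by eventually_elim (auto simp: h_def less_top)
  have eq: "(\<integral>\<^sup>+s. ennreal (indicator {0..x} s * h s) \<partial>lebesgue) = (\<integral>\<^sup>+s\<in>{0<..<x}. f s \<partial>lebesgue)"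
    if "x \<in> {a..b}" for x
    using hf AE_lebesgue_neq[of x]
    by (intro nn_integral_cong_AE, eventually_elim) (use that ab in \<open>auto simp: indicator_def\<close>)
  have int: "integrable lebesgue h"
  proof (rule integrableI_nonneg)
    have "(\<integral>\<^sup>+s. ennreal (h s) \<partial>lebesgue) = (\<integral>\<^sup>+s\<in>{0<..<b}. f s \<partial>lebesgue)"
      using hf by (rule nn_integral_cong_AE)
    then show "(\<integral>\<^sup>+s. ennreal (h s) \<partial>lebesgue) < \<infinity>" using fin by simp
  qed (auto simp: h_def)
  have si: "set_integrable lebesgue {0..x} h" for x
    unfolding set_integrable_def using int by (intro integrable_mult_indicator) auto
  have val: "ennreal (integral {0..x} h) = (\<integral>\<^sup>+s\<in>{0<..<x}. f s \<partial>lebesgue)" if "x \<in> {a..b}" for x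
  proof -
    have "integral {0..x} h = (LINT s:{0..x}|lebesgue. h s)"
      using set_lebesgue_integral_eq_integral(2)[OF si] by simp
    also have "ennreal \<dots> = (\<integral>\<^sup>+s. ennreal (indicator {0..x} s * h s) \<partial>lebesgue)"
      unfolding set_lebesgue_integral_def
      using si[of x] by (subst nn_integral_eq_integral) (auto simp: set_integrable_def h_def)
    finally show ?thesis using eq[OF that] by simp
  qed
  have cont: "continuous_on {a..b} (\<lambda>x. integral {0..x} h)"
    using ab by (intro continuous_on_subset[OF indefinite_integral_continuous_1[of h 0 b]]
      set_lebesgue_integral_eq_integral(1)[OF si]) auto
  have "y < top" using y(2) fin by (rule le_less_trans)
  then obtain y' where y': "y = ennreal y'" "0 \<le> y'" by (cases y) auto
  have nonneg: "0 \<le> integral {0..x} h" for x by (rule integral_nonneg[OF set_lebesgue_integral_eq_integral(1)[OF si]]) (simp add: h_def)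
  have "integral {0..a} h \<le> y'" "y' \<le> integral {0..b} h"
    using y ab y' nonneg by (auto simp flip: val)
  then obtain x where "a \<le> x" "x \<le> b" "integral {0..x} h = y'"
    using IVT'[OF _ _ ab(2) cont] by auto
  then show ?thesis using val[of x] y' by auto
qed

context hardy_data
begin

definition phi :: "real \<Rightarrow> ennreal" where
  "phi t = esssup (lebesgue_on {t<..}) (\<lambda>z. epowr (u t z) (1 + r) * g z)"

definition psi :: "real \<Rightarrow> ennreal" where
  "psi t = esssup (lebesgue_on {t<..}) (\<lambda>z. u t z * g z)"

text \<open>Multiplied by \<open>w\<close> this is the sum of the integrands of the two integral
  conditions, which are estimated together from here on.\<close>

definition dens :: "real \<Rightarrow> ennreal" where
  "dens t = (epowr (W t) r * phi t + epowr (M t t) r * psi t) * indicator {0<..} t"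

lemma esssup_tail_antimono:
  fixes f :: "real \<Rightarrow> real \<Rightarrow> ennreal"
  assumes "\<And>t. f t \<in> borel_measurable lebesgue" "s \<le> t" "\<And>z. f t z \<le> f s z"
  shows "esssup (lebesgue_on {t<..}) (f t) \<le> esssup (lebesgue_on {s<..}) (f s)"
proof (rule esssup_le)
  have "AE z in lebesgue. z \<in> {s<..} \<longrightarrow> f s z \<le> esssup (lebesgue_on {s<..}) (f s)"
    by (rule AE_le_esssup) simp
  then show "AE z in lebesgue. z \<in> {t<..} \<longrightarrow> f t z \<le> esssup (lebesgue_on {s<..}) (f s)"
  proof eventually_elim
    case (elim z)
    then show ?case using assms(2) assms(3)[of z] by (auto intro: order_trans)
  qed
qed (use assms in \<open>auto simp: measurable_restrict_space1\<close>)

lemma phi_antimono: "0 < s \<Longrightarrow> s \<le> t \<Longrightarrow> phi t \<le> phi s"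
  unfolding phi_def using r_pos by (intro esssup_tail_antimono mult_right_mono epowr_mono u_anti) auto

lemma psi_antimono: "0 < s \<Longrightarrow> s \<le> t \<Longrightarrow> psi t \<le> psi s"
  unfolding psi_def by (intro esssup_tail_antimono mult_right_mono u_anti) auto

lemma phi_measurable_borel [measurable]: "(\<lambda>t. phi t * indicator {0<..} t) \<in> borel_measurable borel"
  by (intro borel_measurable_antimono_ennreal; auto intro: phi_antimono is_interval_io)

lemma psi_measurable_borel [measurable]: "(\<lambda>t. psi t * indicator {0<..} t) \<in> borel_measurable borel"
  by (intro borel_measurable_antimono_ennreal; auto intro: psi_antimono is_interval_io)

lemma phi_measurable [measurable]: "(\<lambda>t. phi t * indicator {0<..} t) \<in> borel_measurable lebesgue"
  by (simp add: measurable_completion)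

lemma psi_measurable [measurable]: "(\<lambda>t. psi t * indicator {0<..} t) \<in> borel_measurable lebesgue"
  by (simp add: measurable_completion)

lemma dens_measurable [measurable]: "dens \<in> borel_measurable lebesgue"
proof -
  have "dens = (\<lambda>t. epowr (W t) r * (phi t * indicator {0<..} t) + epowr (M t t) r * (psi t * indicator {0<..} t))"
    by (auto simp: dens_def fun_eq_iff distrib_right mult.assoc)
  then show ?thesis by simp
qed

end

context hardy_grid
begin

definition kappa :: ennreal where
  "kappa = epowr (ennreal a) r + epowr (ennreal (c + a)) r"

text \<open>The factor \<open>W (t k)\<close> supplies the linear factor of \<open>H\<close>. On the
  cell \<open>W s \<le> a * W (t k)\<close> and \<open>u s z \<le> u (t k) z\<close>, which costs
  \<open>a^r\<close> in the \<open>phi\<close> term. For the \<open>psi\<close> term, splitting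
  \<open>M s z\<close> at \<open>t k\<close> gives
  \<open>M s s \<le> (c + a) * (om k + W (t k) * u (t k) z)\<close>. The powers \<open>r\<close> of
  the two constants make up \<open>kappa\<close>.\<close>

lemma W_dens_le_G:
  assumes k: "1 \<le> k" "k \<le> N" and s: "t k < s" "W s \<le> ennreal a * W (t k)"
  shows "W (t k) * dens s \<le> kappa * G k"
proof -
  have "0 < s" using s t_pos[OF k] by simp
  have a_nonneg: "0 \<le> a" using c_ge_1 by (simp add: a_eq)
  let ?J = "\<lambda>z. W (t k) * u (t k) z"
  have "W (t k) * epowr (W s) r * phi s \<le> epowr (ennreal a) r * G k"
    unfolding phi_def
  proof (rule mult_esssup_le)
    show "W (t k) * epowr (W s) r < top"
      using W_less_top epowr_less_top[OF r_pos W_less_top] by (simp add: ennreal_mult_less_top)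
    show "AE z in lebesgue. z \<in> {s<..} \<longrightarrow>
        W (t k) * epowr (W s) r * (epowr (u s z) (1 + r) * g z) \<le> epowr (ennreal a) r * G k"
      using AE_G[of k]
    proof eventually_elim
      case (elim z)
      show ?case
      proof
        assume "z \<in> {s<..}"
        then have z: "s < z" by simp
        have "epowr (W s) r \<le> epowr (ennreal a) r * epowr (W (t k)) r"
          using epowr_mono[OF r_pos s(2)] r_pos by (simp add: epowr_mult)
        moreover have "epowr (u s z) (1 + r) \<le> epowr (u (t k) z) (1 + r)"
          using s t_pos[OF k] by (intro epowr_mono[OF r1_pos] u_anti) auto
        ultimately have "W (t k) * epowr (W s) r * (epowr (u s z) (1 + r) * g z) \<le>
           W (t k) * (epowr (ennreal a) r * epowr (W (t k)) r) * (epowr (u (t k) z) (1 + r) * g z)"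
          by (intro mult_mono) auto
        also have "\<dots> = epowr (ennreal a) r * (g z * (?J z * epowr (?J z) r))"
          using r_pos by (simp add: epowr_mult epowr_Suc ac_simps)
        also have "\<dots> \<le> epowr (ennreal a) r * (g z * H (?J z) (om k))"
          unfolding H_def using r_pos by (intro mult_left_mono epowr_mono) auto
        also have "\<dots> \<le> epowr (ennreal a) r * G k"
          using elim z s by (intro mult_left_mono) auto
        finally show "W (t k) * epowr (W s) r * (epowr (u s z) (1 + r) * g z) \<le> epowr (ennreal a) r * G k" .
      qed
    qed
  qed (auto intro!: measurable_restrict_space1)
  moreover have "W (t k) * epowr (M s s) r * psi s \<le> epowr (ennreal (c + a)) r * G k"
    unfolding psi_def
  proof (rule mult_esssup_le)
    show "W (t k) * epowr (M s s) r < top"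
      using W_less_top epowr_less_top[OF r_pos M_less_top] by (simp add: ennreal_mult_less_top)
    show "AE z in lebesgue. z \<in> {s<..} \<longrightarrow>
        W (t k) * epowr (M s s) r * (u s z * g z) \<le> epowr (ennreal (c + a)) r * G k"
      using AE_G[of k]
    proof eventually_elim
      case (elim z)
      show ?case
      proof
        assume "z \<in> {s<..}"
        then have z: "s < z" by simp
        have "M s s \<le> M s z" using z by (intro M_mono2) auto
        also have "\<dots> = M (t k) z + (\<integral>\<^sup>+x\<in>{t k<..<s}. (w x * u x z) \<partial>lebesgue)"
          unfolding M_def using s t_pos[OF k] by (intro set_nn_integral_split) auto
        also have "(\<integral>\<^sup>+x\<in>{t k<..<s}. (w x * u x z) \<partial>lebesgue) \<le>
            (\<integral>\<^sup>+x. (w x * indicator {0<..<s} x) * u (t k) z \<partial>lebesgue)"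
          using t_pos[OF k] by (intro nn_integral_mono) (auto simp: indicator_def intro!: mult_left_mono u_anti)
        also have "\<dots> = W s * u (t k) z" unfolding W_def by (intro nn_integral_multc) auto
        also have "\<dots> \<le> ennreal a * ?J z"
          unfolding mult.assoc[symmetric] using s by (intro mult_right_mono) auto
        also have "M (t k) z \<le> ennreal c * (M (t k) (t k) + ?J z)"
          using z s by (intro M_triangle) auto
        finally have "M s s \<le> ennreal c * (om k + ?J z) + ennreal a * ?J z"
          by (simp add: add_mono om_def)
        also have "\<dots> \<le> ennreal c * (om k + ?J z) + ennreal a * (om k + ?J z)"
          by (intro add_left_mono mult_left_mono) auto
        also have "\<dots> = ennreal (c + a) * (om k + ?J z)"
          using c_ge_1 a_nonneg by (simp add: distrib_right)
        finally have "epowr (M s s) r \<le> epowr (ennreal (c + a) * (om k + ?J z)) r"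
          by (rule epowr_mono[OF r_pos])
        then have Ms: "epowr (M s s) r \<le> epowr (ennreal (c + a)) r * epowr (om k + ?J z) r"
          by (simp only: epowr_mult[OF r_pos])
        have "u s z \<le> u (t k) z"
          using s t_pos[OF k] by (intro u_anti) auto
        then have "W (t k) * epowr (M s s) r * (u s z * g z) \<le>
           W (t k) * (epowr (ennreal (c + a)) r * epowr (om k + ?J z) r) * (u (t k) z * g z)"
          using Ms by (intro mult_mono) auto
        also have "\<dots> = epowr (ennreal (c + a)) r * (g z * H (?J z) (om k))"
          unfolding H_def by (simp only: ac_simps)
        also have "\<dots> \<le> epowr (ennreal (c + a)) r * G k"
          using elim z s by (intro mult_left_mono) auto
        finally show "W (t k) * epowr (M s s) r * (u s z * g z) \<le> epowr (ennreal (c + a)) r * G k" .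
      qed
    qed
  qed (auto intro!: measurable_restrict_space1)
  ultimately have "W (t k) * epowr (W s) r * phi s + W (t k) * epowr (M s s) r * psi s \<le> kappa * G k"
    unfolding kappa_def distrib_right by (rule add_mono)
  then show ?thesis using \<open>0 < s\<close> by (simp add: dens_def distrib_left mult.assoc)
qed

text \<open>After multiplication by \<open>W (t k)\<close> the integrand is at most
  \<open>kappa * G k * w\<close>, whose integral is controlled by
  \<open>W b \<le> a * W (t k)\<close>; the positive finite factor \<open>W (t k)\<close> then
  cancels.\<close>

lemma integral_dens_step:
  assumes k: "1 \<le> k" "k \<le> N" and b: "W b \<le> ennreal a * W (t k)"
  shows "(\<integral>\<^sup>+s\<in>{t k<..<b}. (w s * dens s) \<partial>lebesgue) \<le> ennreal a * kappa * G k"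
proof -
  have Wk: "W (t k) \<noteq> 0" "W (t k) < top"
    using W_pos[OF t_pos[OF k]] W_less_top by (auto simp: W_def)
  have "W (t k) * (\<integral>\<^sup>+s\<in>{t k<..<b}. (w s * dens s) \<partial>lebesgue) =
      (\<integral>\<^sup>+s. W (t k) * (w s * dens s * indicator {t k<..<b} s) \<partial>lebesgue)"
    by (intro nn_integral_cmult[symmetric]) measurable
  also have "\<dots> \<le> (\<integral>\<^sup>+s. kappa * G k * (w s * indicator {0<..<b} s) \<partial>lebesgue)"
  proof (intro nn_integral_mono)
    fix s
    show "W (t k) * (w s * dens s * indicator {t k<..<b} s) \<le> kappa * G k * (w s * indicator {0<..<b} s)"
    proof (cases "s \<in> {t k<..<b}")
      case True
      then have "W (t k) * dens s \<le> kappa * G k"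
        using W_mono[of s b] b k by (intro W_dens_le_G) auto
      from mult_right_mono[OF this, of "w s"] show ?thesis
        using True t_pos[OF k] by (simp add: ac_simps)
    qed simp
  qed
  also have "\<dots> = kappa * G k * W b" unfolding W_def by (intro nn_integral_cmult) measurable
  also have "\<dots> \<le> kappa * G k * (ennreal a * W (t k))" using b by (intro mult_left_mono) auto
  also have "\<dots> = W (t k) * (ennreal a * kappa * G k)" by (simp only: ac_simps)
  finally show ?thesis
    using Wk by (subst (asm) ennreal_mult_le_mult_iff) (simp_all add: less_top)
qed

lemma integral_dens_le:
  assumes "1 \<le> N" "t N \<le> b" "W b \<le> ennreal a * W (t N)"
    and "\<And>k. 1 \<le> k \<Longrightarrow> k < N \<Longrightarrow> W (t (Suc k)) \<le> ennreal a * W (t k)"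
  shows "(\<integral>\<^sup>+s\<in>{t 1<..<b}. (w s * dens s) \<partial>lebesgue) \<le> ennreal a * kappa * CG * (DD3 + DD4)"
proof -
  have *: "(\<integral>\<^sup>+s\<in>{t 1<..<t (Suc j)}. (w s * dens s) \<partial>lebesgue) \<le> (\<Sum>k=1..j. ennreal a * kappa * G k)"
    if "j < N" for j
    using that
  proof (induction j)
    case (Suc j)
    show ?case
    proof (cases "j = 0")
      case True
      then show ?thesis using integral_dens_step[of 1 "t (Suc 1)"] assms(4)[of 1] Suc.prems by simp
    next
      case False
      have "(\<integral>\<^sup>+s\<in>{t 1<..<t (Suc (Suc j))}. (w s * dens s) \<partial>lebesgue) =
          (\<integral>\<^sup>+s\<in>{t 1<..<t (Suc j)}. (w s * dens s) \<partial>lebesgue) +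
          (\<integral>\<^sup>+s\<in>{t (Suc j)<..<t (Suc (Suc j))}. (w s * dens s) \<partial>lebesgue)"
        using Suc.prems t_le[of 1 "Suc j"] t_le[of "Suc j" "Suc (Suc j)"]
        by (intro set_nn_integral_split) auto
      also have "\<dots> \<le> (\<Sum>k=1..j. ennreal a * kappa * G k) + ennreal a * kappa * G (Suc j)"
        using Suc assms(4)[of "Suc j"] by (intro add_mono integral_dens_step) auto
      finally show ?thesis by simp
    qed
  qed simp
  have "(\<integral>\<^sup>+s\<in>{t 1<..<b}. (w s * dens s) \<partial>lebesgue) =
      (\<integral>\<^sup>+s\<in>{t 1<..<t N}. (w s * dens s) \<partial>lebesgue) + (\<integral>\<^sup>+s\<in>{t N<..<b}. (w s * dens s) \<partial>lebesgue)"
    using assms t_le[of 1 N] by (intro set_nn_integral_split) auto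
  also have "\<dots> \<le> (\<Sum>k=1..N-1. ennreal a * kappa * G k) + ennreal a * kappa * G N"
    using *[of "N - 1"] assms by (intro add_mono integral_dens_step) auto
  also have "\<dots> = (\<Sum>k=1..N. ennreal a * kappa * G k)"
    using sum.cl_ivl_Suc[of "\<lambda>k. ennreal a * kappa * G k" 1 "N - 1"] assms(1) by simp
  also have "\<dots> = ennreal a * kappa * (\<Sum>k=1..N. G k)" by (simp add: sum_distrib_left)
  also have "\<dots> \<le> ennreal a * kappa * (CG * (DD3 + DD4))" by (intro mult_left_mono sum_G_le_D) simp
  finally show ?thesis by (simp add: mult.assoc)
qed

end

text \<open>The constants are stated outside the locales because they are chosen before \<open>U\<close>, \<open>v\<close> and \<open>w\<close>.\<close>

definition Abound :: "real \<Rightarrow> real \<Rightarrow> ennreal" where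
  "Abound r c = (let a = 2 * c * 2 powr (1 + r); C1 = epowr 2 (1 + r) in
     ennreal a * (epowr (ennreal a) r + epowr (ennreal (c + a)) r) *
     (2 * (C1 * C1 + (3 * C1 + 2) * epowr (ennreal (1 + c) * ennreal (2 * c)) (1 + r) *
       (4 * epowr (ennreal (2 * (1 + c))) (1 + r)))))"

lemma Abound_less_top: "0 < r \<Longrightarrow> Abound r c < top"
  unfolding Abound_def Let_def
  by (auto simp: ennreal_mult_less_top intro!: epowr_less_top)

context hardy_data
begin

text \<open>The grid points are chosen so that \<open>W\<close> is multiplied by exactly
  \<open>a\<close> at each step after \<open>d\<close>. Equality gives at once the growth that the
  grid needs and the upper bound on a cell. The levels start from \<open>W d\<close>, which is
  positive because \<open>d > 0\<close>.\<close>

lemma integral_dens_le_D_interval: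
  assumes d: "0 < d" "d \<le> b"
  shows "(\<integral>\<^sup>+s\<in>{d<..<b}. (w s * dens s) \<partial>lebesgue) \<le> Abound r c * (DD3 + DD4)"
proof -
  define a where "a = 2 * c * 2 powr (1 + r)"
  have a: "1 < a"
  proof -
    have "(2::real) powr 1 \<le> 2 powr (1 + r)" using r_pos by (intro powr_mono) auto
    then have "2 * 1 * 2 \<le> a" unfolding a_def using c_ge_1 by (intro mult_mono) auto
    then show ?thesis by simp
  qed
  have Wd: "0 < W d" "W d < top" "0 < W b" "W b < top" "W d \<le> W b"
    using d W_pos[of d] W_pos[of b] W_less_top W_mono by (auto simp: W_def)
  have Wdr: "ennreal (enn2real (W d)) = W d" "ennreal (enn2real (W b)) = W b" "0 < enn2real (W d)"
    using Wd by (auto simp: enn2real_positive_iff)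
  obtain n where "enn2real (W b) / enn2real (W d) < a ^ n"
    using real_arch_pow[OF a] by blast
  then have "enn2real (W b) < a ^ n * enn2real (W d)" using Wdr by (simp add: pos_divide_less_eq)
  then have ex: "W b < ennreal (a ^ n) * W d"
  proof -
    have "0 < a ^ n * enn2real (W d)" using Wdr a by simp
    then have "ennreal (enn2real (W b)) < ennreal (a ^ n * enn2real (W d))"
      using \<open>enn2real (W b) < _\<close> by (simp add: ennreal_lessI)
    also have "\<dots> = ennreal (a ^ n) * W d" using a Wdr by (simp add: ennreal_mult)
    finally show ?thesis using Wdr by simp
  qed
  \<comment> \<open>Minimality keeps the levels \<open>a^j * W d\<close> with \<open>j < N\<close>
    below \<open>W b\<close>, so each is attained in [d,b], and leaves less than one further step of
    ratio \<open>a\<close> between \<open>t N\<close> and \<open>b\<close>.\<close>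
  define N where "N = (LEAST n. W b < ennreal (a ^ n) * W d)"
  have N: "W b < ennreal (a ^ N) * W d" unfolding N_def using ex by (rule LeastI)
  have N_min: "ennreal (a ^ j) * W d \<le> W b" if "j < N" for j
    using not_less_Least[of j] that unfolding N_def by (meson not_less)
  have "N \<noteq> 0" using N Wd by (intro notI) simp
  have ex_t: "\<exists>s\<in>{d..b}. W s = ennreal (a ^ j) * W d" if "j < N" for j
    unfolding W_def
  proof (rule nn_integral_intermediate_value)
    have "1 \<le> ennreal (a ^ j)" using a one_le_power[of a j] ennreal_leI[of 1 "a ^ j"] by simp
    from mult_right_mono[OF this, of "W d"]
    show "(\<integral>\<^sup>+s\<in>{0<..<d}. w s \<partial>lebesgue) \<le> ennreal (a ^ j) * (\<integral>\<^sup>+s\<in>{0<..<d}. w s \<partial>lebesgue)"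
      by (simp add: W_def)
    show "ennreal (a ^ j) * (\<integral>\<^sup>+s\<in>{0<..<d}. w s \<partial>lebesgue) \<le> (\<integral>\<^sup>+s\<in>{0<..<b}. w s \<partial>lebesgue)"
      using N_min[OF that] by (simp add: W_def)
  qed (use d W_finite in auto)
  then have "\<forall>j. \<exists>s. j < N \<longrightarrow> s \<in> {d..b} \<and> W s = ennreal (a ^ j) * W d" by blast
  then obtain f where f: "\<And>j. j < N \<Longrightarrow> f j \<in> {d..b}" "\<And>j. j < N \<Longrightarrow> W (f j) = ennreal (a ^ j) * W d"
    by metis
  \<comment> \<open>The point \<open>f 0\<close> is only known to satisfy
    \<open>W (f 0) = W d\<close>; taking \<open>d\<close> itself starts the integral at the required
    endpoint.\<close>
  define t where "t k = (if k = 0 then 0 else if k = 1 then d else f (k - 1))" for k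
  have Wt: "W (t k) = ennreal (a ^ (k - 1)) * W d" "t k \<in> {d..b}" if "1 \<le> k" "k \<le> N" for k
    using that f[of "k - 1"] d by (auto simp: t_def)
  have step: "W (t (Suc k)) = ennreal a * W (t k)" if "1 \<le> k" "k < N" for k
  proof -
    have "a ^ k = a * a ^ (k - 1)" using that by (cases k) auto
    then show ?thesis using Wt(1)[of k] Wt(1)[of "Suc k"] that a by (simp add: ennreal_mult mult.assoc)
  qed
  interpret hardy_grid r c u w g N t a
  proof
    fix k assume k: "k < N"
    show "t k < t (Suc k)"
    proof (cases "k = 0")
      case False
      have "W (t k) < W (t (Suc k))"
      proof -
        have "0 < W (t k)" "W (t k) < top" using Wt(2)[of k] False k d W_pos[of "t k"] W_less_top
          by (auto simp: W_def)
        then obtain x where x: "W (t k) = ennreal x" "0 < x" by (cases "W (t k)") auto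
        then have "ennreal x < ennreal (a * x)" using a by (simp add: ennreal_less_iff)
        then show ?thesis using step[of k] False k x a by (simp add: ennreal_mult)
      qed
      then show ?thesis using W_mono[of "t (Suc k)" "t k"] by (meson not_less)
    qed (use d in \<open>simp add: t_def\<close>)
  qed (simp_all add: t_def[of 0] a_def step[unfolded a_def])
  have "(\<integral>\<^sup>+s\<in>{t 1<..<b}. (w s * dens s) \<partial>lebesgue) \<le> ennreal a * kappa * CG * (DD3 + DD4)"
  proof (rule integral_dens_le)
    have "W b \<le> ennreal (a ^ N) * W d" using N by simp
    also have "\<dots> = ennreal a * W (t N)"
      using Wt(1)[of N] \<open>N \<noteq> 0\<close> a by (cases N) (auto simp: ennreal_mult mult.assoc)
    finally show "W b \<le> ennreal a * W (t N)" .
  qed (use \<open>N \<noteq> 0\<close> Wt(2)[of N] step in auto)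
  moreover have "ennreal a * kappa * CG = Abound r c"
    unfolding kappa_def CG_def C1_def beta0_def K_def by (simp only: Abound_def Let_def a_def)
  moreover have "t 1 = d" by (simp add: t_def)
  ultimately show ?thesis by (simp only:)
qed

text \<open>The bound on compact subintervals is independent of their endpoints, so monotone
  convergence along (1/(n+1), n+1) gives the half-line.\<close>

lemma integral_dens_le_D:
  "(\<integral>\<^sup>+s\<in>{0<..}. (w s * dens s) \<partial>lebesgue) \<le> Abound r c * (DD3 + DD4)"
proof -
  define I where "I n = {1 / real (Suc n)<..<real (Suc n)}" for n
  have inc: "incseq I"
  proof (rule incseq_SucI)
    fix n
    have "1 / real (Suc (Suc n)) \<le> 1 / real (Suc n)" by (intro divide_left_mono) auto
    then show "I n \<subseteq> I (Suc n)" unfolding I_def by auto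
  qed
  have sup: "(SUP n. f * indicator (I n) s) = (f :: ennreal) * indicator {0<..} s" for f s
  proof (cases "0 < s")
    case True
    obtain n1 where n1: "1 / real (Suc n1) < s" using True nat_approx_posE by metis
    obtain n2 where n2: "s < real n2" using reals_Archimedean2 by blast
    have "s \<in> I (max n1 n2)"
    proof -
      have "1 / real (Suc (max n1 n2)) \<le> 1 / real (Suc n1)" by (simp add: field_simps)
      then show ?thesis using n1 n2 by (auto simp: I_def)
    qed
    then show ?thesis using True
      by (intro antisym SUP_least SUP_upper2[of "max n1 n2"]) (auto simp: indicator_def)
  next
    case False
    then have "\<not> 0 < s" by simp
    moreover have "0 < 1 / real (Suc n)" for n by simp
    ultimately have "s \<notin> I n" for n
      unfolding I_def by (meson greaterThanLessThan_iff less_trans)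
    then show ?thesis using False by simp
  qed
  have "(\<integral>\<^sup>+s\<in>{0<..}. (w s * dens s) \<partial>lebesgue) = (\<integral>\<^sup>+s. (SUP n. w s * dens s * indicator (I n) s) \<partial>lebesgue)"
    by (simp add: sup)
  also have "\<dots> = (SUP n. \<integral>\<^sup>+s\<in>I n. (w s * dens s) \<partial>lebesgue)"
  proof (rule nn_integral_monotone_convergence_SUP)
    show "incseq (\<lambda>n s. w s * dens s * indicator (I n) s)"
      using inc by (auto simp: incseq_def le_fun_def indicator_def subset_eq)
  qed (simp add: I_def)
  also have "\<dots> \<le> Abound r c * (DD3 + DD4)"
    unfolding I_def by (intro SUP_least integral_dens_le_D_interval) (auto simp: field_simps)
  finally show ?thesis .
qed

end

section \<open>Sufficiency of the integral conditions\<close>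

lemma ennreal_inverse_antimono: "x \<le> y \<Longrightarrow> inverse y \<le> inverse (x :: ennreal)"
  including ennreal.lifting by transfer (simp add: ereal_inverse_antimono)

lemma sigma_finite_lebesgue: "sigma_finite_measure (lebesgue :: real measure)"
proof
  obtain A :: "real set set" where A: "countable A" "A \<subseteq> sets lborel" "\<Union>A = space lborel" "\<forall>a\<in>A. emeasure lborel a \<noteq> \<infinity>"
    using lborel.sigma_finite_countable by blast
  then show "\<exists>A::real set set. countable A \<and> A \<subseteq> sets lebesgue \<and> \<Union>A = space lebesgue \<and> (\<forall>a\<in>A. emeasure lebesgue a \<noteq> \<infinity>)"
    by (intro exI[of _ A]) (auto simp: subset_eq)
qed

interpretation lebesgue_pair: pair_sigma_finite "lebesgue :: real measure" "lebesgue :: real measure"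
  by (simp add: pair_sigma_finite_def sigma_finite_lebesgue)

text \<open>The product of the two completed sigma-algebras lies strictly between the Borel and the
  Lebesgue sigma-algebra of the plane; Tonelli's theorem is used on this product.\<close>

abbreviation lebesgue2 :: "(real \<times> real) measure" where "lebesgue2 \<equiv> lebesgue \<Otimes>\<^sub>M lebesgue"

lemma measurable_lebesgue_pair_borel:
  fixes f :: "real \<times> real \<Rightarrow> 'a::topological_space"
  assumes "f \<in> borel_measurable (borel \<Otimes>\<^sub>M borel)"
  shows "f \<in> borel_measurable lebesgue2"
proof -
  have id: "(\<lambda>x. x) \<in> (lebesgue :: real measure) \<rightarrow>\<^sub>M borel"
    by (simp add: measurable_completion)
  have "(\<lambda>p. (fst p, snd p)) \<in> lebesgue2 \<rightarrow>\<^sub>M borel \<Otimes>\<^sub>M borel"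
    by (intro measurable_Pair measurable_compose[OF measurable_fst id] measurable_compose[OF measurable_snd id])
  from measurable_compose[OF this assms] show ?thesis by simp
qed

text \<open>For each \<open>t\<close> the bound may fail on a null set of \<open>x\<close> depending
  on \<open>t\<close>. The set of bad pairs is measurable, so by Tonelli it is null and almost every
  section in the other direction is null too.\<close>

lemma AE_le_swap:
  fixes f :: "real \<Rightarrow> real \<Rightarrow> ennreal"
  assumes f: "(\<lambda>p. f (fst p) (snd p)) \<in> borel_measurable lebesgue2"
    and B: "(\<lambda>t. B t * indicator {0<..} t) \<in> borel_measurable lebesgue"
    and le: "\<And>t. 0 < t \<Longrightarrow> AE x in lebesgue. t < x \<longrightarrow> f t x \<le> B t"
  shows "AE x in lebesgue. AE t in lebesgue. 0 < t \<and> t < x \<longrightarrow> f t x \<le> B t"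
proof -
  have [measurable]: "(\<lambda>p. B (fst p) * indicator {0<..} (fst p)) \<in> borel_measurable lebesgue2"
    by (intro measurable_compose[OF measurable_fst B])
  have [measurable]: "Measurable.pred lebesgue2 (\<lambda>p. 0 < fst p \<and> fst p < (snd p :: real))"
  proof -
    let ?f = "\<lambda>p. if 0 < fst p \<and> fst p < (snd p :: real) then 1 else (0::real)"
    have "?f \<in> borel_measurable lebesgue2"
      by (rule measurable_lebesgue_pair_borel) measurable
    from measurable_sets[OF this, of "{1}"]
    have "?f -` {1} \<inter> space lebesgue2 \<in> sets lebesgue2"
      by simp
    also have "?f -` {1} \<inter> space lebesgue2 =
        {p \<in> space lebesgue2. 0 < fst p \<and> fst p < (snd p :: real)}"
      by (auto split: if_split_asm)
    finally show ?thesis by (simp only: pred_def)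
  qed
  note f [measurable]
  let ?P = "\<lambda>t x. 0 < t \<and> t < x \<longrightarrow> f t x \<le> B t * indicator {0<..} t"
  have "(AE t in lebesgue. AE x in lebesgue. ?P t x) \<longleftrightarrow> (AE x in lebesgue. AE t in lebesgue. ?P t x)"
    by (rule lebesgue_pair.AE_commute) measurable
  moreover have "AE t in lebesgue. AE x in lebesgue. ?P t x"
  proof (rule AE_I2)
    fix t :: real
    show "AE x in lebesgue. ?P t x"
      using le[of t] by (cases "0 < t") auto
  qed
  ultimately have "AE x in lebesgue. AE t in lebesgue. ?P t x" by simp
  then show ?thesis
  proof eventually_elim
    case (elim x)
    then show ?case by eventually_elim auto
  qed
qed

locale hardy_joint = hardy_data +
  assumes u_joint: "(\<lambda>p. u (fst p) (snd p)) \<in> borel_measurable (borel \<Otimes>\<^sub>M borel)"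
begin

lemma u_joint_lebesgue [measurable]: "(\<lambda>p. u (fst p) (snd p)) \<in> borel_measurable lebesgue2"
  by (rule measurable_lebesgue_pair_borel[OF u_joint])

lemma fst_measurable [measurable (raw)]:
  assumes "f \<in> borel_measurable lebesgue"
  shows "(\<lambda>p. f (fst p)) \<in> borel_measurable lebesgue2"
  by (rule measurable_compose[OF measurable_fst assms])

lemma snd_measurable [measurable (raw)]:
  assumes "f \<in> borel_measurable lebesgue"
  shows "(\<lambda>p. f (snd p)) \<in> borel_measurable lebesgue2"
  by (rule measurable_compose[OF measurable_snd assms])

definition S :: "real \<Rightarrow> ennreal" where
  "S t = esssup (lebesgue_on {t<..}) (\<lambda>z. g z * u t z * epowr (M z z) r)"

text \<open>Up to the factor \<open>c\<close>, a majorant of \<open>u t z / M z z\<close> valid for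
  all \<open>z > x\<close>. Freeing the quotient of \<open>z\<close> is what lets the essential
  supremum over \<open>z\<close> be replaced by an integral over \<open>x\<close>.\<close>

definition kap :: "real \<Rightarrow> real \<Rightarrow> ennreal" where
  "kap t x = u t x / M x x + 1 / W x"

definition rest :: "real \<Rightarrow> ennreal" where
  "rest t = (\<integral>\<^sup>+x\<in>{t<..}. (w x * dens x * kap t x) \<partial>lebesgue)"

definition C3 :: ennreal where "C3 = epowr (ennreal c) r * epowr 2 r"

definition C4 :: ennreal where "C4 = epowr 2 r * C3 + 2 * (epowr 2 r * C3 * ennreal c)"

lemma S_antimono: "0 < s \<Longrightarrow> s \<le> t \<Longrightarrow> S t \<le> S s"
  unfolding S_def by (intro esssup_tail_antimono) (auto intro!: mult_right_mono mult_left_mono u_anti)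

lemma S_measurable: "(\<lambda>t. S t * indicator {0<..} t) \<in> borel_measurable lebesgue"
proof -
  have "(\<lambda>t. S t * indicator {0<..} t) \<in> borel_measurable borel"
    by (intro borel_measurable_antimono_ennreal; auto intro: S_antimono is_interval_io)
  then show ?thesis by (simp add: measurable_completion)
qed

lemma AE_phi: "AE z in lebesgue. t < z \<longrightarrow> epowr (u t z) (1 + r) * g z \<le> phi t"
  using AE_le_esssup[of "{t<..}" "\<lambda>z. epowr (u t z) (1 + r) * g z"] by (simp add: phi_def)

lemma AE_psi: "AE z in lebesgue. t < z \<longrightarrow> u t z * g z \<le> psi t"
  using AE_le_esssup[of "{t<..}" "\<lambda>z. u t z * g z"] by (simp add: psi_def)

lemma AE_S: "AE z in lebesgue. t < z \<longrightarrow> g z * u t z * epowr (M z z) r \<le> S t"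
  using AE_le_esssup[of "{t<..}" "\<lambda>z. g z * u t z * epowr (M z z) r"] by (simp add: S_def)

lemma AE_phi_swap: "AE z in lebesgue. AE t in lebesgue. 0 < t \<and> t < z \<longrightarrow> epowr (u t z) (1 + r) * g z \<le> phi t"
  by (rule AE_le_swap[OF _ phi_measurable AE_phi]) measurable

lemma AE_psi_swap: "AE z in lebesgue. AE t in lebesgue. 0 < t \<and> t < z \<longrightarrow> u t z * g z \<le> psi t"
  by (rule AE_le_swap[OF _ psi_measurable AE_psi]) measurable

lemma AE_S_swap: "AE z in lebesgue. AE t in lebesgue. 0 < t \<and> t < z \<longrightarrow> g z * u t z * epowr (M z z) r \<le> S t"
  by (rule AE_le_swap[OF _ S_measurable AE_S]) measurable

lemma g_u_M_le_dens:
  assumes t: "0 < t" "t < z" and "epowr (u t z) (1 + r) * g z \<le> phi t" "u t z * g z \<le> psi t"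
  shows "g z * u t z * epowr (M t z) r \<le> C3 * dens t"
proof -
  have "M t z \<le> ennreal c * (M t t + W t * u t z)" using t by (intro M_triangle) auto
  from epowr_mono[OF r_pos this]
  have "epowr (M t z) r \<le> epowr (ennreal c) r * epowr (M t t + W t * u t z) r"
    by (simp only: epowr_mult[OF r_pos])
  also have "\<dots> \<le> epowr (ennreal c) r * (epowr 2 r * (epowr (M t t) r + epowr (W t * u t z) r))"
    by (intro mult_left_mono epowr_add_le r_pos) simp
  also have "\<dots> = C3 * (epowr (M t t) r + epowr (W t) r * epowr (u t z) r)"
    by (simp only: C3_def epowr_mult[OF r_pos] mult.assoc)
  finally have "g z * u t z * epowr (M t z) r \<le> g z * u t z * (C3 * (epowr (M t t) r + epowr (W t) r * epowr (u t z) r))"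
    by (rule mult_left_mono) simp
  also have "\<dots> = C3 * (epowr (W t) r * (epowr (u t z) (1 + r) * g z) + epowr (M t t) r * (u t z * g z))"
    unfolding epowr_Suc[OF r_pos] by (simp only: distrib_left mult.assoc mult.commute mult.left_commute add.commute)
  also have "\<dots> \<le> C3 * (epowr (W t) r * phi t + epowr (M t t) r * psi t)"
    using assms by (intro mult_left_mono add_mono) auto
  finally show ?thesis using t by (simp add: dens_def)
qed

text \<open>The kernel inequality through \<open>x\<close> gives two quotients. In the first,
  \<open>M z z \<ge> M x x\<close>; in the second, \<open>M z z \<ge> W x * u x z\<close>.\<close>

lemma u_div_M_le_kap:
  assumes t: "0 < t" "t < x" "x < z" and "0 < M z z"
  shows "u t z / M z z \<le> ennreal c * kap t x"
proof -
  have Wx: "W x \<noteq> 0" "W x < top" using W_pos[of x] t W_less_top by (auto simp: W_def)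
  have "u x z / M z z \<le> 1 / W x"
  proof (rule divide_le_posI_ennreal[OF assms(4)])
    have "W x * u x z \<le> M z z"
      using W_u_le_M[of x z] M_mono1[of x z z] t by auto
    then have "u x z \<le> M z z / W x" using Wx by (simp add: ennreal_mult_le_iff_le_divide)
    then show "u x z \<le> M z z * (1 / W x)" by (simp add: ennreal_times_divide)
  qed
  moreover have "u t x / M z z \<le> u t x / M x x"
    using M_diag_mono[of x z] t by (auto simp: divide_ennreal_def intro!: mult_left_mono ennreal_inverse_antimono)
  ultimately have "u t x / M z z + u x z / M z z \<le> kap t x"
    unfolding kap_def by (rule add_mono[rotated])
  moreover have "u t z / M z z \<le> (ennreal c * (u t x + u x z)) / M z z"
    using u_triangle[of t x z] t by (intro divide_right_mono_ennreal) auto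
  moreover have "(ennreal c * (u t x + u x z)) / M z z = ennreal c * (u t x / M z z + u x z / M z z)"
    by (simp add: add_divide_distrib_ennreal flip: ennreal_times_divide)
  ultimately show ?thesis using mult_left_mono[of _ "kap t x" "ennreal c"] by (metis order_trans zero_le)
qed

lemma kap_joint [measurable]: "(\<lambda>p. kap (fst p) (snd p)) \<in> borel_measurable lebesgue2"
  unfolding kap_def by measurable

lemma kap_measurable2 [measurable]: "(\<lambda>x. kap t x) \<in> borel_measurable lebesgue"
  unfolding kap_def by measurable

lemma kap_measurable1 [measurable]: "(\<lambda>t. kap t x) \<in> borel_measurable lebesgue"
  unfolding kap_def by measurable

text \<open>If \<open>M t z\<close> is at least half of \<open>M z z\<close>, the bound for
  \<open>M t z\<close> suffices. Otherwise choose \<open>s\<close> between \<open>t\<close> and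
  \<open>z\<close> with \<open>M s z = M z z / 2\<close>: the interval (s,z) then carries half of
  the mass, and every \<open>x\<close> in it satisfies \<open>M z z \<le> 2 * M x z\<close>, so the
  estimate holds at \<open>x\<close> and can be averaged over (s,z).\<close>

lemma g_u_M_diag_le:
  assumes t: "0 < t" "t < z" and tz: "epowr (u t z) (1 + r) * g z \<le> phi t" "u t z * g z \<le> psi t"
    and ae: "AE x in lebesgue. 0 < x \<and> x < z \<longrightarrow> epowr (u x z) (1 + r) * g z \<le> phi x"
      "AE x in lebesgue. 0 < x \<and> x < z \<longrightarrow> u x z * g z \<le> psi x"
  shows "g z * u t z * epowr (M z z) r \<le>
    C4 * (dens t + rest t)"
proof (cases "M z z \<le> 2 * M t z")
  case True
  have "epowr (M z z) r \<le> epowr 2 r * epowr (M t z) r"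
    using epowr_mono[OF r_pos True] by (simp only: epowr_mult[OF r_pos])
  then have "g z * u t z * epowr (M z z) r \<le> g z * u t z * (epowr 2 r * epowr (M t z) r)"
    by (rule mult_left_mono) simp
  also have "\<dots> = epowr 2 r * (g z * u t z * epowr (M t z) r)" by (simp only: ac_simps)
  also have "\<dots> \<le> epowr 2 r * (C3 * dens t)"
    by (intro mult_left_mono g_u_M_le_dens t tz) simp
  also have "\<dots> \<le> C4 * (dens t + rest t)"
    unfolding C4_def mult.assoc[symmetric] by (intro mult_mono add_increasing2) auto
  finally show ?thesis .
next
  case False
  define mm where "mm = M z z"
  have mm: "0 < mm" "mm < top" using False M_less_top by (auto simp: mm_def not_le intro: le_less_trans[OF zero_le])
  obtain m' where m': "mm = ennreal m'" "0 < m'" using mm by (cases mm) auto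
  have half: "2 * (mm / 2) = mm" by (simp add: ennreal_times_divide ennreal_mult_divide_eq mult.commute)
  have "M t z \<le> mm / 2"
    using False by (simp add: mm_def not_le ennreal_mult_le_iff_le_divide[symmetric])
  moreover have "mm / 2 \<le> mm"
    using m' by (simp add: ennreal_divide_numeral ennreal_leI)
  ultimately obtain s where s: "t \<le> s" "s \<le> z" "M s z = mm / 2"
    using nn_integral_intermediate_value[of "\<lambda>s. w s * u s z" t z "mm / 2"] t M_less_top[of z z]
    unfolding M_def mm_def by auto
  have eq: "(\<integral>\<^sup>+x\<in>{s<..<z}. (w x * u x z) \<partial>lebesgue) = mm / 2"
  proof -
    have "mm = mm / 2 + (\<integral>\<^sup>+x\<in>{s<..<z}. (w x * u x z) \<partial>lebesgue)"
      unfolding s(3)[symmetric] unfolding mm_def M_def using s t by (intro set_nn_integral_split) auto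
    moreover have "mm = mm / 2 + mm / 2" using half unfolding mult_2 by simp
    ultimately have "mm / 2 + mm / 2 = mm / 2 + (\<integral>\<^sup>+x\<in>{s<..<z}. (w x * u x z) \<partial>lebesgue)" by metis
    moreover have "mm / 2 \<noteq> top" using m' by (simp add: ennreal_divide_numeral)
    ultimately show ?thesis by (simp only: ennreal_add_left_cancel) auto
  qed
  define A where "A = g z * u t z * epowr mm r"
  define D where "D = 2 * (epowr 2 r * C3 * ennreal c)"
  \<comment> \<open>The averaging: \<open>mm / 2\<close> is the integral of
    \<open>w x * u x z\<close> over (s,z). In the integrand, \<open>u x z\<close> joins
    \<open>g z * mm^r\<close> to give \<open>dens x\<close>, and \<open>u t z / mm\<close> gives
    \<open>kap t x\<close>.\<close>
  have "A = A / mm * (2 * (mm / 2))"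
    unfolding half using mm by (simp add: ennreal_divide_times)
  also have "\<dots> = A / mm * 2 * (mm / 2)" by (simp only: mult.assoc)
  also have "\<dots> = (\<integral>\<^sup>+x. A / mm * 2 * (w x * u x z * indicator {s<..<z} x) \<partial>lebesgue)"
    unfolding eq[symmetric] by (intro nn_integral_cmult[symmetric]) measurable
  also have "\<dots> \<le> (\<integral>\<^sup>+x. D * (w x * dens x * kap t x * indicator {t<..} x) \<partial>lebesgue)"
  proof (rule nn_integral_mono_AE)
    show "AE x in lebesgue. A / mm * 2 * (w x * u x z * indicator {s<..<z} x) \<le>
      D * (w x * dens x * kap t x * indicator {t<..} x)"
      using ae
    proof eventually_elim
      case (elim x)
      show ?case
      proof (cases "x \<in> {s<..<z}")
        case True
        then have x: "0 < x" "t < x" "x < z" "s < x" using s t by auto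
        have "mm \<le> 2 * M x z"
          using mult_left_mono[OF M_mono1[of s x z], of 2] x half s(3) by simp
        from epowr_mono[OF r_pos this]
        have "epowr mm r \<le> epowr 2 r * epowr (M x z) r" by (simp only: epowr_mult[OF r_pos])
        then have "g z * u x z * epowr mm r \<le> g z * u x z * (epowr 2 r * epowr (M x z) r)"
          by (rule mult_left_mono) simp
        also have "\<dots> = epowr 2 r * (g z * u x z * epowr (M x z) r)" by (simp only: ac_simps)
        also have "\<dots> \<le> epowr 2 r * (C3 * dens x)"
          using elim x by (intro mult_left_mono g_u_M_le_dens) auto
        finally have 1: "g z * u x z * epowr mm r \<le> epowr 2 r * (C3 * dens x)" .
        have 2: "u t z / mm \<le> ennreal c * kap t x"
          unfolding mm_def using x t mm by (intro u_div_M_le_kap) (auto simp: mm_def)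
        have "A / mm * 2 * (w x * u x z) = 2 * w x * (g z * u x z * epowr mm r * (u t z / mm))"
        proof -
          have "A / mm = g z * epowr mm r * (u t z / mm)"
            unfolding A_def by (simp add: ennreal_times_divide ac_simps)
          then show ?thesis by (simp only: ac_simps)
        qed
        also have "\<dots> \<le> 2 * w x * (epowr 2 r * (C3 * dens x) * (ennreal c * kap t x))"
          by (rule mult_left_mono[OF mult_mono[OF 1 2]]) auto
        also have "\<dots> = D * (w x * dens x * kap t x)" unfolding D_def by (simp only: ac_simps)
        finally show ?thesis using True x by simp
      qed simp
    qed
  qed
  also have "\<dots> = D * rest t"
    unfolding rest_def by (intro nn_integral_cmult) measurable
  also have "\<dots> \<le> C4 * (dens t + rest t)"
    unfolding C4_def D_def by (intro mult_mono add_increasing add_increasing2) auto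
  finally show ?thesis by (simp add: A_def mm_def)
qed

lemma S_le:
  assumes t: "0 < t"
  shows "S t \<le> C4 * (dens t + rest t)"
  unfolding S_def
proof (rule esssup_le)
  show "AE z in lebesgue. z \<in> {t<..} \<longrightarrow> g z * u t z * epowr (M z z) r \<le>
      C4 * (dens t + rest t)"
    using AE_phi[of t] AE_psi[of t] AE_phi_swap AE_psi_swap
    by eventually_elim (use t g_u_M_diag_le in auto)
qed (auto intro!: measurable_restrict_space1)

text \<open>The two terms of \<open>kap\<close> integrate to \<open>M x x / M x x\<close> and
  \<open>W x / W x\<close>; the first may be 0 / 0 = 0, hence an inequality.\<close>

lemma integral_kap_le:
  assumes "0 < x"
  shows "(\<integral>\<^sup>+t\<in>{0<..<x}. (w t * kap t x) \<partial>lebesgue) \<le> 2"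
proof -
  have "(\<integral>\<^sup>+t\<in>{0<..<x}. (w t * kap t x) \<partial>lebesgue) =
    (\<integral>\<^sup>+t. (w t * u t x * indicator {0<..<x} t) / M x x + (w t * indicator {0<..<x} t) / W x \<partial>lebesgue)"
    unfolding kap_def by (intro nn_integral_cong) (auto simp: indicator_def distrib_left ennreal_times_divide)
  also have "\<dots> = (\<integral>\<^sup>+t\<in>{0<..<x}. (w t * u t x) \<partial>lebesgue) / M x x + (\<integral>\<^sup>+t\<in>{0<..<x}. w t \<partial>lebesgue) / W x"
    by (subst nn_integral_add) (auto simp: nn_integral_divide)
  also have "\<dots> = M x x / M x x + W x / W x" by (simp add: M_def W_def)
  also have "\<dots> \<le> 1 + 1"
    using M_less_top[of x x] W_less_top[of x] by (intro add_mono) (cases "M x x = 0"; cases "W x = 0"; simp)+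
  finally show ?thesis by simp
qed

text \<open>Exchanging the order in the double integral from \<open>rest\<close> leaves for each
  \<open>x\<close> the integral of \<open>w * kap\<close> over \<open>t < x\<close>, at most 2; with
  the \<open>dens\<close> term itself this makes 3.\<close>

lemma integral_S_le:
  "(\<integral>\<^sup>+t\<in>{0<..}. (w t * S t) \<partial>lebesgue) \<le> 3 * C4 * (\<integral>\<^sup>+t\<in>{0<..}. (w t * dens t) \<partial>lebesgue)"
proof -
  let ?A = "\<integral>\<^sup>+t\<in>{0<..}. (w t * dens t) \<partial>lebesgue"
  define F where "F t x = w t * indicator {0<..} t * (w x * dens x * kap t x * (if t < x then 1 else 0))" for t x
  have [measurable]: "(\<lambda>p. if fst p < snd p then 1 else (0::ennreal)) \<in> borel_measurable lebesgue2"
    by (rule measurable_lebesgue_pair_borel) measurable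
  have F_meas: "(\<lambda>(t, x). F t x) \<in> borel_measurable lebesgue2"
    unfolding F_def case_prod_beta by measurable
  have F_eq: "w t * rest t * indicator {0<..} t = (\<integral>\<^sup>+x. F t x \<partial>lebesgue)" for t
  proof -
    have "w t * indicator {0<..} t * rest t = (\<integral>\<^sup>+x. w t * indicator {0<..} t * (w x * dens x * kap t x * indicator {t<..} x) \<partial>lebesgue)"
      unfolding rest_def by (intro nn_integral_cmult[symmetric]) measurable
    also have "\<dots> = (\<integral>\<^sup>+x. F t x \<partial>lebesgue)"
      unfolding F_def by (intro nn_integral_cong) (auto simp: indicator_def)
    finally show ?thesis by (simp add: ac_simps)
  qed
  have "(\<integral>\<^sup>+t\<in>{0<..}. (w t * S t) \<partial>lebesgue) \<le>
      (\<integral>\<^sup>+t. C4 * (w t * dens t * indicator {0<..} t + w t * rest t * indicator {0<..} t) \<partial>lebesgue)"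
  proof (intro nn_integral_mono)
    fix t
    show "w t * S t * indicator {0<..} t \<le> C4 * (w t * dens t * indicator {0<..} t + w t * rest t * indicator {0<..} t)"
      using mult_left_mono[OF S_le[of t], of "w t"] by (auto simp: indicator_def distrib_left ac_simps)
  qed
  also have "\<dots> = C4 * (?A + (\<integral>\<^sup>+t. (\<integral>\<^sup>+x. F t x \<partial>lebesgue) \<partial>lebesgue))"
  proof -
    have [measurable]: "(\<lambda>t. \<integral>\<^sup>+x. F t x \<partial>lebesgue) \<in> borel_measurable lebesgue"
      using F_meas by (intro sigma_finite_measure.borel_measurable_nn_integral[OF sigma_finite_lebesgue])
    show ?thesis unfolding F_eq by (subst nn_integral_cmult, measurable, subst nn_integral_add) auto
  qed
  also have "(\<integral>\<^sup>+t. (\<integral>\<^sup>+x. F t x \<partial>lebesgue) \<partial>lebesgue) = (\<integral>\<^sup>+x. (\<integral>\<^sup>+t. F t x \<partial>lebesgue) \<partial>lebesgue)"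
    by (rule lebesgue_pair.Fubini'[symmetric, OF F_meas])
  also have "\<dots> \<le> (\<integral>\<^sup>+x. 2 * (w x * dens x * indicator {0<..} x) \<partial>lebesgue)"
  proof (intro nn_integral_mono)
    fix x
    show "(\<integral>\<^sup>+t. F t x \<partial>lebesgue) \<le> 2 * (w x * dens x * indicator {0<..} x)"
    proof (cases "0 < x")
      case True
      have "(\<integral>\<^sup>+t. F t x \<partial>lebesgue) = (\<integral>\<^sup>+t. (w x * dens x) * (w t * kap t x * indicator {0<..<x} t) \<partial>lebesgue)"
        unfolding F_def by (intro nn_integral_cong) (auto simp: indicator_def ac_simps)
      also have "\<dots> = (w x * dens x) * (\<integral>\<^sup>+t\<in>{0<..<x}. (w t * kap t x) \<partial>lebesgue)"
        by (intro nn_integral_cmult) measurable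
      also have "\<dots> \<le> (w x * dens x) * 2" by (intro mult_left_mono integral_kap_le True) simp
      finally show ?thesis using True by (simp add: mult.commute)
    next
      case False
      then have "F t x = 0" for t by (auto simp: F_def indicator_def)
      then show ?thesis by simp
    qed
  qed
  also have "\<dots> = 2 * ?A" by (intro nn_integral_cmult) measurable
  finally have "(\<integral>\<^sup>+t\<in>{0<..}. (w t * S t) \<partial>lebesgue) \<le> C4 * (?A + 2 * ?A)"
    by (simp add: mult_left_mono add_left_mono)
  also have "?A + 2 * ?A = 3 * ?A"
    using distrib_right[of 1 2 ?A] by simp
  finally show ?thesis by (simp only: mult.assoc mult.left_commute[of C4])
qed

end

section \<open>Young's inequality and the weight \<open>h\<close>\<close>

lemma epowr_neg_ennreal: "0 < x \<Longrightarrow> a \<noteq> 0 \<Longrightarrow> epowr (ennreal x) a = ennreal (x powr a)"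
  by (auto simp: epowr_def ennreal_eq_0_iff)

lemma epowr_neg_extremes: "a < 0 \<Longrightarrow> epowr 0 a = top" "a < 0 \<Longrightarrow> epowr top a = 0"
  by (auto simp: epowr_def)

text \<open>With \<open>a = l * F * S^(-1/r)\<close> and \<open>b = l^(-r) * S\<close> one has
  \<open>F^(r/(1+r)) = a^(r/(1+r)) * b^(1/(1+r))\<close>, a weighted geometric mean, at most
  \<open>max a b\<close>. The parameter \<open>l\<close> is kept free in order to balance the two
  terms later.\<close>

lemma young_epowr:
  assumes r: "0 < r" and l: "0 < l"
  shows "epowr F (r / (1 + r)) \<le> ennreal l * (F * epowr S (- 1 / r)) + ennreal (l powr (- r)) * S"
proof -
  have q: "0 < r / (1 + r)" "- 1 / r < 0" using r by auto
  consider "F = 0" | "F = top" | "S = 0" "F \<noteq> 0" | "S = top"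
    | x y where "F = ennreal x" "S = ennreal y" "0 < x" "0 < y"
    by (cases F; cases S) (auto simp: less_eq_real_def)
  then show ?thesis
  proof cases
    case 2
    then show ?thesis using l q r
      by (cases S) (auto simp: epowr_neg_extremes ennreal_mult_top epowr_def ennreal_top_mult ennreal_mult_eq_top_iff)
  next
    case 3
    then show ?thesis using l q by (simp add: epowr_neg_extremes ennreal_mult_top)
  next
    case 4
    then show ?thesis using l q by (simp add: ennreal_mult_top)
  next
    case 5
    define a b where "a = l * (x * y powr (- 1 / r))" and "b = l powr (- r) * y"
    have ab: "0 < a" "0 < b" using 5 l by (auto simp: a_def b_def)
    have 1: "x powr (r / (1 + r)) = a powr (r / (1 + r)) * b powr (1 / (1 + r))"
    proof -
      have e: "(- 1 / r) * (r / (1 + r)) = - (1 / (1 + r))" "(- r) * (1 / (1 + r)) = - (r / (1 + r))"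
        using r by (auto simp: field_simps)
      have "a powr (r / (1 + r)) = l powr (r / (1 + r)) * (x powr (r / (1 + r)) * y powr (- (1 / (1 + r))))"
        using 5 l by (simp only: a_def powr_mult powr_powr e)
      moreover have "b powr (1 / (1 + r)) = l powr (- (r / (1 + r))) * y powr (1 / (1 + r))"
        using 5 l by (simp only: b_def powr_mult powr_powr e)
      ultimately have "a powr (r / (1 + r)) * b powr (1 / (1 + r)) = x powr (r / (1 + r)) *
          (l powr (r / (1 + r)) * l powr (- (r / (1 + r)))) * (y powr (- (1 / (1 + r))) * y powr (1 / (1 + r)))"
        by (simp only: ac_simps)
      then show ?thesis using 5 l by (simp flip: powr_add)
    qed
    have "a powr (r / (1 + r)) * b powr (1 / (1 + r)) \<le> max a b powr (r / (1 + r)) * max a b powr (1 / (1 + r))"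
      using r ab by (intro mult_mono powr_mono2) auto
    also have "\<dots> = max a b powr 1"
      using r by (simp flip: powr_add add: add_divide_distrib[symmetric] add.commute)
    also have "\<dots> \<le> a + b" using ab by auto
    finally have "ennreal (x powr (r / (1 + r))) \<le> ennreal (a + b)" unfolding 1 by (rule ennreal_leI)
    then show ?thesis
      using 5 l q r ab by (simp add: epowr_ennreal epowr_neg_ennreal a_def b_def ennreal_mult)
  qed (use q in simp)
qed

text \<open>Raising the hypothesis to the power \<open>-1/r\<close> gives
  \<open>S^(-1/r) \<le> v * u^(-1/r) / m\<close>. The degenerate values agree with this:
  \<open>v = 0\<close> with \<open>u \<noteq> 0\<close> forces \<open>S = \<infinity>\<close>, whose
  negative power is 0.\<close>

lemma epowr_extremal_bound:
  assumes r: "0 < r" and m: "0 < m" "m < top" and u: "u < top" and v: "v < top"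
    and S: "epowr v (- r) * u * epowr m r \<le> S"
  shows "epowr S (- 1 / r) * epowr u (1 + 1 / r) * m \<le> v * u"
proof -
  have p: "0 < 1 + 1 / r" "- 1 / r < 0" using r by (auto intro: add_pos_pos)
  consider "u = 0" | "S = top" | "u \<noteq> 0" "v = 0" "S \<noteq> top" | "u \<noteq> 0" "v \<noteq> 0" "S \<noteq> top" by blast
  then show ?thesis
  proof cases
    case 3
    have "epowr m r \<noteq> 0" using epowr_pos[OF r m(1)] by simp
    then have "S = top" using S 3 r by (auto simp: epowr_neg_extremes ennreal_top_mult top_unique)
    then show ?thesis using p by (simp add: epowr_neg_extremes)
  next
    case 4
    obtain x where x: "u = ennreal x" "0 < x" using u 4 by (cases u) (auto simp: less_eq_real_def)
    obtain y where y: "v = ennreal y" "0 < y" using v 4 by (cases v) (auto simp: less_eq_real_def)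
    obtain m' where m': "m = ennreal m'" "0 < m'" using m by (cases m) auto
    obtain s where s: "S = ennreal s" "0 \<le> s" using 4 by (cases S) auto
    define k where "k = y powr (- r) * x * m' powr r"
    have k: "0 < k" using x y m' by (simp add: k_def)
    have "ennreal k \<le> ennreal s"
      using S x y m' r unfolding s(1) by (simp add: k_def epowr_neg_ennreal epowr_ennreal ennreal_mult)
    then have "k \<le> s" using s by simp
    then have "s powr (- 1 / r) \<le> k powr (- 1 / r)" using k p by (intro powr_mono2') auto
    also have "k powr (- 1 / r) = y * x powr (- 1 / r) / m'"
    proof -
      have e: "- r * (- 1 / r) = 1" "r * (- 1 / r) = - 1" using r by auto
      have "k powr (- 1 / r) = y powr 1 * x powr (- 1 / r) * m' powr (- 1)"
        by (simp only: k_def powr_mult powr_powr e)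
      then show ?thesis using y m' by (simp add: powr_minus_divide)
    qed
    finally have "s powr (- 1 / r) * (x powr (1 + 1 / r) * m') \<le> y * x powr (- 1 / r) / m' * (x powr (1 + 1 / r) * m')"
      using m' by (intro mult_right_mono) auto
    also have "\<dots> = y * (x powr (- 1 / r) * x powr (1 + 1 / r))" using m' by simp
    also have "x powr (- 1 / r) * x powr (1 + 1 / r) = x" using x by (simp flip: powr_add)
    finally have "ennreal (s powr (- 1 / r) * (x powr (1 + 1 / r) * m')) \<le> ennreal (y * x)" by (rule ennreal_leI)
    moreover have "epowr u (1 + 1 / r) = ennreal (x powr (1 + 1 / r))"
      unfolding x(1) using x(2) by (intro epowr_ennreal p(1)) simp
    moreover have "epowr S (- 1 / r) = ennreal (s powr (- 1 / r))"
      unfolding s(1) using k \<open>k \<le> s\<close> p by (intro epowr_neg_ennreal) auto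
    ultimately show ?thesis using x y m' by (simp add: ennreal_mult mult.assoc)
  qed (use p in \<open>auto simp: epowr_neg_extremes epowr_zero[OF p(1)]\<close>)
qed

context hardy_data
begin

text \<open>The power \<open>1 + 1/r = 1/q\<close> turns \<open>u\<close> back into
  \<open>U\<close>; likewise the exponent \<open>r/(1+r)\<close> in \<open>hardy_int\<close> is
  \<open>q\<close>.\<close>

definition hardy_op :: "(real \<Rightarrow> ennreal) \<Rightarrow> real \<Rightarrow> ennreal" where
  "hardy_op f t = (\<integral>\<^sup>+x\<in>{t<..}. (f x * epowr (u t x) (1 + 1 / r)) \<partial>lebesgue)"

definition hardy_int :: "(real \<Rightarrow> ennreal) \<Rightarrow> ennreal" where
  "hardy_int f = (\<integral>\<^sup>+t\<in>{0<..}. (epowr (hardy_op f t) (r / (1 + r)) * w t) \<partial>lebesgue)"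

end

context hardy_joint
begin

text \<open>Multiplied by \<open>M x x\<close>, the integrand is at most
  \<open>v x * w t * u t x\<close>, whose integral is \<open>v x * M x x\<close>, and
  \<open>M x x\<close> cancels. If \<open>M x x = 0\<close>, then \<open>w t * u t x\<close>
  vanishes for almost every \<open>t < x\<close>, and so does the integrand.\<close>

lemma weight_test_le:
  assumes [measurable]: "v \<in> borel_measurable lebesgue" and g: "\<And>x. 0 < x \<Longrightarrow> g x = epowr (v x) (- r)"
  shows "AE x in lebesgue. 0 < x \<longrightarrow>
    (\<integral>\<^sup>+t\<in>{0<..<x}. (w t * (epowr (S t * indicator {0<..} t) (- 1 / r) * epowr (u t x) (1 + 1 / r))) \<partial>lebesgue) \<le> v x"
  using AE_S_swap
proof eventually_elim
  case (elim x)
  note [measurable] = S_measurable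
  let ?h = "\<lambda>t. epowr (S t * indicator {0<..} t) (- 1 / r) * epowr (u t x) (1 + 1 / r)"
  show ?case
  proof (intro impI)
    assume x: "0 < x"
    show "(\<integral>\<^sup>+t\<in>{0<..<x}. (w t * ?h t) \<partial>lebesgue) \<le> v x"
    proof (cases "v x = top")
      case False
      show ?thesis
      proof (cases "M x x = 0")
        case True
        then have "AE t in lebesgue. w t * u t x * indicator {0<..<x} t = 0"
          unfolding M_def by (subst (asm) nn_integral_0_iff_AE) auto
        then have "AE t in lebesgue. w t * ?h t * indicator {0<..<x} t = 0"
        proof eventually_elim
          case (elim t)
          have "0 < 1 + 1 / r" using r_pos by (auto intro: add_pos_pos)
          then show ?case using elim by (auto simp: indicator_def)
        qed
        then have "(\<integral>\<^sup>+t\<in>{0<..<x}. (w t * ?h t) \<partial>lebesgue) = 0"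
          by (subst nn_integral_0_iff_AE) auto
        then show ?thesis by simp
      next
        case M0: False
        have "M x x * (\<integral>\<^sup>+t\<in>{0<..<x}. (w t * ?h t) \<partial>lebesgue) =
            (\<integral>\<^sup>+t. M x x * (w t * ?h t * indicator {0<..<x} t) \<partial>lebesgue)"
          by (intro nn_integral_cmult[symmetric]) measurable
        also have "\<dots> \<le> (\<integral>\<^sup>+t. v x * (w t * u t x * indicator {0<..<x} t) \<partial>lebesgue)"
        proof (rule nn_integral_mono_AE)
          show "AE t in lebesgue. M x x * (w t * ?h t * indicator {0<..<x} t) \<le> v x * (w t * u t x * indicator {0<..<x} t)"
            using elim
          proof eventually_elim
            case (elim t)
            show ?case
            proof (cases "t \<in> {0<..<x}")
              case True
              then have "?h t * M x x \<le> v x * u t x"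
                using elim g[OF x] M0 False M_less_top u_finite r_pos
                by (intro epowr_extremal_bound) (auto simp: less_top zero_less_iff_neq_zero)
              from mult_left_mono[OF this, of "w t"] show ?thesis using True by (simp add: ac_simps)
            qed simp
          qed
        qed
        also have "\<dots> = v x * M x x" unfolding M_def by (intro nn_integral_cmult) measurable
        finally have "M x x * (\<integral>\<^sup>+t\<in>{0<..<x}. (w t * ?h t) \<partial>lebesgue) \<le> M x x * v x"
          by (simp only: mult.commute)
        then show ?thesis using M0 M_less_top[of x x]
          by (subst (asm) ennreal_mult_le_mult_iff) (simp_all add: less_top)
      qed
    qed simp
  qed
qed

lemma hardy_op_young:
  assumes [measurable]: "v \<in> borel_measurable lebesgue" "f \<in> borel_measurable lebesgue"
    and g: "\<And>x. 0 < x \<Longrightarrow> g x = epowr (v x) (- r)" and l: "0 < l"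
  shows "hardy_int f \<le>
    ennreal l * (\<integral>\<^sup>+t\<in>{0<..}. (f t * v t) \<partial>lebesgue) +
    ennreal (l powr (- r)) * (\<integral>\<^sup>+t\<in>{0<..}. (w t * S t) \<partial>lebesgue)"
proof -
  note [measurable] = S_measurable
  define h where "h t = epowr (S t * indicator {0<..} t) (- 1 / r)" for t
  have [measurable]: "h \<in> borel_measurable lebesgue" unfolding h_def by measurable
  define F where "F t x = w t * indicator {0<..} t * (h t * (f x * epowr (u t x) (1 + 1 / r) * (if t < x then 1 else 0)))" for t x
  have [measurable]: "(\<lambda>p. if fst p < snd p then 1 else (0::ennreal)) \<in> borel_measurable lebesgue2"
    by (rule measurable_lebesgue_pair_borel) measurable
  have F_meas: "(\<lambda>(t, x). F t x) \<in> borel_measurable lebesgue2"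
    unfolding F_def case_prod_beta by measurable
  have [measurable]: "(\<lambda>t. \<integral>\<^sup>+x. F t x \<partial>lebesgue) \<in> borel_measurable lebesgue"
    using F_meas by (intro sigma_finite_measure.borel_measurable_nn_integral[OF sigma_finite_lebesgue])
  have F_eq: "(\<integral>\<^sup>+x. F t x \<partial>lebesgue) = w t * indicator {0<..} t * (h t * hardy_op f t)" for t
  proof -
    have "w t * indicator {0<..} t * (h t * hardy_op f t) = w t * indicator {0<..} t * h t * hardy_op f t"
      by (simp only: mult.assoc)
    also have "\<dots> = (\<integral>\<^sup>+x. w t * indicator {0<..} t * h t * (f x * epowr (u t x) (1 + 1 / r) * indicator {t<..} x) \<partial>lebesgue)"
      unfolding hardy_op_def by (intro nn_integral_cmult[symmetric]) measurable
    also have "\<dots> = (\<integral>\<^sup>+x. F t x \<partial>lebesgue)"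
      unfolding F_def by (intro nn_integral_cong) (auto simp: indicator_def mult.assoc)
    finally show ?thesis by simp
  qed
  have "hardy_int f \<le>
      (\<integral>\<^sup>+t. ennreal l * (\<integral>\<^sup>+x. F t x \<partial>lebesgue) + ennreal (l powr (- r)) * (w t * (S t * indicator {0<..} t)) \<partial>lebesgue)"
    unfolding hardy_int_def
  proof (intro nn_integral_mono)
    fix t
    show "epowr (hardy_op f t) (r / (1 + r)) * w t * indicator {0<..} t \<le>
      ennreal l * (\<integral>\<^sup>+x. F t x \<partial>lebesgue) + ennreal (l powr (- r)) * (w t * (S t * indicator {0<..} t))"
    proof (cases "0 < t")
      case True
      then show ?thesis
        using mult_right_mono[OF young_epowr[OF r_pos l, of "hardy_op f t" "S t"], of "w t"]
        by (simp add: F_eq h_def distrib_right distrib_left ac_simps)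
    qed simp
  qed
  also have "\<dots> = ennreal l * (\<integral>\<^sup>+t. (\<integral>\<^sup>+x. F t x \<partial>lebesgue) \<partial>lebesgue) +
      ennreal (l powr (- r)) * (\<integral>\<^sup>+t\<in>{0<..}. (w t * S t) \<partial>lebesgue)"
    by (simp add: nn_integral_add nn_integral_cmult mult.assoc)
  also have "(\<integral>\<^sup>+t. (\<integral>\<^sup>+x. F t x \<partial>lebesgue) \<partial>lebesgue) = (\<integral>\<^sup>+x. (\<integral>\<^sup>+t. F t x \<partial>lebesgue) \<partial>lebesgue)"
    by (rule lebesgue_pair.Fubini'[symmetric, OF F_meas])
  also have "\<dots> \<le> (\<integral>\<^sup>+t\<in>{0<..}. (f t * v t) \<partial>lebesgue)"
  proof (rule nn_integral_mono_AE)
    show "AE x in lebesgue. (\<integral>\<^sup>+t. F t x \<partial>lebesgue) \<le> f x * v x * indicator {0<..} x"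
    proof -
      have "AE x in lebesgue. 0 < x \<longrightarrow>
        (\<integral>\<^sup>+t\<in>{0<..<x}. (w t * (h t * epowr (u t x) (1 + 1 / r))) \<partial>lebesgue) \<le> v x"
        unfolding h_def by (intro weight_test_le assms(1) g)
      then show ?thesis
      proof eventually_elim
        case (elim x)
        show ?case
        proof (cases "0 < x")
          case True
          have "(\<integral>\<^sup>+t. F t x \<partial>lebesgue) =
              (\<integral>\<^sup>+t. f x * (w t * (h t * epowr (u t x) (1 + 1 / r)) * indicator {0<..<x} t) \<partial>lebesgue)"
            unfolding F_def by (intro nn_integral_cong) (auto simp: indicator_def ac_simps)
          also have "\<dots> = f x * (\<integral>\<^sup>+t\<in>{0<..<x}. (w t * (h t * epowr (u t x) (1 + 1 / r))) \<partial>lebesgue)"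
            by (intro nn_integral_cmult) measurable
          also have "\<dots> \<le> f x * v x" using elim True by (intro mult_left_mono) auto
          finally show ?thesis using True by simp
        next
          case False
          then have "F t x = 0" for t by (auto simp: F_def indicator_def)
          then show ?thesis by simp
        qed
      qed
    qed
  qed
  finally show ?thesis by (simp add: add_right_mono mult_left_mono)
qed

lemma hardy_op_bound:
  assumes v: "v \<in> borel_measurable lebesgue" and f: "f \<in> borel_measurable lebesgue"
    and g: "\<And>x. 0 < x \<Longrightarrow> g x = epowr (v x) (- r)"
    and B: "0 < B" "(\<integral>\<^sup>+t\<in>{0<..}. (w t * S t) \<partial>lebesgue) \<le> ennreal B"
  shows "epowr (hardy_int f) (1 + 1 / r)
    \<le> ennreal ((2 * B powr (1 / (1 + r))) powr (1 + 1 / r)) * (\<integral>\<^sup>+t\<in>{0<..}. (f t * v t) \<partial>lebesgue)"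
    (is "epowr ?L _ \<le> ennreal ?C * ?X")
proof -
  have C: "0 < ?C" using B by simp
  have p: "0 < 1 + 1 / r" "0 < 1 + r" using r_pos by (auto intro: add_pos_pos)
  have "epowr ?L (1 + 1 / r) / ennreal ?C \<le> ?X"
  proof (rule ennreal_le_if_less_imp_le)
    fix z assume z: "?X < z" "z < top"
    then obtain x where x: "z = ennreal x" "0 < x"
    proof -
      have "0 < z" using z(1) by (rule le_less_trans[OF zero_le])
      then show ?thesis using z(2) that by (cases z) auto
    qed
    \<comment> \<open>This value balances Young's inequality: both terms become \<open>b\<close>,
      hence the factor 2 in the constant.\<close>
    define l where "l = (B / x) powr (1 / (1 + r))"
    have l: "0 < l" using B x by (simp add: l_def)
    define b where "b = B powr (1 / (1 + r)) * x powr (r / (1 + r))"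
    have e: "- (1 / (1 + r)) + 1 = r / (1 + r)" "1 / (1 + r) * (- r) + 1 = 1 / (1 + r)"
      "- (1 / (1 + r) * (- r)) = r / (1 + r)"
      using r_pos by (auto simp: field_simps)
    have "l * x = B powr (1 / (1 + r)) * x powr (- (1 / (1 + r)) + 1)"
      using B x unfolding l_def powr_add by (simp add: powr_divide powr_minus_divide)
    then have lx: "l * x = b" unfolding e b_def .
    have "l powr (- r) * B = B powr (1 / (1 + r) * (- r) + 1) * x powr (- (1 / (1 + r) * (- r)))"
      using B x unfolding l_def powr_add by (simp add: powr_divide powr_powr powr_minus_divide)
    then have lB: "l powr (- r) * B = b" unfolding e b_def .
    have "?L \<le> ennreal l * ?X + ennreal (l powr (- r)) * (\<integral>\<^sup>+t\<in>{0<..}. (w t * S t) \<partial>lebesgue)"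
      by (rule hardy_op_young[OF v f g l])
    also have "\<dots> \<le> ennreal l * ennreal x + ennreal (l powr (- r)) * ennreal B"
      using z x B by (intro add_mono mult_left_mono) auto
    also have "\<dots> = ennreal b + ennreal b"
      unfolding lx[symmetric] using l x B by (simp add: lB flip: ennreal_mult) (simp add: lx)
    also have "\<dots> = ennreal (b + b)" by (rule ennreal_plus[symmetric]) (simp_all add: b_def)
    also have "b + b = 2 * b" by simp
    finally have "epowr ?L (1 + 1 / r) \<le> epowr (ennreal (2 * b)) (1 + 1 / r)" by (rule epowr_mono[OF p(1)])
    also have "\<dots> = ennreal (?C * x)"
    proof -
      have "1 + 1 / r = (1 + r) / r" using r_pos by (simp add: add_divide_distrib)
      then have e: "r / (1 + r) * (1 + 1 / r) = 1" using r_pos by simp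
      have "(x powr (r / (1 + r))) powr (1 + 1 / r) = x" unfolding powr_powr e using x by simp
      moreover have "(2 * b) powr (1 + 1 / r) = ?C * (x powr (r / (1 + r))) powr (1 + 1 / r)"
        using B x by (simp add: b_def powr_mult mult.assoc)
      ultimately show ?thesis using p B x by (simp add: epowr_ennreal b_def)
    qed
    finally have "epowr ?L (1 + 1 / r) \<le> ennreal ?C * z" using x by (simp add: ennreal_mult)
    then show "epowr ?L (1 + 1 / r) / ennreal ?C \<le> z"
      using C by (intro divide_le_posI_ennreal) auto
  qed
  then have "ennreal ?C * (epowr ?L (1 + 1 / r) / ennreal ?C) \<le> ennreal ?C * ?X" by (rule mult_left_mono) simp
  moreover have "ennreal ?C * (y / ennreal ?C) = y" for y
    using C by (simp add: ennreal_times_divide ennreal_mult_divide_eq mult.commute)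
  ultimately show ?thesis by simp
qed

end

section \<open>A right-continuous version of the kernel\<close>

lemma mono_AE_right_continuous:
  fixes f :: "real \<Rightarrow> ennreal"
  assumes mono: "\<And>x y. x \<le> y \<Longrightarrow> f x \<le> f y" and fin: "\<And>x. f x < top"
  shows "AE x in lebesgue. \<forall>L. (\<forall>y>x. L \<le> f y) \<longrightarrow> L \<le> f x"
proof -
  define h where "h x = enn2real (f x)" for x
  have h: "f x = ennreal (h x)" for x using fin[of x] by (simp add: h_def)
  \<comment> \<open>A monotone real function has countably many discontinuities. Continuity enters
    through lower bounds \<open>L\<close> of the values to the right, the form that fits a kernel
    defined as an infimum.\<close>
  have "mono h" unfolding h_def by (intro monoI enn2real_mono mono fin)
  then have "countable {x. \<not> isCont h x}" by (rule mono_ctble_discont)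
  then have "AE x in lborel. x \<notin> {x. \<not> isCont h x}"
    by (intro AE_not_in countable_imp_null_set_lborel)
  then have "AE x in lebesgue. isCont h x" by (intro AE_completion) simp
  then show ?thesis
  proof eventually_elim
    case (elim x)
    show ?case
    proof (intro allI impI)
      fix L assume L: "\<forall>y>x. L \<le> f y"
      have "(\<lambda>n. x + inverse (real (Suc n))) \<longlonglongrightarrow> x + 0"
        by (intro tendsto_add tendsto_const LIMSEQ_inverse_real_of_nat)
      then have "(\<lambda>n. h (x + inverse (real (Suc n)))) \<longlonglongrightarrow> h x"
        using elim by (intro isCont_tendsto_compose[of x h]) auto
      then have "(\<lambda>n. ennreal (h (x + inverse (real (Suc n))))) \<longlonglongrightarrow> ennreal (h x)"
        by (rule tendsto_ennrealI)
      then show "L \<le> f x"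
        unfolding h[symmetric]
      proof (rule LIMSEQ_le_const)
        show "\<exists>N. \<forall>n\<ge>N. L \<le> f (x + inverse (real (Suc n)))" using L by auto
      qed
    qed
  qed
qed

text \<open>The least multiple of \<open>2^(-n)\<close> strictly above \<open>x\<close>. Its
  countable range makes \<open>u t (dyadic_above n x)\<close> jointly measurable, and strictness
  makes the infimum over \<open>n\<close> a right limit in the monotone variable.\<close>

definition dyadic_above :: "nat \<Rightarrow> real \<Rightarrow> real" where
  "dyadic_above n x = (of_int \<lfloor>x * 2 ^ n\<rfloor> + 1) / 2 ^ n"

lemma dyadic_above_gt: "x < dyadic_above n x"
  unfolding dyadic_above_def by (simp add: field_simps) linarith

lemma dyadic_above_le: "dyadic_above n x \<le> x + 1 / 2 ^ n"
proof -
  have "of_int \<lfloor>x * 2 ^ n\<rfloor> \<le> x * 2 ^ n" by simp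
  then show ?thesis unfolding dyadic_above_def by (simp add: field_simps)
qed

lemma dyadic_above_mono: "x \<le> y \<Longrightarrow> dyadic_above n x \<le> dyadic_above n y"
  unfolding dyadic_above_def
  by (intro divide_right_mono add_right_mono) (auto intro!: floor_mono mult_right_mono)

lemma dyadic_above_less: "x < y \<Longrightarrow> \<exists>n. dyadic_above n x < y"
proof -
  assume "x < y"
  then obtain n where "(1 / 2 :: real) ^ n < y - x" using real_arch_pow_inv[of "y - x" "1/2"] by auto
  then have "x + 1 / 2 ^ n < y" by (simp add: power_divide)
  with dyadic_above_le[of n x] show ?thesis by (intro exI[of _ n]) simp
qed

definition Sbound :: "real \<Rightarrow> real \<Rightarrow> ennreal" where
  "Sbound r c = epowr 2 r * (epowr (ennreal c) r * epowr 2 r) +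
     2 * (epowr 2 r * (epowr (ennreal c) r * epowr 2 r) * ennreal c)"

lemma Sbound_less_top: "0 < r \<Longrightarrow> Sbound r c < top"
  unfolding Sbound_def by (auto simp: ennreal_mult_less_top intro!: epowr_less_top)

lemma (in hardy_joint) C4_eq_Sbound: "C4 = Sbound r c"
  by (simp only: C4_def C3_def Sbound_def)

context hardy_data
begin

text \<open>The right-continuous version of the kernel is jointly Borel measurable, which a function monotone
  in each variable need not be; for each fixed first argument the two kernels agree almost everywhere.\<close>

definition ur :: "real \<Rightarrow> real \<Rightarrow> ennreal" where
  "ur t x = (if x \<le> 0 then 0 else INF n. u t (dyadic_above n x))"

lemma u_le_ur: "u t x \<le> ur t x"
  unfolding ur_def using u_mono[OF less_imp_le[OF dyadic_above_gt[of x]]]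
  by (auto simp: u_zero intro: INF_greatest)

lemma ur_le_u: "x < y \<Longrightarrow> ur t x \<le> u t y"
proof (cases "x \<le> 0")
  case False
  assume "x < y"
  then obtain n where "dyadic_above n x < y" using dyadic_above_less by blast
  then have "u t (dyadic_above n x) \<le> u t y" by (intro u_mono) simp
  then show ?thesis using False by (auto simp: ur_def intro: INF_lower2)
qed (simp add: ur_def)

lemma ur_eq_u: "AE x in lebesgue. ur t x = u t x"
proof -
  have "AE x in lebesgue. \<forall>L. (\<forall>y>x. L \<le> u t y) \<longrightarrow> L \<le> u t x"
    by (intro mono_AE_right_continuous u_mono u_finite)
  then show ?thesis
  proof eventually_elim
    case (elim x)
    then show ?case using ur_le_u[of x _ t] u_le_ur[of t x] by (intro antisym) auto
  qed
qed

lemma ur_joint: "(\<lambda>p. ur (fst p) (snd p)) \<in> borel_measurable (borel \<Otimes>\<^sub>M borel)"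
proof -
  have [measurable]: "(\<lambda>p. u (fst p) (dyadic_above n (snd p))) \<in> borel_measurable (borel \<Otimes>\<^sub>M borel)" for n
    unfolding dyadic_above_def
  proof (rule measurable_compose_countable[where f = "\<lambda>i p. u (fst p) ((of_int i + 1) / 2 ^ n)" and g = "\<lambda>p. \<lfloor>snd p * 2 ^ n\<rfloor>"])
    show "(\<lambda>p. u (fst p) ((real_of_int i + 1) / 2 ^ n)) \<in> borel_measurable (borel \<Otimes>\<^sub>M borel)" for i
      by (rule measurable_compose[OF measurable_fst u_measurable1])
  qed measurable
  show ?thesis unfolding ur_def by measurable
qed

lemma hardy_joint_ur: "hardy_joint r c ur w g"
proof
  fix x x' y y' z :: real
  show "x \<le> 0 \<or> y \<le> 0 \<Longrightarrow> ur x y = 0" by (auto simp: ur_def u_zero)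
  show "0 < x \<Longrightarrow> x \<le> x' \<Longrightarrow> ur x' y \<le> ur x y"
    unfolding ur_def by (auto intro!: INF_mono u_anti)
  show "y \<le> y' \<Longrightarrow> ur x y \<le> ur x y'"
    unfolding ur_def by (auto intro!: INF_mono u_mono dyadic_above_mono)
  show "ur x z \<le> ennreal c * (ur x y + ur y z)" if xyz: "0 < x" "x < y" "y < z"
  proof -
    have c: "0 < ennreal c" using c_ge_1 by simp
    \<comment> \<open>Only \<open>z\<close> is approached from the right while \<open>y\<close>
      stays fixed; dividing by \<open>c\<close> first lets the infimum pass through the sum.\<close>
    have "ur x z / ennreal c \<le> (INF n. ur x y + u y (dyadic_above n z))"
    proof (rule INF_greatest)
      fix n
      have "ur x z \<le> u x (dyadic_above n z)" by (rule ur_le_u[OF dyadic_above_gt])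
      also have "\<dots> \<le> ennreal c * (u x y + u y (dyadic_above n z))"
        using xyz dyadic_above_gt[of z n] by (intro u_triangle) auto
      also have "\<dots> \<le> ennreal c * (ur x y + u y (dyadic_above n z))"
        by (intro mult_left_mono add_right_mono u_le_ur) simp
      finally show "ur x z / ennreal c \<le> ur x y + u y (dyadic_above n z)"
        by (rule divide_le_posI_ennreal[OF c])
    qed
    also have "\<dots> = ur x y + ur y z"
      using xyz by (simp add: INF_ennreal_const_add ur_def[of y z])
    finally have "ennreal c * (ur x z / ennreal c) \<le> ennreal c * (ur x y + ur y z)"
      by (rule mult_left_mono) simp
    moreover have "ennreal c * (ur x z / ennreal c) = ur x z * ennreal c / ennreal c"
      by (simp only: ennreal_times_divide mult.commute)
    moreover have "\<dots> = ur x z"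
      using c by (intro ennreal_mult_divide_eq) auto
    ultimately show ?thesis by simp
  qed
  show "\<exists>B<top. \<forall>x. ur x y \<le> B"
  proof -
    obtain B where "B < top" "\<And>x. u x (y + 1) \<le> B" using u_bounded[of "y + 1"] by auto
    then show ?thesis using ur_le_u[of y "y + 1"] by (intro exI[of _ B]) (auto intro: order_trans)
  qed
qed (use r_pos c_ge_1 w_meas g_meas W_pos W_finite ur_joint in auto)

interpretation reg: hardy_joint r c ur w g
  by (rule hardy_joint_ur)

lemma reg_phi: "reg.phi t = phi t"
  unfolding reg.phi_def phi_def
proof (rule esssup_AE_cong)
  show "AE z in lebesgue_on {t<..}. epowr (ur t z) (1 + r) * g z = epowr (u t z) (1 + r) * g z"
    using ur_eq_u[of t] by (auto simp: AE_restrict_space_iff elim!: eventually_mono)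
qed (auto intro!: measurable_restrict_space1)

lemma reg_psi: "reg.psi t = psi t"
  unfolding reg.psi_def psi_def
proof (rule esssup_AE_cong)
  show "AE z in lebesgue_on {t<..}. ur t z * g z = u t z * g z"
    using ur_eq_u[of t] by (auto simp: AE_restrict_space_iff elim!: eventually_mono)
qed (auto intro!: measurable_restrict_space1)

text \<open>Although \<open>ur\<close> dominates \<open>u\<close>, it satisfies
  \<open>ur s t \<le> u s y\<close> for every \<open>y > t\<close>, so each \<open>M y y\<close>
  with \<open>y > t\<close> bounds the regularised diagonal. By monotonicity of \<open>M y y\<close>
  the bound passes to \<open>y = t\<close> for almost every \<open>t\<close>.\<close>

lemma reg_M_le: "AE t in lebesgue. reg.M t t \<le> M t t"
proof -
  have "AE t in lebesgue. \<forall>L. (\<forall>y>t. L \<le> M y y) \<longrightarrow> L \<le> M t t"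
    by (intro mono_AE_right_continuous M_diag_mono M_less_top)
  then show ?thesis
  proof eventually_elim
    case (elim t)
    have "reg.M t t \<le> M y y" if "t < y" for y
    proof -
      have "reg.M t t \<le> M t y"
        unfolding reg.M_def M_def
        by (intro nn_integral_mono mult_right_mono mult_left_mono ur_le_u that) auto
      also have "\<dots> \<le> M y y" using that by (intro M_mono1) auto
      finally show ?thesis .
    qed
    then show ?case using elim by blast
  qed
qed

lemma reg_dens_le: "AE t in lebesgue. reg.dens t \<le> dens t"
  using reg_M_le
proof eventually_elim
  case (elim t)
  then show ?case
    unfolding reg.dens_def dens_def reg_phi reg_psi
    using r_pos by (intro mult_right_mono add_mono mult_mono epowr_mono) auto
qed

lemma reg_hardy_op: "reg.hardy_op f t = hardy_op f t"
  unfolding reg.hardy_op_def hardy_op_def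
  using ur_eq_u[of t] by (intro nn_integral_cong_AE) (auto elim!: eventually_mono)

lemma reg_hardy_int: "reg.hardy_int f = hardy_int f"
  unfolding reg.hardy_int_def hardy_int_def reg_hardy_op ..

lemma hardy_op_le:
  assumes v: "v \<in> borel_measurable lebesgue" and f: "f \<in> borel_measurable lebesgue"
    and g: "\<And>x. 0 < x \<Longrightarrow> g x = epowr (v x) (- r)"
    and B: "0 < B" "3 * Sbound r c * (\<integral>\<^sup>+t\<in>{0<..}. (w t * dens t) \<partial>lebesgue) \<le> ennreal B"
  shows "epowr (hardy_int f) (1 + 1 / r)
    \<le> ennreal ((2 * B powr (1 / (1 + r))) powr (1 + 1 / r)) * (\<integral>\<^sup>+t\<in>{0<..}. (f t * v t) \<partial>lebesgue)"
proof -
  have "(\<integral>\<^sup>+t\<in>{0<..}. (w t * reg.S t) \<partial>lebesgue) \<le> 3 * Sbound r c * (\<integral>\<^sup>+t\<in>{0<..}. (w t * reg.dens t) \<partial>lebesgue)"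
    unfolding reg.C4_eq_Sbound[symmetric] by (rule reg.integral_S_le)
  also have "\<dots> \<le> 3 * Sbound r c * (\<integral>\<^sup>+t\<in>{0<..}. (w t * dens t) \<partial>lebesgue)"
  proof (intro mult_left_mono nn_integral_mono_AE)
    show "AE t in lebesgue. w t * reg.dens t * indicator {0<..} t \<le> w t * dens t * indicator {0<..} t"
      using reg_dens_le by eventually_elim (intro mult_left_mono mult_right_mono; simp)
  qed simp
  also note B(2)
  finally show ?thesis
    using reg.hardy_op_bound[OF v f g B(1)] by (simp add: reg_hardy_int)
qed

end

section \<open>Necessity of the discrete conditions\<close>

text \<open>An essential supremum may be infinite and need not be reached by any test function, so
  each \<open>E k\<close> is approached by finite values strictly below it, or by 0. The induction
  passes to the supremum in one coordinate at a time; \<open>a\<close> carries the terms held fixed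
  meanwhile.\<close>

lemma sum_mult_le_if_below_le:
  fixes N E :: "'a \<Rightarrow> ennreal"
  assumes "finite I"
    and "\<And>b. (\<And>k. k \<in> I \<Longrightarrow> b k < top \<and> (b k = 0 \<or> b k < E k)) \<Longrightarrow> a + (\<Sum>k\<in>I. N k * b k) \<le> L"
  shows "a + (\<Sum>k\<in>I. N k * E k) \<le> L"
  using assms
proof (induction I arbitrary: a rule: finite_induct)
  case empty
  from empty[of "\<lambda>_. 0"] show ?case by simp
next
  case (insert k I)
  define A where "A = {b. b < top \<and> (b = 0 \<or> b < E k)}"
  have "E k \<le> Sup A"
    by (rule dense_le) (auto simp: A_def intro!: Sup_upper intro: less_le_trans)
  moreover have "Sup A \<le> E k" by (auto simp: A_def intro!: Sup_least)
  ultimately have sup: "E k = Sup A" by simp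
  have le: "N k * b + (a + (\<Sum>k\<in>I. N k * E k)) \<le> L" if "b \<in> A" for b
  proof -
    have "(a + N k * b) + (\<Sum>k\<in>I. N k * E k) \<le> L"
    proof (rule insert.IH)
      fix b' assume b': "\<And>j. j \<in> I \<Longrightarrow> b' j < top \<and> (b' j = 0 \<or> b' j < E j)"
      have eq: "(\<Sum>j\<in>I. N j * (b'(k := b)) j) = (\<Sum>j\<in>I. N j * b' j)"
        using insert.hyps by (intro sum.cong) auto
      have "a + (\<Sum>j\<in>insert k I. N j * (b'(k := b)) j) \<le> L"
        using b' that by (intro insert.prems) (auto simp: A_def)
      then show "(a + N k * b) + (\<Sum>k\<in>I. N k * b' k) \<le> L"
        using insert.hyps eq by (simp add: add.assoc)
    qed
    then show ?thesis by (simp only: add.assoc add.commute add.left_commute)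
  qed
  have "A \<noteq> {}" by (auto simp: A_def intro!: exI[of _ 0])
  have "a + (\<Sum>k\<in>insert k I. N k * E k) = N k * E k + (a + (\<Sum>k\<in>I. N k * E k))"
    using insert.hyps by (simp add: add.left_commute)
  also have "\<dots> = (SUP b\<in>A. N k * b + (a + (\<Sum>k\<in>I. N k * E k)))"
  proof -
    have "N k * E k = (SUP b\<in>A. N k * b)"
      using SUP_mult_left_ennreal[of "N k" "\<lambda>b. b" A] by (simp add: sup)
    then show ?thesis using \<open>A \<noteq> {}\<close> by (simp add: ennreal_SUP_add_left)
  qed
  also have "\<dots> \<le> L" using le by (rule SUP_least)
  finally show ?case .
qed

lemma epowr_test_bound:
  assumes r: "0 < r" and b: "b \<le> epowr P (1 + r) * epowr v (- r)" and v: "v < top"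
  shows "epowr b (1 / r) * v \<le> epowr P (1 + 1 / r)"
proof (cases "v = 0")
  case False
  have p: "0 < 1 + r" "0 < 1 / r" using r by auto
  obtain y where y: "v = ennreal y" "0 < y" using v False by (cases v) (auto simp: less_eq_real_def)
  have "epowr v (- r) * epowr v r = 1"
    using y r by (simp add: epowr_ennreal epowr_neg_ennreal flip: ennreal_mult powr_add)
  then have "b * epowr v r \<le> epowr P (1 + r)"
    using mult_right_mono[OF b, of "epowr v r"] by (simp add: mult.assoc)
  from epowr_mono[OF p(2) this]
  have "epowr b (1 / r) * epowr v (r * (1 / r)) \<le> epowr P ((1 + r) * (1 / r))"
    using p r by (simp only: epowr_mult epowr_epowr)
  moreover have "r * (1 / r) = 1" "(1 + r) * (1 / r) = 1 + 1 / r" using r by (auto simp: field_simps)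
  ultimately show ?thesis by (simp only: epowr_one)
qed simp

text \<open>The supremum of \<open>\<integral> f * P^(1 + 1/r)\<close> over
  \<open>\<integral> f * v \<le> 1\<close> is the essential supremum of
  \<open>P^(1 + 1/r) / v\<close>, that is, the power \<open>1/r\<close> of the one of
  \<open>P^(1 + r) * v^(-r)\<close>. The function \<open>f\<close> certifies a value
  \<open>b\<close> below the latter.\<close>

definition test_function where
  "test_function r v P J b f \<longleftrightarrow> f \<in> borel_measurable lebesgue \<and> (\<forall>x::real. x \<notin> J \<longrightarrow> f x = 0) \<and>
    (\<integral>\<^sup>+x. f x * v x \<partial>lebesgue) \<le> 1 \<and>
    epowr b (1 / r) \<le> (\<integral>\<^sup>+x. f x * epowr (P x) (1 + 1 / r) \<partial>lebesgue)"

text \<open>Where the function under the essential supremum exceeds \<open>b\<close> there is a set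
  of positive measure, and a bounded piece \<open>B n\<close> of it already has positive measure. On
  a bounded piece \<open>v\<close> has finite integral \<open>a\<close>, so the indicator divided by
  \<open>a\<close> is a candidate.\<close>

lemma exists_test_function:
  fixes v P g :: "real \<Rightarrow> ennreal"
  assumes r: "0 < r" and [measurable]: "v \<in> borel_measurable lebesgue" "P \<in> borel_measurable lebesgue"
      "g \<in> borel_measurable lebesgue"
    and v: "\<And>t. (\<integral>\<^sup>+s\<in>{0<..<t}. v s \<partial>lebesgue) < top"
    and g: "\<And>x. 0 < x \<Longrightarrow> g x = epowr (v x) (- r)"
    and J [measurable]: "J \<in> sets lebesgue" and J_pos: "J \<subseteq> {0<..}"
    and b: "b = 0 \<or> b < esssup (lebesgue_on J) (\<lambda>x. epowr (P x) (1 + r) * g x)"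
  shows "\<exists>f. test_function r v P J b f"
proof (cases "b = 0")
  case True
  then show ?thesis unfolding test_function_def using r by (intro exI[of _ "\<lambda>_. 0"]) auto
next
  case False
  then have b: "b < esssup (lebesgue_on J) (\<lambda>x. epowr (P x) (1 + r) * g x)" using b by simp
  define B where "B n = {x \<in> space lebesgue. x \<in> J \<and> x < real n \<and> b < epowr (P x) (1 + r) * g x}" for n :: nat
  have [measurable]: "{..<real n} \<in> sets lebesgue" for n by simp
  have B_sets [measurable]: "B n \<in> sets lebesgue" for n
  proof -
    have "B n = J \<inter> {..<real n} \<inter> {x \<in> space lebesgue. b < epowr (P x) (1 + r) * g x}"
      by (auto simp: B_def)
    also have "\<dots> \<in> sets lebesgue" by measurable
    finally show ?thesis .
  qed
  have "\<exists>n. emeasure lebesgue (B n) \<noteq> 0"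
  proof (rule ccontr)
    assume "\<not> ?thesis"
    then have "(\<Union>n. B n) \<in> null_sets lebesgue" using B_sets by (intro null_sets_UN) auto
    then have "AE x in lebesgue. x \<notin> (\<Union>n. B n)" by (rule AE_not_in)
    then have "AE x in lebesgue. x \<in> J \<longrightarrow> epowr (P x) (1 + r) * g x \<le> b"
    proof eventually_elim
      case (elim x)
      obtain n where "x < real n" using reals_Archimedean2 by blast
      moreover have "x \<notin> B n" using elim by blast
      ultimately show ?case by (auto simp: B_def not_less)
    qed
    then have "esssup (lebesgue_on J) (\<lambda>x. epowr (P x) (1 + r) * g x) \<le> b"
      by (intro esssup_le measurable_restrict_space1) auto
    with b show False by simp
  qed
  then obtain n where n: "emeasure lebesgue (B n) \<noteq> 0" by blast
  define a where "a = (\<integral>\<^sup>+x\<in>B n. v x \<partial>lebesgue)"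
  have "a \<le> (\<integral>\<^sup>+x\<in>{0<..<real n}. v x \<partial>lebesgue)"
    unfolding a_def using J_pos by (intro set_nn_integral_mono_set) (auto simp: B_def)
  also have "\<dots> < top" by (rule v)
  finally have a: "a < top" .
  define f where "f x = indicator (B n) x / a" for x
  have vP: "v x < top" "b \<le> epowr (P x) (1 + r) * epowr (v x) (- r)" if "x \<in> B n" for x
  proof -
    have x: "b < epowr (P x) (1 + r) * epowr (v x) (- r)"
      using that g[of x] J_pos by (auto simp: B_def)
    then show "b \<le> epowr (P x) (1 + r) * epowr (v x) (- r)" by simp
    have "v x \<noteq> top" using x r by (intro notI) (simp add: epowr_neg_extremes)
    then show "v x < top" by (simp add: less_top)
  qed
  have fv: "(\<integral>\<^sup>+x. f x * v x \<partial>lebesgue) = a / a"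
  proof -
    have "(\<integral>\<^sup>+x. f x * v x \<partial>lebesgue) = (\<integral>\<^sup>+x. (v x * indicator (B n) x) / a \<partial>lebesgue)"
      unfolding f_def by (intro nn_integral_cong) (auto simp: indicator_def ennreal_times_divide ennreal_divide_times)
    also have "\<dots> = a / a" unfolding a_def by (intro nn_integral_divide) measurable
    finally show ?thesis .
  qed
  show ?thesis
    unfolding test_function_def
  proof (intro exI[of _ f] conjI allI impI)
    show "f \<in> borel_measurable lebesgue" unfolding f_def by measurable
    show "f x = 0" if "x \<notin> J" for x using that by (auto simp: f_def B_def)
    show "(\<integral>\<^sup>+x. f x * v x \<partial>lebesgue) \<le> 1" unfolding fv using a by (cases "a = 0") auto
    show "epowr b (1 / r) \<le> (\<integral>\<^sup>+x. f x * epowr (P x) (1 + 1 / r) \<partial>lebesgue)"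
    proof (cases "a = 0")
      case False
      then have "epowr b (1 / r) = epowr b (1 / r) * (\<integral>\<^sup>+x. f x * v x \<partial>lebesgue)" unfolding fv using a by simp
      also have "\<dots> = (\<integral>\<^sup>+x. epowr b (1 / r) * (f x * v x) \<partial>lebesgue)"
        unfolding f_def by (intro nn_integral_cmult[symmetric]) measurable
      also have "\<dots> \<le> (\<integral>\<^sup>+x. f x * epowr (P x) (1 + 1 / r) \<partial>lebesgue)"
      proof (intro nn_integral_mono)
        fix x
        show "epowr b (1 / r) * (f x * v x) \<le> f x * epowr (P x) (1 + 1 / r)"
        proof (cases "x \<in> B n")
          case True
          from mult_left_mono[OF epowr_test_bound[OF r vP(2)[OF True] vP(1)[OF True]], of "f x"]
          show ?thesis by (simp add: ac_simps)
        qed (simp add: f_def)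
      qed
      finally show ?thesis .
    next
      \<comment> \<open>Here \<open>f\<close> is \<infinity> on \<open>B n\<close>: its integral
        against \<open>v\<close> is 0 / 0 = 0, while \<open>P > 0\<close> on this set of positive
        measure makes the other integral infinite.\<close>
      case True
      have "(\<integral>\<^sup>+x. f x * epowr (P x) (1 + 1 / r) \<partial>lebesgue) = (\<integral>\<^sup>+x. top * indicator (B n) x \<partial>lebesgue)"
      proof (intro nn_integral_cong)
        fix x
        have "P x \<noteq> 0" if "x \<in> B n"
          using that r by (intro notI) (auto simp: B_def)
        moreover have "0 < 1 + 1 / r" using r by (auto intro: add_pos_pos)
        ultimately have "epowr (P x) (1 + 1 / r) \<noteq> 0" if "x \<in> B n"
          using that epowr_pos[of "1 + 1 / r" "P x"] by (auto simp: zero_less_iff_neq_zero)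
        then show "f x * epowr (P x) (1 + 1 / r) = top * indicator (B n) x"
          using True by (auto simp: f_def indicator_def ennreal_top_mult)
      qed
      also have "\<dots> = top" using n by (subst nn_integral_cmult_indicator) (auto simp: ennreal_top_mult)
      finally show ?thesis by simp
    qed
  qed
qed

lemma covering_sequence_mono:
  assumes "covering_sequence m n t" "m \<le> i" "i \<le> j" "j \<le> n"
  shows "t i \<le> t j"
  using assms(3,4)
proof (induction j rule: int_ge_induct)
  case (step j)
  then have "t j < t (j + 1)" using assms(1,2) by (auto simp: covering_sequence_def)
  then show ?case using step by auto
qed simp

lemma covering_sequence_less:
  assumes "covering_sequence m n t" "m \<le> i" "i < j" "j \<le> n"
  shows "t i < t j"
proof -
  have "t i < t (i + 1)" using assms by (auto simp: covering_sequence_def)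
  also have "\<dots> \<le> t j" using assms by (intro covering_sequence_mono[OF assms(1)]) auto
  finally show ?thesis .
qed

context hardy_data
begin

text \<open>For \<open>s < t k < x\<close> the kernel dominates a product
  \<open>Q k s * P k x\<close>. The choice \<open>Q = 1\<close>, \<open>P = u (t k)\<close> yields
  \<open>D3\<close>, and \<open>Q s = u s (t k)\<close>, \<open>P = 1\<close> yields
  \<open>D4\<close>. Testing with \<open>F\<close> gives
  \<open>A^(1 + 1/r) \<le> C * A\<close>.\<close>

lemma covering_sum_le_hardy:
  fixes Q P :: "int \<Rightarrow> real \<Rightarrow> ennreal" and t :: "int \<Rightarrow> ereal"
  assumes v_meas [measurable]: "v \<in> borel_measurable lebesgue"
    and v: "\<And>t. (\<integral>\<^sup>+s\<in>{0<..<t}. v s \<partial>lebesgue) < top"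
    and g: "\<And>x. 0 < x \<Longrightarrow> g x = epowr (v x) (- r)"
    and C: "C < top"
    and hardy: "\<And>f. f \<in> borel_measurable lebesgue \<Longrightarrow>
      epowr (hardy_int f) (1 + 1 / r)
        \<le> C * (\<integral>\<^sup>+t\<in>{0<..}. (f t * v t) \<partial>lebesgue)"
    and cov: "covering_sequence m n t"
    and Q [measurable]: "\<And>k. Q k \<in> borel_measurable lebesgue"
    and P [measurable]: "\<And>k. P k \<in> borel_measurable lebesgue"
    and QP: "\<And>k s x. k \<in> {m..n} - {m, n} \<Longrightarrow> s \<in> einterval (t (k - 1)) (t k) \<Longrightarrow>
      x \<in> einterval (t k) (t (k + 1)) \<Longrightarrow> Q k s * P k x \<le> u s x"
    and fin: "\<And>k. k \<in> {m..n} - {m, n} \<Longrightarrow> (\<integral>\<^sup>+s\<in>einterval (t (k - 1)) (t k). (w s * Q k s) \<partial>lebesgue) < top"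
  shows "(\<Sum>k\<in>{m..n} - {m, n}. epowr (\<integral>\<^sup>+s\<in>einterval (t (k - 1)) (t k). (w s * Q k s) \<partial>lebesgue) (1 + r) *
     esssup (lebesgue_on (einterval (t k) (t (k + 1)))) (\<lambda>x. epowr (P k x) (1 + r) * g x)) \<le> epowr C r"
proof -
  define I where "I = {m..n} - {m, n}"
  define J where "J k = einterval (t (k - 1)) (t k)" for k
  define N where "N k = (\<integral>\<^sup>+s\<in>J k. (w s * Q k s) \<partial>lebesgue)" for k
  define E where "E k = esssup (lebesgue_on (J (k + 1))) (\<lambda>x. epowr (P k x) (1 + r) * g x)" for k
  have p: "0 < 1 + 1 / r" and q: "0 < r / (1 + r)"
    using r_pos by (auto intro: add_pos_pos)
  have e: "(1 + 1 / r) * (r / (1 + r)) = 1" "1 / r * (r / (1 + r)) = 1 / (1 + r)"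
    "(1 + r) * (r / (1 + r)) = r" "1 / (1 + r) * (1 + r) = 1" "1 / r * r = 1"
  proof -
    have "1 + 1 / r = (1 + r) / r" using r_pos by (simp add: add_divide_distrib)
    then show "(1 + 1 / r) * (r / (1 + r)) = 1" using r_pos by simp
  qed (use r_pos in auto)
  have J_sets [measurable]: "J k \<in> sets lebesgue" for k by (simp add: J_def)
  have J_pos: "J k \<subseteq> {0<..}" if "k \<in> {m<..n}" for k
  proof -
    have "0 \<le> t (k - 1)"
      using covering_sequence_mono[OF cov, of m "k - 1"] cov that by (auto simp: covering_sequence_def)
    then show ?thesis unfolding J_def einterval_def
      by auto (metis ereal_less(2) less_ereal.simps(1) order.strict_trans1)
  qed
  have disj: "J i \<inter> J j = {}" if "i \<in> {m<..n}" "j \<in> {m<..n}" "i < j" for i j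
  proof -
    have "t i \<le> t (j - 1)" using covering_sequence_mono[OF cov, of i "j - 1"] that by auto
    then show ?thesis unfolding J_def einterval_def by (auto dest: less_trans order.strict_trans2)
  qed
  have "0 + (\<Sum>k\<in>I. epowr (N k) (1 + r) * E k) \<le> epowr C r"
  proof (rule sum_mult_le_if_below_le)
    fix b assume b: "\<And>k. k \<in> I \<Longrightarrow> b k < top \<and> (b k = 0 \<or> b k < E k)"
    have "\<forall>k\<in>I. \<exists>f. test_function r v (P k) (J (k + 1)) (b k) f"
    proof
      fix k assume k: "k \<in> I"
      have J: "J (k + 1) \<subseteq> {0<..}" using k by (intro J_pos) (auto simp: I_def)
      have "b k = 0 \<or> b k < esssup (lebesgue_on (J (k + 1))) (\<lambda>x. epowr (P k x) (1 + r) * g x)"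
        using b[OF k] by (simp add: E_def)
      from exists_test_function[OF r_pos v_meas P g_meas v g J_sets J this]
      show "\<exists>f. test_function r v (P k) (J (k + 1)) (b k) f" .
    qed
    from bchoice[OF this] obtain f where "\<forall>k\<in>I. test_function r v (P k) (J (k + 1)) (b k) (f k)" by blast
    then have f: "\<And>k. k \<in> I \<Longrightarrow> f k \<in> borel_measurable lebesgue"
      "\<And>k x. k \<in> I \<Longrightarrow> x \<notin> J (k + 1) \<Longrightarrow> f k x = 0"
      "\<And>k. k \<in> I \<Longrightarrow> (\<integral>\<^sup>+x. f k x * v x \<partial>lebesgue) \<le> 1"
      "\<And>k. k \<in> I \<Longrightarrow> epowr (b k) (1 / r) \<le> (\<integral>\<^sup>+x. f k x * epowr (P k x) (1 + 1 / r) \<partial>lebesgue)"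
      by (auto simp: test_function_def)
    \<comment> \<open>These coefficients solve \<open>a^(r/(1+r)) * b^(1/(1+r)) * N = a\<close>, so
      the left side of the inequality is bounded below by the same sum \<open>A\<close> that bounds
      the right side above.\<close>
    define a where "a k = epowr (N k) (1 + r) * b k" for k
    define F where "F x = (\<Sum>k\<in>I. a k * f k x)" for x
    define A where "A = (\<Sum>k\<in>I. a k)"
    have F_meas [measurable]: "F \<in> borel_measurable lebesgue"
      unfolding F_def using f(1) by measurable
    have Fv: "(\<integral>\<^sup>+x\<in>{0<..}. (F x * v x) \<partial>lebesgue) \<le> A"
    proof -
      have "(\<integral>\<^sup>+x\<in>{0<..}. (F x * v x) \<partial>lebesgue) \<le> (\<integral>\<^sup>+x. (\<Sum>k\<in>I. a k * (f k x * v x)) \<partial>lebesgue)"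
        unfolding F_def by (intro nn_integral_mono) (auto simp: indicator_def sum_distrib_right mult.assoc)
      also have "\<dots> = (\<Sum>k\<in>I. a k * (\<integral>\<^sup>+x. f k x * v x \<partial>lebesgue))"
        using f(1) by (subst nn_integral_sum) (auto simp: nn_integral_cmult)
      also have "\<dots> \<le> (\<Sum>k\<in>I. a k * 1)" using f(3) by (intro sum_mono mult_left_mono) auto
      finally show ?thesis by (simp add: A_def)
    qed
    have op: "a k * (epowr (Q k s) (1 + 1 / r) * epowr (b k) (1 / r)) \<le> hardy_op F s"
      if k: "k \<in> I" and s: "s \<in> J k" for k s
    proof -
      note fk [measurable] = f(1)[OF k]
      have "a k * (epowr (Q k s) (1 + 1 / r) * epowr (b k) (1 / r)) \<le>
          a k * (epowr (Q k s) (1 + 1 / r) * (\<integral>\<^sup>+x. f k x * epowr (P k x) (1 + 1 / r) \<partial>lebesgue))"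
        by (intro mult_left_mono f(4) k) auto
      also have "\<dots> = (\<integral>\<^sup>+x. a k * epowr (Q k s) (1 + 1 / r) * (f k x * epowr (P k x) (1 + 1 / r)) \<partial>lebesgue)"
        unfolding mult.assoc[symmetric, of "a k"] by (intro nn_integral_cmult[symmetric]) measurable
      also have "\<dots> \<le> hardy_op F s"
        unfolding hardy_op_def
      proof (intro nn_integral_mono)
        fix x
        show "a k * epowr (Q k s) (1 + 1 / r) * (f k x * epowr (P k x) (1 + 1 / r)) \<le>
          F x * epowr (u s x) (1 + 1 / r) * indicator {s<..} x"
        proof (cases "x \<in> J (k + 1)")
          case True
          have "s < x" using s True by (auto simp: J_def einterval_def dest: less_trans)
          have "epowr (Q k s) (1 + 1 / r) * epowr (P k x) (1 + 1 / r) \<le> epowr (u s x) (1 + 1 / r)"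
            unfolding epowr_mult[OF p, symmetric]
            using QP[of k s x] k s True by (intro epowr_mono p) (auto simp: I_def J_def)
          moreover have "a k * f k x \<le> F x"
            unfolding F_def using k by (intro member_le_sum) (auto simp: I_def)
          ultimately have "(a k * f k x) * (epowr (Q k s) (1 + 1 / r) * epowr (P k x) (1 + 1 / r)) \<le>
            F x * epowr (u s x) (1 + 1 / r)"
            by (intro mult_mono) auto
          then show ?thesis using \<open>s < x\<close> by (simp add: ac_simps)
        qed (use f(2)[OF k] in simp)
      qed
      finally show ?thesis .
    qed
    have "A \<le> hardy_int F"
    proof -
      have "A = (\<Sum>k\<in>I. \<integral>\<^sup>+s. epowr (a k) (r / (1 + r)) * epowr (b k) (1 / (1 + r)) * (w s * Q k s * indicator (J k) s) \<partial>lebesgue)"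
        unfolding A_def
      proof (rule sum.cong)
        fix k assume k: "k \<in> I"
        have "a k = epowr (N k * epowr (b k) (1 / (1 + r))) (1 + r)"
          using r1_pos r_pos by (simp add: epowr_mult epowr_epowr e a_def)
        then have "epowr (a k) (r / (1 + r)) = epowr (N k * epowr (b k) (1 / (1 + r))) r"
          using r1_pos q by (simp only: epowr_epowr e)
        moreover have "a k = N k * epowr (b k) (1 / (1 + r)) * epowr (N k * epowr (b k) (1 / (1 + r))) r"
          unfolding epowr_Suc[OF r_pos, symmetric] by fact
        ultimately have "a k = epowr (a k) (r / (1 + r)) * epowr (b k) (1 / (1 + r)) * N k"
          by (simp only: ac_simps)
        also have "\<dots> = (\<integral>\<^sup>+s. epowr (a k) (r / (1 + r)) * epowr (b k) (1 / (1 + r)) * (w s * Q k s * indicator (J k) s) \<partial>lebesgue)"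
          unfolding N_def by (intro nn_integral_cmult[symmetric]) measurable
        finally show "a k = (\<integral>\<^sup>+s. epowr (a k) (r / (1 + r)) * epowr (b k) (1 / (1 + r)) * (w s * Q k s * indicator (J k) s) \<partial>lebesgue)" .
      qed simp
      also have "\<dots> = (\<integral>\<^sup>+s. (\<Sum>k\<in>I. epowr (a k) (r / (1 + r)) * epowr (b k) (1 / (1 + r)) * (w s * Q k s * indicator (J k) s)) \<partial>lebesgue)"
        by (intro nn_integral_sum[symmetric]) measurable
      also have "\<dots> \<le> hardy_int F"
        unfolding hardy_int_def
      proof (intro nn_integral_mono)
        fix s
        let ?T = "\<lambda>k. epowr (a k) (r / (1 + r)) * epowr (b k) (1 / (1 + r)) * (w s * Q k s * indicator (J k) s)"
        show "(\<Sum>k\<in>I. ?T k) \<le> epowr (hardy_op F s) (r / (1 + r)) * w s * indicator {0<..} s"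
        proof (cases "\<exists>k\<in>I. s \<in> J k")
          case True
          then obtain k where k: "k \<in> I" "s \<in> J k" by blast
          have "0 < s" using J_pos[of k] k by (auto simp: I_def)
          \<comment> \<open>By disjointness at most one term is present at each \<open>s\<close>, so
            the power acts on a single product and not on a sum.\<close>
          have "s \<notin> J j" if "j \<in> I" "j \<noteq> k" for j
            using disj[of j k] disj[of k j] that k by (cases "j < k") (auto simp: I_def)
          then have "(\<Sum>j\<in>I. ?T j) = ?T k"
            using k by (subst sum.remove[of I k]) (auto simp: I_def intro!: sum.neutral)
          also have "\<dots> = epowr (a k * (epowr (Q k s) (1 + 1 / r) * epowr (b k) (1 / r))) (r / (1 + r)) * w s"
          proof -
            have "epowr (a k * (epowr (Q k s) (1 + 1 / r) * epowr (b k) (1 / r))) (r / (1 + r)) =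
                epowr (a k) (r / (1 + r)) * (Q k s * epowr (b k) (1 / (1 + r)))"
              using p q r_pos by (simp only: epowr_mult epowr_epowr e epowr_one zero_less_divide_1_iff)
            then show ?thesis using k by (simp add: ac_simps)
          qed
          also have "\<dots> \<le> epowr (hardy_op F s) (r / (1 + r)) * w s"
            using op[OF k] q by (intro mult_right_mono epowr_mono) auto
          finally show ?thesis using \<open>0 < s\<close> by simp
        qed (auto intro!: sum.neutral)
      qed
      finally show ?thesis .
    qed
    from epowr_mono[OF p this] have "epowr A (1 + 1 / r) \<le> epowr (hardy_int F) (1 + 1 / r)" .
    also have "\<dots> \<le> C * (\<integral>\<^sup>+x\<in>{0<..}. (F x * v x) \<partial>lebesgue)" by (rule hardy) simp
    also have "\<dots> \<le> C * A" using Fv by (rule mult_left_mono) simp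
    finally have AC: "A * epowr A (1 / r) \<le> A * C"
      using r_pos by (simp add: epowr_Suc mult.commute)
    \<comment> \<open>Cancelling \<open>A\<close> needs finiteness, which comes from the finite
      values \<open>b k\<close> and from \<open>fin\<close>.\<close>
    have "A < top"
      unfolding A_def a_def using b fin epowr_less_top[OF r1_pos]
      by (auto simp: ennreal_mult_less_top I_def N_def J_def intro!: ennreal_sum_less_top)
    have "A \<le> epowr C r"
    proof (cases "A = 0")
      case False
      then have "epowr A (1 / r) \<le> C"
        using AC \<open>A < top\<close> by (subst (asm) ennreal_mult_le_mult_iff) (auto simp: less_top)
      from epowr_mono[OF r_pos this] have "epowr A (1 / r * r) \<le> epowr C r"
        using r_pos by (simp only: epowr_epowr zero_less_divide_1_iff)
      then show ?thesis by (simp only: e epowr_one)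
    qed simp
    then show "0 + (\<Sum>k\<in>I. epowr (N k) (1 + r) * b k) \<le> epowr C r"
      by (simp add: A_def a_def)
  qed (simp add: I_def)
  then show ?thesis by (simp add: I_def N_def E_def J_def)
qed

end

section \<open>The Hardy inequality\<close>

text \<open>Equality on the whole space also transfers measurability, so the default value of
  \<open>esssup\<close> at non-measurable functions agrees as well.\<close>

lemma esssup_cong:
  assumes "\<And>x. x \<in> space M \<Longrightarrow> f x = h x"
  shows "esssup M f = esssup M h"
proof -
  have "f \<in> borel_measurable M \<longleftrightarrow> h \<in> borel_measurable M"
    using assms by (rule measurable_cong)
  moreover have "(AE x in M. f x \<le> z) \<longleftrightarrow> (AE x in M. h x \<le> z)" for z
    using assms by (intro AE_cong) auto
  ultimately show ?thesis
    by (cases "h \<in> borel_measurable M") (auto simp: esssup_eq_AE esssup_non_measurable)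
qed

lemma set_nn_integral_cong_on:
  assumes "\<And>x. x \<in> A \<Longrightarrow> f x = h x"
  shows "(\<integral>\<^sup>+x\<in>A. f x \<partial>M) = (\<integral>\<^sup>+x\<in>A. h x \<partial>M)"
  using assms by (intro nn_integral_cong) (auto simp: indicator_def)

lemma Mplus_iff: "f \<in> Mplus \<longleftrightarrow> (\<lambda>x. f x * indicator {0<..} x) \<in> borel_measurable lebesgue"
  unfolding Mplus_def by (subst borel_measurable_restrict_space_iff_ennreal) simp_all

context hardy_data
begin

lemma integral_dens_eq:
  "(\<integral>\<^sup>+t\<in>{0<..}. (w t * dens t) \<partial>lebesgue) =
    (\<integral>\<^sup>+t\<in>{0<..}. (epowr (W t) r * w t * phi t) \<partial>lebesgue) +
    (\<integral>\<^sup>+t\<in>{0<..}. (epowr (M t t) r * w t * psi t) \<partial>lebesgue)"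
proof -
  have "(\<integral>\<^sup>+t\<in>{0<..}. (w t * dens t) \<partial>lebesgue) =
    (\<integral>\<^sup>+t. epowr (W t) r * w t * (phi t * indicator {0<..} t) + epowr (M t t) r * w t * (psi t * indicator {0<..} t) \<partial>lebesgue)"
    by (intro nn_integral_cong) (auto simp: dens_def indicator_def distrib_left ac_simps)
  also have "\<dots> = (\<integral>\<^sup>+t. epowr (W t) r * w t * (phi t * indicator {0<..} t) \<partial>lebesgue) +
     (\<integral>\<^sup>+t. epowr (M t t) r * w t * (psi t * indicator {0<..} t) \<partial>lebesgue)"
    by (intro nn_integral_add) measurable
  finally show ?thesis by (simp only: mult.assoc)
qed

end

section \<open>Return to the original kernel and weights\<close>

locale hardy_setting =
  fixes q \<theta> r c :: real and U :: "real \<Rightarrow> real \<Rightarrow> real" and v w :: "real \<Rightarrow> ennreal"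
  assumes q: "0 < q" "q < 1" and theta: "0 < \<theta>"
    and r_def: "r = q / (1 - q)" and c_def: "c = max 1 (\<theta> powr q)"
    and U: "regular_kernel \<theta> U" and v: "weight v" and w: "weight w"
begin

text \<open>The given data are unconstrained on part of the line, while \<open>hardy_data\<close>
  imposes measurability and kernel conditions globally; hence the cut-off to positive arguments,
  here and for the weights.\<close>

definition u' :: "real \<Rightarrow> real \<Rightarrow> ennreal" where
  "u' x y = (if 0 < x \<and> 0 < y then ennreal (U x y powr q) else 0)"

definition w' :: "real \<Rightarrow> ennreal" where "w' x = w x * indicator {0<..} x"

definition v' :: "real \<Rightarrow> ennreal" where "v' x = v x * indicator {0<..} x"

definition g' :: "real \<Rightarrow> ennreal" where "g' x = epowr (v' x) (- r)"

lemma r_pos: "0 < r" using q by (simp add: r_def)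

lemma q_eq: "r / (1 + r) = q" "1 + 1 / r = 1 / q" "q * (1 + r) = r"
  and conj_exp_eq: "conj_exp q = - r"
proof -
  have *: "1 + r = 1 / (1 - q)" using q by (simp add: r_def field_simps)
  then show "r / (1 + r) = q" "q * (1 + r) = r" using q by (simp_all add: r_def)
  show "1 + 1 / r = 1 / q" using q by (simp add: r_def field_simps)
  show "conj_exp q = - r" using q by (simp add: r_def conj_exp_def field_simps)
qed

lemma U_nonneg: "0 \<le> x \<Longrightarrow> 0 \<le> y \<Longrightarrow> 0 \<le> U x y"
  and U_anti: "0 \<le> x \<Longrightarrow> x \<le> x' \<Longrightarrow> 0 \<le> y \<Longrightarrow> U x' y \<le> U x y"
  and U_mono: "0 \<le> x \<Longrightarrow> 0 \<le> y \<Longrightarrow> y \<le> y' \<Longrightarrow> U x y \<le> U x y'"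
  and U_tri: "0 \<le> x \<Longrightarrow> x < y \<Longrightarrow> y < z \<Longrightarrow> U x z \<le> \<theta> * (U x y + U y z)"
proof -
  note K = U[unfolded regular_kernel_def]
  show "0 \<le> x \<Longrightarrow> 0 \<le> y \<Longrightarrow> 0 \<le> U x y" using K[THEN conjunct2, THEN conjunct1] by blast
  show "0 \<le> x \<Longrightarrow> x \<le> x' \<Longrightarrow> 0 \<le> y \<Longrightarrow> U x' y \<le> U x y"
    using K[THEN conjunct2, THEN conjunct2, THEN conjunct1] by blast
  show "0 \<le> x \<Longrightarrow> 0 \<le> y \<Longrightarrow> y \<le> y' \<Longrightarrow> U x y \<le> U x y'"
    using K[THEN conjunct2, THEN conjunct2, THEN conjunct2, THEN conjunct1] by blast
  show "0 \<le> x \<Longrightarrow> x < y \<Longrightarrow> y < z \<Longrightarrow> U x z \<le> \<theta> * (U x y + U y z)"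
    using K[THEN conjunct2, THEN conjunct2, THEN conjunct2, THEN conjunct2, THEN conjunct1] by blast
qed

lemma weight_set_integral: "(\<integral>\<^sup>+s\<in>{0<..<t}. (f s * indicator {0<..} s) \<partial>lebesgue) = (\<integral>\<^sup>+s\<in>{0<..<t}. f s \<partial>lebesgue)"
  for t :: real and f :: "real \<Rightarrow> ennreal"
  by (rule set_nn_integral_cong_on) simp

lemma weight_finite: "weight f \<Longrightarrow> (\<integral>\<^sup>+s\<in>{0<..<t}. f s \<partial>lebesgue) < top"
  by (cases "0 < t") (auto simp: weight_def)

lemma v'_meas: "v' \<in> borel_measurable lebesgue" and w'_meas: "w' \<in> borel_measurable lebesgue"
proof -
  have "v' = (\<lambda>x. v x * indicator {0<..} x)" "w' = (\<lambda>x. w x * indicator {0<..} x)"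
    by (auto simp: v'_def w'_def)
  then show "v' \<in> borel_measurable lebesgue" "w' \<in> borel_measurable lebesgue"
    using v w by (simp_all add: weight_def Mplus_iff)
qed

lemma hardy_data_uwg: "hardy_data r c u' w' g'"
proof
  show "w' \<in> borel_measurable lebesgue" by (rule w'_meas)
  show "g' \<in> borel_measurable lebesgue" unfolding g'_def using v'_meas by measurable
  show "0 < (\<integral>\<^sup>+s\<in>{0<..<t}. w' s \<partial>lebesgue)" if "0 < t" for t
    using w that unfolding w'_def weight_set_integral by (simp add: weight_def)
  show "(\<integral>\<^sup>+s\<in>{0<..<t}. w' s \<partial>lebesgue) < top" for t
    unfolding w'_def weight_set_integral by (rule weight_finite[OF w])
  show "u' x' y \<le> u' x y" if "0 < x" "x \<le> x'" for x x' y
    using that q U_anti[of x x' y] U_nonneg[of x' y] by (auto simp: u'_def intro!: ennreal_leI powr_mono2)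
  show "u' x y \<le> u' x y'" if "y \<le> y'" for x y y'
    using that q U_mono[of x y y'] U_nonneg[of x y] by (auto simp: u'_def intro!: ennreal_leI powr_mono2)
  show "u' x z \<le> ennreal c * (u' x y + u' y z)" if xyz: "0 < x" "x < y" "y < z" for x y z
  proof -
    have nn: "0 \<le> U x y" "0 \<le> U y z" "0 \<le> U x z" using xyz by (auto intro!: U_nonneg)
    have "U x z powr q \<le> (\<theta> * (U x y + U y z)) powr q"
      using U_tri[of x y z] xyz nn q by (intro powr_mono2) auto
    also have "\<dots> = \<theta> powr q * (U x y + U y z) powr q" by (rule powr_mult)
    \<comment> \<open>Subadditivity of the power \<open>q < 1\<close> gives the constant
      \<open>\<theta>^q\<close>; the maximum with 1 in \<open>c\<close> serves the coincident points
      in \<open>u_triangle'\<close>.\<close>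
    also have "\<dots> \<le> c * (U x y powr q + U y z powr q)"
      using nn q powr_subadd[of q "U x y" "U y z"] by (intro mult_mono) (auto simp: c_def)
    finally show ?thesis
      using xyz by (simp add: u'_def c_def flip: ennreal_mult ennreal_plus)
  qed
  show "\<exists>B<top. \<forall>x. u' x y \<le> B" for y
  proof (intro exI[of _ "ennreal (U 0 y powr q)"] conjI allI)
    show "u' x y \<le> ennreal (U 0 y powr q)" for x
      using q U_anti[of 0 x y] U_nonneg[of x y] by (auto simp: u'_def intro!: ennreal_leI powr_mono2)
  qed simp
qed (auto simp: r_pos c_def u'_def)

interpretation hardy_data r c u' w' g'
  by (rule hardy_data_uwg)

lemma v'_finite: "(\<integral>\<^sup>+s\<in>{0<..<t}. v' s \<partial>lebesgue) < top"
  unfolding v'_def weight_set_integral by (rule weight_finite[OF v])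

lemma u'_eq: "0 < x \<Longrightarrow> 0 < y \<Longrightarrow> u' x y = epowr (ennreal (U x y)) q"
  using q U_nonneg[of x y] by (simp add: u'_def epowr_ennreal)

lemma u'_powr: "0 < x \<Longrightarrow> 0 < y \<Longrightarrow> epowr (u' x y) (1 + r) = epowr (ennreal (U x y)) r"
    "0 < x \<Longrightarrow> 0 < y \<Longrightarrow> epowr (u' x y) (1 + 1 / r) = ennreal (U x y)"
  using q r_pos by (simp_all add: u'_eq epowr_epowr q_eq)

lemma covering_points:
  assumes "covering_sequence m n t" "k \<in> {m..n} - {m, n}"
  shows "einterval (t (k - 1)) (t k) \<subseteq> {0<..}" "einterval (t k) (t (k + 1)) \<subseteq> {0<..}"
    "\<exists>x>0. t k = ereal x"
proof -
  have "0 = t m" "t n = \<infinity>" using assms by (auto simp: covering_sequence_def)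
  then have *: "0 \<le> t (k - 1)" "0 < t k" "t k < \<infinity>"
    using covering_sequence_mono[OF assms(1), of m "k - 1"] covering_sequence_less[OF assms(1), of m k]
      covering_sequence_less[OF assms(1), of k n] assms(2) by auto
  show "einterval (t (k - 1)) (t k) \<subseteq> {0<..}" "einterval (t k) (t (k + 1)) \<subseteq> {0<..}"
    using * unfolding einterval_def
    by (auto, metis ereal_less(2) less_ereal.simps(1) order.strict_trans1)
      (metis ereal_less(2) less_ereal.simps(1) less_trans)
  show "\<exists>x>0. t k = ereal x" using * by (cases "t k") auto
qed

lemma D3_eq: "D3 q U v w = DD3"
  unfolding D3_def DD3_def cover_sup_def Let_def conj_exp_eq
proof (intro SUP_cong refl, safe, intro sum.cong refl)
  fix m n t k assume *: "covering_sequence m n t" "k \<in> {m..n} - {m, n}"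
  obtain x where x: "0 < x" "t k = ereal x" using covering_points(3)[OF *] by blast
  show "epowr (\<integral>\<^sup>+s\<in>einterval (t (k - 1)) (t k). w s \<partial>lebesgue) (1 - - r) *
      esssup (lebesgue_on (einterval (t k) (t (k + 1))))
        (\<lambda>y. epowr (ennreal (U (real_of_ereal (t k)) y)) (- (- r)) * epowr (v y) (- r)) =
      d3 (t (k - 1)) (t k) (t (k + 1))"
    unfolding d3_def
    by (rule arg_cong2[where f = "(*)", OF arg_cong2[where f = epowr, OF set_nn_integral_cong_on] esssup_cong])
      (use covering_points(1,2)[OF *] x in \<open>auto simp: w'_def g'_def v'_def u'_powr subset_eq\<close>)
qed

lemma D4_eq: "D4 q U v w = DD4"
  unfolding D4_def DD4_def cover_sup_def Let_def conj_exp_eq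
proof (intro SUP_cong refl, safe, intro sum.cong refl)
  fix m n t k assume *: "covering_sequence m n t" "k \<in> {m..n} - {m, n}"
  obtain x where x: "0 < x" "t k = ereal x" using covering_points(3)[OF *] by blast
  show "epowr (\<integral>\<^sup>+s\<in>einterval (t (k - 1)) (t k). (w s * epowr (ennreal (U s (real_of_ereal (t k)))) q) \<partial>lebesgue) (1 - - r) *
      esssup (lebesgue_on (einterval (t k) (t (k + 1)))) (\<lambda>y. epowr (v y) (- r)) =
      d4 (t (k - 1)) (t k) (t (k + 1))"
    unfolding d4_def
    by (rule arg_cong2[where f = "(*)", OF arg_cong2[where f = epowr, OF set_nn_integral_cong_on] esssup_cong])
      (use covering_points(1,2)[OF *] x in \<open>auto simp: w'_def g'_def v'_def u'_eq subset_eq\<close>)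
qed

lemma A_eq: "A3 q U v w + A4 q U v w = (\<integral>\<^sup>+t\<in>{0<..}. (w' t * dens t) \<partial>lebesgue)"
proof -
  have "A3 q U v w = (\<integral>\<^sup>+t\<in>{0<..}. (epowr (W t) r * w' t * phi t) \<partial>lebesgue)"
    unfolding A3_def Let_def conj_exp_eq
  proof (rule set_nn_integral_cong_on)
    fix t :: real assume "t \<in> {0<..}"
    then have t: "0 < t" by simp
    have 1: "(\<integral>\<^sup>+x\<in>{0<..<t}. w x \<partial>lebesgue) = W t"
      unfolding W_def w'_def weight_set_integral ..
    have 2: "esssup (lebesgue_on {t<..}) (\<lambda>z. epowr (ennreal (U t z)) (- (- r)) * epowr (v z) (- r)) = phi t"
      unfolding phi_def using t by (intro esssup_cong) (auto simp: u'_powr g'_def v'_def)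
    show "epowr (\<integral>\<^sup>+x\<in>{0<..<t}. w x \<partial>lebesgue) (- (- r)) * w t *
        esssup (lebesgue_on {t<..}) (\<lambda>z. epowr (ennreal (U t z)) (- (- r)) * epowr (v z) (- r)) =
      epowr (W t) r * w' t * phi t"
      unfolding 1 2 using t by (simp add: w'_def)
  qed
  moreover have "A4 q U v w = (\<integral>\<^sup>+t\<in>{0<..}. (epowr (M t t) r * w' t * psi t) \<partial>lebesgue)"
    unfolding A4_def Let_def conj_exp_eq
  proof (rule set_nn_integral_cong_on)
    fix t :: real assume "t \<in> {0<..}"
    then have t: "0 < t" by simp
    have 1: "(\<integral>\<^sup>+x\<in>{0<..<t}. (w x * epowr (ennreal (U x t)) q) \<partial>lebesgue) = M t t"
      unfolding M_def using t by (intro set_nn_integral_cong_on) (auto simp: w'_def u'_eq)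
    have 2: "esssup (lebesgue_on {t<..}) (\<lambda>z. epowr (ennreal (U t z)) q * epowr (v z) (- r)) = psi t"
      unfolding psi_def using t by (intro esssup_cong) (auto simp: u'_eq g'_def v'_def)
    show "epowr (\<integral>\<^sup>+x\<in>{0<..<t}. (w x * epowr (ennreal (U x t)) q) \<partial>lebesgue) (- (- r)) * w t *
        esssup (lebesgue_on {t<..}) (\<lambda>z. epowr (ennreal (U t z)) q * epowr (v z) (- r)) =
      epowr (M t t) r * w' t * psi t"
      unfolding 1 2 using t by (simp add: w'_def)
  qed
  ultimately show ?thesis unfolding integral_dens_eq by simp
qed

lemma hardy_sides:
  "(\<integral>\<^sup>+t\<in>{0<..}. (epowr (\<integral>\<^sup>+x\<in>{t<..}. f x * ennreal (U t x) \<partial>lebesgue) q * w t) \<partial>lebesgue) =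
    hardy_int (\<lambda>x. f x * indicator {0<..} x)"
  "(\<integral>\<^sup>+t\<in>{0<..}. (f t * v t) \<partial>lebesgue) = (\<integral>\<^sup>+t\<in>{0<..}. (f t * indicator {0<..} t * v' t) \<partial>lebesgue)"
proof -
  have "(\<integral>\<^sup>+x\<in>{t<..}. f x * ennreal (U t x) \<partial>lebesgue) = hardy_op (\<lambda>x. f x * indicator {0<..} x) t" if "0 < t" for t
    unfolding hardy_op_def using that by (intro set_nn_integral_cong_on) (auto simp: u'_powr)
  then show "(\<integral>\<^sup>+t\<in>{0<..}. (epowr (\<integral>\<^sup>+x\<in>{t<..}. f x * ennreal (U t x) \<partial>lebesgue) q * w t) \<partial>lebesgue) =
    hardy_int (\<lambda>x. f x * indicator {0<..} x)"
    unfolding hardy_int_def by (intro set_nn_integral_cong_on) (auto simp: w'_def q_eq)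
  show "(\<integral>\<^sup>+t\<in>{0<..}. (f t * v t) \<partial>lebesgue) = (\<integral>\<^sup>+t\<in>{0<..}. (f t * indicator {0<..} t * v' t) \<partial>lebesgue)"
    by (intro set_nn_integral_cong_on) (auto simp: v'_def)
qed

lemma D_le_hardy:
  assumes "hardy_inequality q U v w C"
  shows "DD3 \<le> epowr C r" "DD4 \<le> epowr C r"
proof -
  have "DD3 \<le> epowr C r \<and> DD4 \<le> epowr C r"
  proof (cases "C = top")
    case False
    then have C: "C < top" by (simp add: less_top)
    have hardy: "epowr (hardy_int f) (1 + 1 / r)
        \<le> C * (\<integral>\<^sup>+t\<in>{0<..}. (f t * v' t) \<partial>lebesgue)" if f: "f \<in> borel_measurable lebesgue" for f
    proof -
      have "hardy_op (\<lambda>x. f x * indicator {0<..} x) t = hardy_op f t" if "0 < t" for t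
        unfolding hardy_op_def using that by (intro set_nn_integral_cong_on) auto
      then have "hardy_int (\<lambda>x. f x * indicator {0<..} x) = hardy_int f"
        unfolding hardy_int_def by (intro set_nn_integral_cong_on) simp
      moreover have "(\<integral>\<^sup>+t\<in>{0<..}. (f t * indicator {0<..} t * v' t) \<partial>lebesgue) = (\<integral>\<^sup>+t\<in>{0<..}. (f t * v' t) \<partial>lebesgue)"
        by (intro set_nn_integral_cong_on) simp
      moreover have "f \<in> Mplus" using f by (simp add: Mplus_iff)
      ultimately show ?thesis
        using assms unfolding hardy_inequality_def hardy_sides q_eq(2) by auto
    qed
    have "DD3 \<le> epowr C r"
      unfolding DD3_def cover_sup_def
    proof (rule SUP_least, safe)
      fix m n t assume cov: "covering_sequence m n t"
      have "(\<Sum>k\<in>{m..n} - {m, n}. epowr (\<integral>\<^sup>+s\<in>einterval (t (k - 1)) (t k). (w' s * 1) \<partial>lebesgue) (1 + r) *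
         esssup (lebesgue_on (einterval (t k) (t (k + 1)))) (\<lambda>x. epowr (u' (real_of_ereal (t k)) x) (1 + r) * g' x)) \<le> epowr C r"
      proof (rule covering_sum_le_hardy[where Q = "\<lambda>k s. 1" and P = "\<lambda>k. u' (real_of_ereal (t k))", OF v'_meas v'_finite _ C hardy cov])
        fix k assume k: "k \<in> {m..n} - {m, n}"
        obtain x where x: "0 < x" "t k = ereal x" using covering_points(3)[OF cov k] by blast
        show "1 * u' (real_of_ereal (t k)) y \<le> u' s y" if "s \<in> einterval (t (k - 1)) (t k)" for s y
          using that x covering_points(1)[OF cov k] by (auto simp: einterval_def intro!: u_anti)
        have "(\<integral>\<^sup>+s\<in>einterval (t (k - 1)) (t k). (w' s * 1) \<partial>lebesgue) \<le> W x"
          unfolding W_def mult_1_right using covering_points(1)[OF cov k] x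
          by (intro set_nn_integral_mono_set) (auto simp: einterval_def)
        then show "(\<integral>\<^sup>+s\<in>einterval (t (k - 1)) (t k). (w' s * 1) \<partial>lebesgue) < top"
          using W_less_top by (rule le_less_trans)
      qed (auto simp: g'_def)
      then show "(\<Sum>k\<in>{m..n} - {m, n}. d3 (t (k - 1)) (t k) (t (k + 1))) \<le> epowr C r"
        by (simp add: d3_def)
    qed
    moreover have "DD4 \<le> epowr C r"
      unfolding DD4_def cover_sup_def
    proof (rule SUP_least, safe)
      fix m n t assume cov: "covering_sequence m n t"
      have "(\<Sum>k\<in>{m..n} - {m, n}. epowr (\<integral>\<^sup>+s\<in>einterval (t (k - 1)) (t k). (w' s * u' s (real_of_ereal (t k))) \<partial>lebesgue) (1 + r) *
         esssup (lebesgue_on (einterval (t k) (t (k + 1)))) (\<lambda>x. epowr 1 (1 + r) * g' x)) \<le> epowr C r"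
      proof (rule covering_sum_le_hardy[where Q = "\<lambda>k s. u' s (real_of_ereal (t k))" and P = "\<lambda>k x. 1", OF v'_meas v'_finite _ C hardy cov])
        fix k assume k: "k \<in> {m..n} - {m, n}"
        obtain x where x: "0 < x" "t k = ereal x" using covering_points(3)[OF cov k] by blast
        show "u' s (real_of_ereal (t k)) * 1 \<le> u' s y" if "y \<in> einterval (t k) (t (k + 1))" for s y
          using that x by (auto simp: einterval_def intro!: u_mono)
        have "(\<integral>\<^sup>+s\<in>einterval (t (k - 1)) (t k). (w' s * u' s (real_of_ereal (t k))) \<partial>lebesgue) \<le> M x x"
          unfolding M_def x(2) using covering_points(1)[OF cov k] x
          by (simp, intro set_nn_integral_mono_set) (auto simp: einterval_def)
        then show "(\<integral>\<^sup>+s\<in>einterval (t (k - 1)) (t k). (w' s * u' s (real_of_ereal (t k))) \<partial>lebesgue) < top"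
          using M_less_top by (rule le_less_trans)
      qed (auto simp: g'_def)
      moreover have "epowr 1 (1 + r) = 1" using r_pos epowr_ennreal[of 1 "1 + r"] by simp
      ultimately show "(\<Sum>k\<in>{m..n} - {m, n}. d4 (t (k - 1)) (t k) (t (k + 1))) \<le> epowr C r"
        by (simp add: d4_def)
    qed
    ultimately show ?thesis ..
  qed (use r_pos in simp)
  then show "DD3 \<le> epowr C r" "DD4 \<le> epowr C r" by auto
qed

text \<open>Taking the power \<open>1/r\<close> turns the bound into \<open>X^(1/r) \<le> C\<close>
  for every admissible \<open>C\<close>, which passes to the infimum whether or not it is
  attained.\<close>

lemma D_le_least_constant:
  "D3 q U v w + D4 q U v w \<le> 2 * epowr (least_constant q U v w) r"
proof -
  have "X \<le> epowr (least_constant q U v w) r"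
    if "\<And>C. hardy_inequality q U v w C \<Longrightarrow> X \<le> epowr C r" for X
  proof -
    have e: "r * (1 / r) = 1" "1 / r * r = 1" "0 < 1 / r" using r_pos by auto
    have "epowr X (1 / r) \<le> least_constant q U v w"
      unfolding least_constant_def
    proof (rule Inf_greatest)
      fix C assume "C \<in> {C. hardy_inequality q U v w C}"
      then have "X \<le> epowr C r" using that by simp
      from epowr_mono[OF e(3) this] show "epowr X (1 / r) \<le> C"
        using r_pos e by (simp only: epowr_epowr epowr_one)
    qed
    from epowr_mono[OF r_pos this] show ?thesis
      using r_pos e by (simp only: epowr_epowr epowr_one)
  qed
  then show ?thesis unfolding D3_eq D4_eq mult_2 using D_le_hardy by (intro add_mono) auto
qed

lemma A_le_D: "A3 q U v w + A4 q U v w \<le> Abound r c * (D3 q U v w + D4 q U v w)"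
  unfolding A_eq D3_eq D4_eq by (rule integral_dens_le_D)

text \<open>Every finite \<open>B\<close> above \<open>3 * Sbound r c * (A3 + A4)\<close> is
  admissible in \<open>hardy_op_le\<close>, and the resulting constant satisfies
  \<open>C^r = 2^(1 + r) * B\<close>; then \<open>B\<close> decreases to its bound.\<close>

lemma least_constant_le_A:
  "epowr (least_constant q U v w) r \<le> epowr 2 (1 + r) * (3 * Sbound r c) * (A3 q U v w + A4 q U v w)"
proof -
  let ?L = "least_constant q U v w" and ?I = "3 * Sbound r c * (A3 q U v w + A4 q U v w)"
  have two: "epowr 2 (1 + r) = ennreal (2 powr (1 + r))"
    using r_pos epowr_ennreal[of 2 "1 + r"] by simp
  have "epowr ?L r / epowr 2 (1 + r) \<le> ?I"
  proof (rule ennreal_le_if_less_imp_le)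
    fix z assume z: "?I < z" "z < top"
    have "0 < z" using z(1) by (rule le_less_trans[OF zero_le])
    then obtain B where B: "z = ennreal B" "0 < B" using z(2) by (cases z) auto
    define C where "C = (2 * B powr (1 / (1 + r))) powr (1 + 1 / r)"
    have "hardy_inequality q U v w (ennreal C)"
      unfolding hardy_inequality_def hardy_sides q_eq(2)[symmetric] C_def
    proof (intro ballI hardy_op_le v'_meas)
      show "(\<lambda>x. f x * indicator {0<..} x) \<in> borel_measurable lebesgue" if "f \<in> Mplus" for f
        using that by (simp add: Mplus_iff)
      show "3 * Sbound r c * (\<integral>\<^sup>+t\<in>{0<..}. (w' t * dens t) \<partial>lebesgue) \<le> ennreal B"
        using z B by (simp add: A_eq)
    qed (use B in \<open>auto simp: g'_def\<close>)
    then have "?L \<le> ennreal C" unfolding least_constant_def by (intro Inf_lower) simp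
    from epowr_mono[OF r_pos this] have "epowr ?L r \<le> ennreal (C powr r)"
      using r_pos by (simp add: epowr_ennreal C_def)
    also have "C powr r = 2 powr (1 + r) * B"
    proof -
      have "(1 + 1 / r) * r = 1 + r" "1 / (1 + r) * (1 + r) = 1" using r_pos by (auto simp: field_simps)
      moreover from this have "1 / (1 + r) * (1 + 1 / r) * r = 1" by (simp only: mult.assoc)
      ultimately have "C powr r = 2 powr (1 + r) * B powr 1"
        unfolding C_def by (simp only: powr_powr powr_mult)
      then show ?thesis using B by simp
    qed
    finally have "epowr ?L r \<le> epowr 2 (1 + r) * z"
      using B by (simp add: two ennreal_mult)
    then show "epowr ?L r / epowr 2 (1 + r) \<le> z"
      using two by (intro divide_le_posI_ennreal) auto
  qed
  then have "epowr 2 (1 + r) * (epowr ?L r / epowr 2 (1 + r)) \<le> epowr 2 (1 + r) * ?I"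
    by (rule mult_left_mono) simp
  moreover have "epowr 2 (1 + r) * (epowr ?L r / epowr 2 (1 + r)) = epowr ?L r * epowr 2 (1 + r) / epowr 2 (1 + r)"
    by (simp only: ennreal_times_divide mult.commute)
  moreover have "\<dots> = epowr ?L r"
    using two by (intro ennreal_mult_divide_eq) auto
  ultimately show ?thesis by (simp only: mult.assoc)
qed

lemma hardy_iff_least_constant:
  "(\<exists>C. 0 < C \<and> C < \<infinity> \<and> hardy_inequality q U v w C) \<longleftrightarrow> epowr (least_constant q U v w) r < top"
proof
  assume "\<exists>C. 0 < C \<and> C < \<infinity> \<and> hardy_inequality q U v w C"
  then have "least_constant q U v w < top"
    unfolding least_constant_def by (auto simp: Inf_less_iff)
  then show "epowr (least_constant q U v w) r < top" by (rule epowr_less_top[OF r_pos])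
next
  assume "epowr (least_constant q U v w) r < top"
  then have "least_constant q U v w \<noteq> top" using r_pos by (intro notI) simp
  then obtain C where C: "hardy_inequality q U v w C" "C < top"
    unfolding least_constant_def by (auto simp: Inf_less_iff less_top)
  \<comment> \<open>An admissible \<open>C\<close> may be 0, whereas assertion (i) asks for a
    positive constant.\<close>
  have "hardy_inequality q U v w (C + 1)"
    unfolding hardy_inequality_def
    by (intro ballI order_trans[OF bspec[OF C(1)[unfolded hardy_inequality_def]] mult_right_mono]) auto
  moreover have "0 < C + 1" "C + 1 < \<infinity>" using C(2) by (auto simp: zero_less_iff_neq_zero)
  ultimately show "\<exists>C. 0 < C \<and> C < \<infinity> \<and> hardy_inequality q U v w C" by blast
qed

end

lemma equiv_up_to_constantI:
  assumes "a < top" "b < top"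
    and "\<And>U v w. regular_kernel \<theta> U \<Longrightarrow> weight v \<Longrightarrow> weight w \<Longrightarrow> X U v w \<le> a * Y U v w"
    and "\<And>U v w. regular_kernel \<theta> U \<Longrightarrow> weight v \<Longrightarrow> weight w \<Longrightarrow> Y U v w \<le> b * X U v w"
  shows "equiv_up_to_constant \<theta> X Y"
  unfolding equiv_up_to_constant_def
proof (intro exI[of _ "enn2real a + enn2real b + 1"] conjI allI impI)
  have c: "a \<le> ennreal (enn2real a + enn2real b + 1)" "b \<le> ennreal (enn2real a + enn2real b + 1)"
    using assms(1,2) by (cases a; cases b; simp)+
  fix U v w assume *: "regular_kernel \<theta> U" "weight v" "weight w"
  show "X U v w \<le> ennreal (enn2real a + enn2real b + 1) * Y U v w"
    by (rule order_trans[OF assms(3)[OF *] mult_right_mono[OF c(1)]]) simp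
  show "Y U v w \<le> ennreal (enn2real a + enn2real b + 1) * X U v w"
    by (rule order_trans[OF assms(4)[OF *] mult_right_mono[OF c(2)]]) simp
qed (simp add: add_nonneg_pos)

theorem theorem8:
  fixes q \<theta> :: real
  assumes "0 < q" and "q < 1" and "0 < \<theta>"
  shows "(\<forall>U v w. regular_kernel \<theta> U \<longrightarrow> weight v \<longrightarrow> weight w \<longrightarrow>
            ((\<exists>C. 0 < C \<and> C < \<infinity> \<and> hardy_inequality q U v w C)
               \<longleftrightarrow> D3 q U v w < \<infinity> \<and> D4 q U v w < \<infinity>) \<and>
            (D3 q U v w < \<infinity> \<and> D4 q U v w < \<infinity>
               \<longleftrightarrow> A3 q U v w < \<infinity> \<and> A4 q U v w < \<infinity>)) \<and>
         equiv_up_to_constant \<theta>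
           (\<lambda>U v w. epowr (least_constant q U v w) (- conj_exp q))
           (\<lambda>U v w. D3 q U v w + D4 q U v w) \<and>
         equiv_up_to_constant \<theta>
           (\<lambda>U v w. D3 q U v w + D4 q U v w)
           (\<lambda>U v w. A3 q U v w + A4 q U v w)"
proof -
  define r where "r = q / (1 - q)"
  define c where "c = max 1 (\<theta> powr q)"
  have r: "0 < r" "- conj_exp q = r"
    using assms by (simp_all add: r_def conj_exp_def field_simps)
  define K1 where "K1 = epowr 2 (1 + r) * (3 * Sbound r c)"
  define K2 where "K2 = Abound r c"
  let ?L = "\<lambda>U v w. epowr (least_constant q U v w) r"
  let ?D = "\<lambda>U v w. D3 q U v w + D4 q U v w"
  let ?A = "\<lambda>U v w. A3 q U v w + A4 q U v w"
  have fin: "K1 < top" "K2 < top"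
    using r Sbound_less_top[of r c] Abound_less_top[of r c] epowr_less_top[of "1 + r" 2]
    by (auto simp: K1_def K2_def ennreal_mult_less_top)
  have chain: "?D U v w \<le> 2 * ?L U v w" "?L U v w \<le> K1 * ?A U v w" "?A U v w \<le> K2 * ?D U v w"
    and iff: "(\<exists>C. 0 < C \<and> C < \<infinity> \<and> hardy_inequality q U v w C) \<longleftrightarrow> ?L U v w < top"
    if "regular_kernel \<theta> U" "weight v" "weight w" for U v w
  proof -
    interpret hardy_setting q \<theta> r c U v w
      by unfold_locales (use assms that in \<open>simp_all add: r_def c_def\<close>)
    show "?D U v w \<le> 2 * ?L U v w" by (rule D_le_least_constant)
    show "?L U v w \<le> K1 * ?A U v w" unfolding K1_def by (rule least_constant_le_A)
    show "?A U v w \<le> K2 * ?D U v w" unfolding K2_def by (rule A_le_D)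
    show "(\<exists>C. 0 < C \<and> C < \<infinity> \<and> hardy_inequality q U v w C) \<longleftrightarrow> ?L U v w < top"
      by (rule hardy_iff_least_constant)
  qed
  have finite_iff: "?L U v w < top \<longleftrightarrow> ?D U v w < top" "?D U v w < top \<longleftrightarrow> ?A U v w < top"
    if *: "regular_kernel \<theta> U" "weight v" "weight w" for U v w
  proof -
    have "?D U v w < top" if "?L U v w < top"
      by (rule le_less_trans[OF chain(1)[OF *]]) (use that in \<open>simp add: ennreal_mult_less_top\<close>)
    moreover have "?L U v w < top" if "?A U v w < top"
      by (rule le_less_trans[OF chain(2)[OF *]]) (use that fin in \<open>simp add: ennreal_mult_less_top\<close>)
    moreover have "?A U v w < top" if "?D U v w < top"
      by (rule le_less_trans[OF chain(3)[OF *]]) (use that fin in \<open>simp add: ennreal_mult_less_top\<close>)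
    ultimately show "?L U v w < top \<longleftrightarrow> ?D U v w < top" "?D U v w < top \<longleftrightarrow> ?A U v w < top" by blast+
  qed
  show ?thesis
    unfolding r(2)
  proof (intro conjI allI impI)
    fix U v w assume *: "regular_kernel \<theta> U" "weight v" "weight w"
    show "(\<exists>C. 0 < C \<and> C < \<infinity> \<and> hardy_inequality q U v w C)
               \<longleftrightarrow> D3 q U v w < \<infinity> \<and> D4 q U v w < \<infinity>"
      unfolding iff[OF *] finite_iff(1)[OF *] by simp
    show "D3 q U v w < \<infinity> \<and> D4 q U v w < \<infinity> \<longleftrightarrow> A3 q U v w < \<infinity> \<and> A4 q U v w < \<infinity>"
      using finite_iff(2)[OF *] by simp
  next
    show "equiv_up_to_constant \<theta> ?L ?D"
    proof (rule equiv_up_to_constantI)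
      show "K1 * K2 < top" using fin by (simp add: ennreal_mult_less_top)
      show "?L U v w \<le> K1 * K2 * ?D U v w" if "regular_kernel \<theta> U" "weight v" "weight w" for U v w
        unfolding mult.assoc by (rule order_trans[OF chain(2)[OF that] mult_left_mono[OF chain(3)[OF that]]]) simp
      show "?D U v w \<le> 2 * ?L U v w" if "regular_kernel \<theta> U" "weight v" "weight w" for U v w
        by (rule chain(1)[OF that])
    qed simp
    show "equiv_up_to_constant \<theta> ?D ?A"
    proof (rule equiv_up_to_constantI)
      show "2 * K1 < top" using fin by (simp add: ennreal_mult_less_top)
      show "?D U v w \<le> 2 * K1 * ?A U v w" if "regular_kernel \<theta> U" "weight v" "weight w" for U v w
        unfolding mult.assoc by (rule order_trans[OF chain(1)[OF that] mult_left_mono[OF chain(2)[OF that]]]) simp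
      show "?A U v w \<le> K2 * ?D U v w" if "regular_kernel \<theta> U" "weight v" "weight w" for U v w
        by (rule chain(3)[OF that])
    qed (rule fin)
  qed
qed

end
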